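(* Assume $R=S/I$ is an Artinian compressed level algebra with initial degree $\tau$. (1) If $n=3$ and $\tau\ge 4$, or $n\ge 4$ and $\tau\ge 3$, then $R$ has minimal rate, i.e. $\operatorname{rate}(R)=m(I)-1$. (2) If $n=4$ and $\tau\ge 6$, or $n\ge 5$ and $\tau\ge 4$, then $R$ has minimal slant, i.e. $\operatorname{slant}(R)=\frac{m(I)}2$.
   Context: $\mathsf k$ is a field, $n\ge 2$, $S=\mathsf k[x_1,\dots,x_n]$ is standard graded, $I$ is a nonzero homogeneous ideal of $S$ contained in $(x_1,\dots,x_n)^2$, $R=S/I$, and $m(I)$ is the largest degree of a minimal generator of $I$. The initial degree of $I$ (or of $R$) is the smallest degree of a minimal generator of $I$. For $i\ge 0$ let $t_i^R(\mathsf k)=\sup\{j: \operatorname{Tor}_i^R(\mathsf k,\mathsf k)_j\ne 0\}$, where $j$ is the internal degree. Define $$\operatorname{rate}(R)=\sup_{i\ge 2}\frac{t_i^R(\mathsf k)-1}{i-1},\qquad \operatorname{slant}(R)=\sup_{i\ge 1}\frac{t_i^R(\mathsf k)}{i}.$$ An Artinian $R$ is level if its socle is concentrated in a single degree. A level Artinian $R$ with $s$-dimensional socle in degree $\rho$ is compressed if $\dim_{\mathsf k}R_d=\min\{\dim_{\mathsf k}S_d,\ s\dim_{\mathsf k}S_{\rho-d}\}$ for all $d$. *)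

theory Defs
  imports
    "HOL-Algebra.Algebra"
    "HOL-Algebra.Algebraic_Closure_Type"
    "HOL-Library.Poly_Mapping"
    "HOL-Library.Extended_Real"
    "HOL-Library.Cardinality"
begin

section \<open>Graded rings and their ideals\<close>

text \<open>
  A graded ring is given by a ring \<open>R\<close> together with the family
  \<open>gr :: int \<Rightarrow> 'a set\<close> of its homogeneous components.  Degrees are integers, so that
  expressions such as \<open>\<rho> - d\<close> are not truncated; the components of negative degree of the
  rings considered below are zero.
\<close>

definition irrelevant_ideal :: "'a ring \<Rightarrow> (int \<Rightarrow> 'a set) \<Rightarrow> 'a set"
  where "irrelevant_ideal R gr = Idl\<^bsub>R\<^esub> (\<Union>d\<in>{1..}. gr d)"

definition artinian_ring :: "'a ring \<Rightarrow> bool"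
  where "artinian_ring R \<longleftrightarrow>
    (\<forall>J :: nat \<Rightarrow> 'a set.
       (\<forall>k. ideal (J k) R) \<and> (\<forall>k. J (Suc k) \<subseteq> J k) \<longrightarrow> (\<exists>N. \<forall>k\<ge>N. J k = J N))"

definition homogeneous_ideal :: "'a ring \<Rightarrow> (int \<Rightarrow> 'a set) \<Rightarrow> 'a set \<Rightarrow> bool"
  where "homogeneous_ideal R gr I \<longleftrightarrow> (\<exists>G. G \<subseteq> (\<Union>d. gr d) \<and> I = Idl\<^bsub>R\<^esub> G)"

definition minimal_generating_set :: "'a ring \<Rightarrow> (int \<Rightarrow> 'a set) \<Rightarrow> 'a set \<Rightarrow> 'a set \<Rightarrow> bool"
  where "minimal_generating_set R gr I G \<longleftrightarrow>
    G \<subseteq> (\<Union>d. gr d) \<and> Idl\<^bsub>R\<^esub> G = I \<and> (\<forall>H. H \<subset> G \<longrightarrow> Idl\<^bsub>R\<^esub> H \<noteq> I)"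

definition generator_degrees :: "'a ring \<Rightarrow> (int \<Rightarrow> 'a set) \<Rightarrow> 'a set \<Rightarrow> int set"
  where "generator_degrees R gr I =
    {d. \<exists>G g. minimal_generating_set R gr I G \<and> g \<in> G \<and> g \<in> gr d}"

definition max_generator_degree :: "'a ring \<Rightarrow> (int \<Rightarrow> 'a set) \<Rightarrow> 'a set \<Rightarrow> int"
  where "max_generator_degree R gr I = Max (generator_degrees R gr I)"

definition initial_degree :: "'a ring \<Rightarrow> (int \<Rightarrow> 'a set) \<Rightarrow> 'a set \<Rightarrow> int"
  where "initial_degree R gr I = Min (generator_degrees R gr I)"

definition socle :: "'a ring \<Rightarrow> (int \<Rightarrow> 'a set) \<Rightarrow> 'a set"
  where "socle R gr =
    {r \<in> carrier R. \<forall>x \<in> irrelevant_ideal R gr. x \<otimes>\<^bsub>R\<^esub> r = \<zero>\<^bsub>R\<^esub>}"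


section \<open>Graded free resolutions of the residue field and Tor\<close>

definition self_module :: "'a ring \<Rightarrow> ('a, 'a) module"
  where "self_module R =
    \<lparr>carrier = carrier R, monoid.mult = monoid.mult R, one = \<one>\<^bsub>R\<^esub>, ring.zero = \<zero>\<^bsub>R\<^esub>,
     add = add R, module.smult = monoid.mult R\<rparr>"

definition residue_field :: "'a ring \<Rightarrow> (int \<Rightarrow> 'a set) \<Rightarrow> ('a, 'a set) module"
  where "residue_field R gr =
    (let m = irrelevant_ideal R gr; k = R Quot m in
     \<lparr>carrier = carrier k, monoid.mult = monoid.mult k, one = \<one>\<^bsub>k\<^esub>, ring.zero = \<zero>\<^bsub>k\<^esub>,
      add = add k, module.smult = (\<lambda>r x. (m +>\<^bsub>R\<^esub> r) \<otimes>\<^bsub>k\<^esub> x)\<rparr>)"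

text \<open>The direct sum of \<open>n\<close> copies of a module, and the map between two such sums given by an
  \<open>m \<times> n\<close> matrix \<open>A\<close> of ring elements.\<close>

definition copies :: "('a, 'b) module \<Rightarrow> nat \<Rightarrow> (nat \<Rightarrow> 'b) monoid"
  where "copies M n = product_group {..<n} (\<lambda>_. add_monoid M)"

definition mat_map ::
  "('a, 'b) module \<Rightarrow> nat \<Rightarrow> nat \<Rightarrow> (nat \<Rightarrow> nat \<Rightarrow> 'a) \<Rightarrow> (nat \<Rightarrow> 'b) \<Rightarrow> (nat \<Rightarrow> 'b)"
  where "mat_map M m n A x =
    (\<lambda>a\<in>{..<m}. \<Oplus>\<^bsub>M\<^esub>b\<in>{..<n}. A a b \<odot>\<^bsub>M\<^esub> x b)"

text \<open>
  The data of a sequence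
  \<open>\<dots> \<rightarrow> F\<^sub>2 \<rightarrow> F\<^sub>1 \<rightarrow> F\<^sub>0 \<rightarrow> k\<close> of graded free modules of finite rank:
  \<open>F\<^sub>i\<close> has a homogeneous basis of \<open>rank F i\<close> elements, of degrees \<open>bdeg F i a\<close>,
  \<open>dmat F i\<close> is the matrix of \<open>F\<^sub>i \<rightarrow> F\<^sub>i\<^sub>-\<^sub>1\<close> for \<open>i \<ge> 1\<close> (\<open>dmat F 0\<close> is not used), and
  \<open>aug F a\<close> is the image in the residue field of the \<open>a\<close>-th basis element of \<open>F\<^sub>0\<close>.
\<close>

record 'a free_complex =
  rank :: "nat \<Rightarrow> nat"
  bdeg :: "nat \<Rightarrow> nat \<Rightarrow> int"
  dmat :: "nat \<Rightarrow> nat \<Rightarrow> nat \<Rightarrow> 'a"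
  aug :: "nat \<Rightarrow> 'a set"

text \<open>The differential of \<open>F \<otimes> M\<close>, from homological degree \<open>Suc i\<close> to \<open>i\<close>; here
  \<open>F\<^sub>i \<otimes> M\<close> is the sum of \<open>rank F i\<close> copies of \<open>M\<close>.  The complex \<open>F\<close> itself is the case
  \<open>M = R\<close>.\<close>

definition differential ::
  "('a, 'b) module \<Rightarrow> 'a free_complex \<Rightarrow> nat \<Rightarrow> (nat \<Rightarrow> 'b) \<Rightarrow> (nat \<Rightarrow> 'b)"
  where "differential M F i = mat_map M (rank F i) (rank F (Suc i)) (dmat F (Suc i))"

definition augmentation ::
  "'a ring \<Rightarrow> (int \<Rightarrow> 'a set) \<Rightarrow> 'a free_complex \<Rightarrow> (nat \<Rightarrow> 'a) \<Rightarrow> 'a set"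
  where "augmentation R gr F x =
    (\<Oplus>\<^bsub>residue_field R gr\<^esub>a\<in>{..<rank F 0}. x a \<odot>\<^bsub>residue_field R gr\<^esub> aug F a)"

definition homogeneous_data :: "'a ring \<Rightarrow> (int \<Rightarrow> 'a set) \<Rightarrow> 'a free_complex \<Rightarrow> bool"
  where "homogeneous_data R gr F \<longleftrightarrow>
    (\<forall>i. \<forall>a<rank F i. \<forall>b<rank F (Suc i).
       dmat F (Suc i) a b \<in> gr (bdeg F (Suc i) b - bdeg F i a)) \<and>
    (\<forall>a<rank F 0. aug F a \<in> carrier (residue_field R gr) \<and>
       (bdeg F 0 a \<noteq> 0 \<longrightarrow> aug F a = \<zero>\<^bsub>residue_field R gr\<^esub>))"

definition graded_free_resolution :: "'a ring \<Rightarrow> (int \<Rightarrow> 'a set) \<Rightarrow> 'a free_complex \<Rightarrow> bool"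
  where "graded_free_resolution R gr F \<longleftrightarrow>
    homogeneous_data R gr F \<and>
    augmentation R gr F ` carrier (copies (self_module R) (rank F 0))
      = carrier (residue_field R gr) \<and>
    {x \<in> carrier (copies (self_module R) (rank F 0)).
        augmentation R gr F x = \<zero>\<^bsub>residue_field R gr\<^esub>}
      = differential (self_module R) F 0 ` carrier (copies (self_module R) (rank F 1)) \<and>
    (\<forall>i. {x \<in> carrier (copies (self_module R) (rank F (Suc i))).
            differential (self_module R) F i x = \<one>\<^bsub>copies (self_module R) (rank F i)\<^esub>}
         = differential (self_module R) F (Suc i)
             ` carrier (copies (self_module R) (rank F (Suc (Suc i)))))"

text \<open>The component of internal degree \<open>j\<close> of \<open>F\<^sub>i \<otimes> k\<close>, the residue field \<open>k\<close> being
  concentrated in degree \<open>0\<close>, and its cycles and boundaries.\<close>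

definition tensor_component ::
  "'a ring \<Rightarrow> (int \<Rightarrow> 'a set) \<Rightarrow> 'a free_complex \<Rightarrow> nat \<Rightarrow> int \<Rightarrow> (nat \<Rightarrow> 'a set) set"
  where "tensor_component R gr F i j =
    {x \<in> carrier (copies (residue_field R gr) (rank F i)).
       \<forall>a<rank F i. bdeg F i a \<noteq> j \<longrightarrow> x a = \<zero>\<^bsub>residue_field R gr\<^esub>}"

definition tensor_cycles ::
  "'a ring \<Rightarrow> (int \<Rightarrow> 'a set) \<Rightarrow> 'a free_complex \<Rightarrow> nat \<Rightarrow> int \<Rightarrow> (nat \<Rightarrow> 'a set) set"
  where "tensor_cycles R gr F i j =
    {x \<in> tensor_component R gr F i j.
       \<forall>i'. i = Suc i' \<longrightarrow>
         differential (residue_field R gr) F i' x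
           = \<one>\<^bsub>copies (residue_field R gr) (rank F i')\<^esub>}"

definition tensor_boundaries ::
  "'a ring \<Rightarrow> (int \<Rightarrow> 'a set) \<Rightarrow> 'a free_complex \<Rightarrow> nat \<Rightarrow> int \<Rightarrow> (nat \<Rightarrow> 'a set) set"
  where "tensor_boundaries R gr F i j =
    differential (residue_field R gr) F i ` tensor_component R gr F (Suc i) j"

text \<open>
  \<open>Tor R gr i j\<close> is the component of internal degree \<open>j\<close> of \<open>Tor\<^sub>i\<^sup>R(k, k)\<close>, as a group.  It is
  computed from an arbitrarily chosen resolution; when \<open>R\<close> is Noetherian, standard graded over a
  field, resolutions by free modules of finite rank exist and the choice does not matter up to
  isomorphism.
\<close>

definition Tor :: "'a ring \<Rightarrow> (int \<Rightarrow> 'a set) \<Rightarrow> nat \<Rightarrow> int \<Rightarrow> (nat \<Rightarrow> 'a set) set monoid"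
  where "Tor R gr i j =
    (let F = (SOME F. graded_free_resolution R gr F) in
     copies (residue_field R gr) (rank F i) \<lparr>carrier := tensor_cycles R gr F i j\<rparr>
       Mod tensor_boundaries R gr F i j)"

text \<open>Suprema are taken in the extended reals, so that no finiteness is presupposed and the
  supremum of the empty set is \<open>-\<infinity>\<close>.\<close>

definition top_degree :: "'a ring \<Rightarrow> (int \<Rightarrow> 'a set) \<Rightarrow> nat \<Rightarrow> ereal"
  where "top_degree R gr i = (SUP j\<in>{j. \<not> trivial_group (Tor R gr i j)}. ereal (of_int j))"

definition rate :: "'a ring \<Rightarrow> (int \<Rightarrow> 'a set) \<Rightarrow> ereal"
  where "rate R gr = (SUP i\<in>{2..}. (top_degree R gr i - 1) / ereal (real i - 1))"

definition slant :: "'a ring \<Rightarrow> (int \<Rightarrow> 'a set) \<Rightarrow> ereal"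
  where "slant R gr = (SUP i\<in>{1..}. top_degree R gr i / ereal (real i))"


section \<open>Polynomial rings and their quotients\<close>

text \<open>The variables are indexed by a finite type \<open>'n\<close>; a monomial is its exponent vector.\<close>

type_synonym ('n, 'k) mpoly = "('n \<Rightarrow>\<^sub>0 nat) \<Rightarrow>\<^sub>0 'k"

abbreviation poly_alg :: "('n::finite, 'k::field) mpoly ring"
  where "poly_alg \<equiv> ring_of_type_algebra"

definition variables :: "('n::finite, 'k::field) mpoly set"
  where "variables = range (\<lambda>i. Poly_Mapping.single (Poly_Mapping.single i 1) 1)"

definition constants :: "('n::finite, 'k::field) mpoly set"
  where "constants = range (Poly_Mapping.single 0)"

definition forms :: "int \<Rightarrow> ('n::finite, 'k::field) mpoly set"
  where "forms d =
    {f. \<forall>u \<in> Poly_Mapping.keys f. int (\<Sum>i\<in>UNIV. Poly_Mapping.lookup u i) = d}"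

definition quot_alg :: "('n::finite, 'k::field) mpoly set \<Rightarrow> ('n, 'k) mpoly set ring"
  where "quot_alg I = poly_alg Quot I"

definition quot_constants :: "('n::finite, 'k::field) mpoly set \<Rightarrow> ('n, 'k) mpoly set set"
  where "quot_constants I = (\<lambda>c. I +>\<^bsub>poly_alg\<^esub> c) ` constants"

definition quot_forms :: "('n::finite, 'k::field) mpoly set \<Rightarrow> int \<Rightarrow> ('n, 'k) mpoly set set"
  where "quot_forms I d = (\<lambda>f. I +>\<^bsub>poly_alg\<^esub> f) ` forms d"

text \<open>\<open>S/I\<close> is Artinian and level with socle of dimension \<open>s\<close> in degree \<open>\<rho>\<close>.\<close>

definition level :: "('n::finite, 'k::field) mpoly set \<Rightarrow> int \<Rightarrow> nat \<Rightarrow> bool"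
  where "level I \<rho> s \<longleftrightarrow>
    artinian_ring (quot_alg I) \<and>
    socle (quot_alg I) (quot_forms I) \<subseteq> quot_forms I \<rho> \<and>
    ring.dimension (quot_alg I) s (quot_constants I) (socle (quot_alg I) (quot_forms I))"

definition compressed_level :: "('n::finite, 'k::field) mpoly set \<Rightarrow> bool"
  where "compressed_level I \<longleftrightarrow>
    (\<exists>\<rho> s. level I \<rho> s \<and>
      (\<forall>d. ring.dim (quot_alg I) (quot_constants I) (quot_forms I d)
         = min (ring.dim (poly_alg :: ('n, 'k) mpoly ring) constants (forms d))
               (s * ring.dim (poly_alg :: ('n, 'k) mpoly ring) constants (forms (\<rho> - d)))))"

end

theory Submission
  imports Defs "HOL-Library.Function_Algebras"
begin

text \<open>
  Write \<open>T p\<close> for the top degree of \<open>Tor\<^sub>p\<^sup>R(k, k)\<close> and \<open>h i\<close> for that of the Koszul homology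
  \<open>H\<^sub>i(K)\<close> of \<open>R = S/I\<close>.  Breaking the Koszul complex \<open>K\<close> into the short exact sequences of its
  cycles and boundaries, and using that \<open>K\<close> is free over \<open>R\<close> and that \<open>H\<^sub>i(K)\<close> is a sum of shifted
  copies of \<open>k\<close>, one gets \<open>T p \<le> max (p, max\<^sub>i (T (p - 1 - i) + h i))\<close>, which is Serre's bound in
  terms of degrees.  For a compressed level algebra of socle degree \<open>\<rho>\<close>, multiplication into the socle
  identifies \<open>R\<^sub>d\<close> for \<open>d \<ge> \<tau>\<close> with the functions from the monomials of degree \<open>\<rho> - d\<close> to
  \<open>R\<^sub>\<rho>\<close>: this map is injective since \<open>R\<close> is level, and bijective by comparison of dimensions.  In
  these degrees \<open>K\<close> is therefore the Koszul complex of an inverse system, which is exact except at its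
  end, so \<open>h i \<le> \<tau> + i\<close> for \<open>i < n\<close>; moreover \<open>h 1 = m\<close> and \<open>h n = \<rho> + n \<le> 2 \<tau> - 1 + n\<close>.  With
  these values the recursion yields the upper bounds for rate and slant.  They are attained at
  \<open>p = 2\<close>: a minimal generator of degree \<open>m\<close> gives a nonzero class in \<open>H\<^sub>1(K)\<^sub>m\<close>, and hence in
  \<open>Tor\<^sub>2\<^sup>R(k, k)\<^sub>m\<close>.
\<close>

text \<open>Only vanishing of homology in single degrees is needed, so every module that occurs is
  taken as a subquotient \<open>M / N\<close> of the Koszul complex over the polynomial ring, and
  long exact sequences become implications between vanishing statements. \<open>Tor\<close> rests on
  an arbitrarily chosen resolution: one by free modules of finite rank has to be exhibited to make
  the choice meaningful, and the estimates have to hold for whichever one is chosen. The recursion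
  is used through a majorant \<open>a\<close> of \<open>T\<close> with
  \<open>a q + h i \<le> a (q + i + 1)\<close>. For the rate, the line
  \<open>1 + (p - 1) (m - 1)\<close> qualifies once \<open>h i \<le> 1 + i (m - 1)\<close>; for the
  slant, the line \<open>p m / 2\<close> qualifies once \<open>h i \<le> (i + 1) m / 2\<close>. The
  ranges of \<open>n\<close> and \<open>\<tau>\<close> are those in which these inequalities survive
  the worst case \<open>m = \<tau>\<close>: \<open>i = 2\<close> asks for \<tau> \<ge> 3 and \<tau>
  \<ge> 4 respectively, while \<open>i = n\<close>, where \<open>h\<close> may reach
  \<open>2 \<tau> - 1 + n\<close>, raises this to \<tau> \<ge> 4 for \<open>n = 3\<close> and to
  \<tau> \<ge> 6 for \<open>n = 4\<close>.\<close>

abbreviation (input) "lookup \<equiv> Poly_Mapping.lookup"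
abbreviation (input) "single \<equiv> Poly_Mapping.single"
abbreviation (input) "keys \<equiv> Poly_Mapping.keys"

section \<open>Homogeneous components and the maximal ideal\<close>

definition mdeg :: "('n::finite \<Rightarrow>\<^sub>0 nat) \<Rightarrow> nat"
  where "mdeg u = (\<Sum>i\<in>UNIV. lookup u i)"

definition pvar :: "'n::finite \<Rightarrow> ('n, 'k::field) mpoly"
  where "pvar i = single (single i 1) 1"

definition pconst :: "'k::field \<Rightarrow> ('n::finite, 'k) mpoly"
  where "pconst c = single 0 c"

definition hcomp :: "int \<Rightarrow> ('n::finite, 'k::field) mpoly \<Rightarrow> ('n, 'k) mpoly"
  where "hcomp d f = Abs_poly_mapping (\<lambda>u. if int (mdeg u) = d then lookup f u else 0)"

lemma lookup_hcomp:
  "lookup (hcomp d f) u = (if int (mdeg u) = d then lookup f u else 0)"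
proof -
  have "finite {u. (if int (mdeg u) = d then lookup f u else 0) \<noteq> 0}"
    by (rule finite_subset[OF _ finite_lookup[of f]]) auto
  then show ?thesis unfolding hcomp_def by simp
qed

lemma forms_iff: "f \<in> forms d \<longleftrightarrow> (\<forall>u. lookup f u \<noteq> 0 \<longrightarrow> int (mdeg u) = d)"
  by (auto simp: forms_def mdeg_def in_keys_iff)

lemma mdeg_add: "mdeg (u + v) = mdeg u + mdeg v"
  by (simp add: mdeg_def lookup_add sum.distrib)

lemma mdeg_0 [simp]: "mdeg 0 = 0"
  by (simp add: mdeg_def)

lemma mdeg_single [simp]: "mdeg (single i k) = k"
  by (simp add: mdeg_def lookup_single when_def)

lemma mdeg_eq_0_iff: "mdeg u = 0 \<longleftrightarrow> u = 0"
  by (auto simp: mdeg_def intro: poly_mapping_eqI)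

lemma forms_0 [simp]: "0 \<in> forms d"
  by (simp add: forms_iff)

lemma forms_add: "f \<in> forms d \<Longrightarrow> g \<in> forms d \<Longrightarrow> f + g \<in> forms d"
  unfolding forms_iff by (metis lookup_add add.right_neutral)

lemma forms_uminus: "f \<in> forms d \<Longrightarrow> - f \<in> forms d"
  by (simp add: forms_iff)

lemma forms_diff: "f \<in> forms d \<Longrightarrow> g \<in> forms d \<Longrightarrow> f - g \<in> forms d"
  using forms_add[of f d "- g"] forms_uminus by auto

lemma forms_sum: "(\<And>a. a \<in> A \<Longrightarrow> f a \<in> forms d) \<Longrightarrow> sum f A \<in> forms d"
  by (induction A rule: infinite_finite_induct) (auto intro: forms_add)

lemma forms_single: "int (mdeg u) = d \<Longrightarrow> single u c \<in> forms d"
  by (auto simp: forms_iff lookup_single when_def)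

lemma forms_pvar: "pvar i \<in> forms 1"
  by (simp add: pvar_def forms_single)

lemma forms_pconst: "pconst c \<in> forms 0"
  by (simp add: pconst_def forms_single)

lemma forms_mult: "f \<in> forms d \<Longrightarrow> g \<in> forms e \<Longrightarrow> f * g \<in> forms (d + e)"
  unfolding forms_def using keys_mult[of f g]
  by (auto simp: lookup_add sum.distrib dest!: subsetD)

lemma forms_mult_eq: "f \<in> forms d \<Longrightarrow> g \<in> forms e \<Longrightarrow> d + e = c \<Longrightarrow> f * g \<in> forms c"
  using forms_mult by blast

lemma forms_neg: "f \<in> forms d \<Longrightarrow> d < 0 \<Longrightarrow> f = 0"
  by (rule poly_mapping_eqI) (force simp: forms_iff)

lemma forms_0_eq_pconst: "f \<in> forms 0 \<Longrightarrow> f = pconst (lookup f 0)"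
  by (rule poly_mapping_eqI)
    (auto simp: forms_iff pconst_def lookup_single when_def mdeg_eq_0_iff)

lemma forms_distinct: "f \<in> forms d \<Longrightarrow> f \<in> forms e \<Longrightarrow> d \<noteq> e \<Longrightarrow> f = 0"
  by (rule poly_mapping_eqI) (force simp: forms_iff)

lemma hcomp_forms [simp]: "hcomp d f \<in> forms d"
  by (auto simp: forms_iff lookup_hcomp split: if_splits)

lemma hcomp_add: "hcomp d (f + g) = hcomp d f + hcomp d g"
  by (rule poly_mapping_eqI) (simp add: lookup_hcomp lookup_add)

lemma hcomp_0 [simp]: "hcomp d 0 = 0"
  by (rule poly_mapping_eqI) (simp add: lookup_hcomp)

lemma hcomp_uminus: "hcomp d (- f) = - hcomp d f"
  by (rule poly_mapping_eqI) (simp add: lookup_hcomp)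

lemma hcomp_diff: "hcomp d (f - g) = hcomp d f - hcomp d g"
  by (rule poly_mapping_eqI) (simp add: lookup_hcomp lookup_minus)

lemma hcomp_sum: "hcomp d (sum f A) = (\<Sum>a\<in>A. hcomp d (f a))"
  by (induction A rule: infinite_finite_induct) (auto simp: hcomp_add)

lemma hcomp_eq: "f \<in> forms d \<Longrightarrow> hcomp d f = f"
  by (rule poly_mapping_eqI) (auto simp: lookup_hcomp forms_iff)

lemma hcomp_eq_0: "f \<in> forms d \<Longrightarrow> d \<noteq> e \<Longrightarrow> hcomp e f = 0"
  by (rule poly_mapping_eqI) (auto simp: lookup_hcomp forms_iff)

lemma hcomp_decomp: "\<exists>N::nat. f = (\<Sum>d\<in>{..<N}. hcomp (int d) f)"
proof -
  define N where "N = Suc (\<Sum>u\<in>keys f. mdeg u)"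
  have "lookup f u = lookup (\<Sum>d\<in>{..<N}. hcomp (int d) f) u" for u
  proof (cases "lookup f u = 0")
    case False
    then have "mdeg u \<le> (\<Sum>u\<in>keys f. mdeg u)"
      by (intro member_le_sum) (auto simp: in_keys_iff)
    then have "mdeg u < N" by (simp add: N_def)
    then show ?thesis by (simp add: lookup_sum lookup_hcomp)
  qed (simp add: lookup_sum lookup_hcomp)
  then show ?thesis by (meson poly_mapping_eqI)
qed

lemma hcomp_mult:
  assumes "f \<in> forms d"
  shows "hcomp e (f * g) = f * hcomp (e - d) g"
proof -
  obtain N where N: "g = (\<Sum>j\<in>{..<N::nat}. hcomp (int j) g)"
    using hcomp_decomp by blast
  have "hcomp e (f * hcomp (int j) g) = f * hcomp (e - d) (hcomp (int j) g)" for j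
  proof (cases "int j = e - d")
    case True
    then show ?thesis
      using hcomp_eq[OF forms_mult_eq[OF assms hcomp_forms[of "int j" g], of e]]
      by (simp add: hcomp_eq)
  next
    case False
    then show ?thesis
      using hcomp_eq_0[OF forms_mult[OF assms hcomp_forms[of "int j" g]], of e]
        hcomp_eq_0[OF hcomp_forms False, of g] by auto
  qed
  then have "(\<Sum>j\<in>{..<N}. hcomp e (f * hcomp (int j) g))
      = (\<Sum>j\<in>{..<N}. f * hcomp (e - d) (hcomp (int j) g))"
    by simp
  then have "hcomp e (f * (\<Sum>j\<in>{..<N}. hcomp (int j) g)) = f * hcomp (e - d) (\<Sum>j\<in>{..<N}. hcomp (int j) g)"
    by (simp add: hcomp_sum sum_distrib_left)
  then show ?thesis by (simp only: N[symmetric])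
qed

lemma pconst_add: "pconst (a + b) = pconst a + pconst b"
  by (simp add: pconst_def single_add)

lemma pconst_mult: "pconst (a * b) = pconst a * pconst b"
  by (simp add: pconst_def mult_single)

lemma pconst_0 [simp]: "pconst 0 = 0"
  by (simp add: pconst_def)

lemma pconst_1 [simp]: "pconst 1 = 1"
  by (simp add: pconst_def)

lemma lookup_single_mult:
  "lookup (single u c * f) (u + v) = c * lookup f v"
  for u v :: "'n::finite \<Rightarrow>\<^sub>0 nat"
proof -
  have "f = (\<Sum>w\<in>keys f. single w (lookup f w))"
    by (rule poly_mapping_eqI) (simp add: lookup_sum lookup_single when_def in_keys_iff)
  then have "single u c * f
      = (\<Sum>w\<in>keys f. single (u + w) (c * lookup f w))"
    by (metis (mono_tags, lifting) mult_single sum.cong sum_distrib_left)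
  then show ?thesis
    by (simp add: lookup_sum lookup_single when_def in_keys_iff)
qed

lemma lookup_pconst_mult: "lookup (pconst c * f) u = c * lookup f u"
  using lookup_single_mult[of 0 c f u] by (simp add: pconst_def)

lemma monomial_sum: "f = (\<Sum>w\<in>keys f. single w (lookup f w))"
  by (rule poly_mapping_eqI) (simp add: lookup_sum lookup_single when_def in_keys_iff)

lemma lookup_0_add: "u + v = 0 \<longleftrightarrow> u = 0 \<and> v = 0" for u v :: "'n::finite \<Rightarrow>\<^sub>0 nat"
  using mdeg_add[of u v] by (auto simp: mdeg_eq_0_iff[symmetric])

text \<open>A monomial of positive degree times \<open>g\<close> has no constant term. Hence the
  polynomials with \<open>lookup f 0 = 0\<close> form the maximal ideal, and the constant
  coefficient serves as the class in \<open>k\<close>.\<close>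

lemma const_mult: "lookup (f * g) 0 = lookup f 0 * lookup g 0"
  for f g :: "('n::finite, 'k::field) mpoly"
proof -
  have f: "f = pconst (lookup f 0) + (\<Sum>w\<in>keys f - {0}. single w (lookup f w))"
    by (rule poly_mapping_eqI)
      (auto simp: lookup_add pconst_def lookup_sum lookup_single when_def in_keys_iff sum.delta')
  have "lookup (single w c * g) 0 = 0" if "w \<noteq> 0" for w c
  proof -
    have "0 \<notin> keys (single w c * g)"
    proof
      assume "0 \<in> keys (single w c * g)"
      then obtain v where "0 = w + v"
        using keys_mult[of "single w c" g] by (auto split: if_splits)
      then show False using that lookup_0_add[of w v] by simp
    qed
    then show ?thesis by (simp add: in_keys_iff)
  qed
  then have "lookup ((\<Sum>w\<in>keys f - {0}. single w (lookup f w)) * g) 0 = 0"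
    by (simp add: sum_distrib_right lookup_sum)
  then show ?thesis
    by (subst f) (simp only: distrib_right lookup_add lookup_pconst_mult, simp)
qed

text \<open>Each monomial is divided by one of its variables.\<close>

lemma max_ideal_decomp:
  fixes f :: "('n::finite, 'k::field) mpoly"
  assumes "lookup f 0 = 0"
  shows "\<exists>g. f = (\<Sum>i\<in>UNIV. pvar i * g i) \<and> (\<forall>d. f \<in> forms d \<longrightarrow> (\<forall>i. g i \<in> forms (d - 1)))"
proof -
  have "\<exists>i. lookup u i \<noteq> 0" if "u \<noteq> 0" for u :: "'n \<Rightarrow>\<^sub>0 nat"
    using that by (metis poly_mapping_eqI lookup_zero)
  then obtain \<iota> where \<iota>: "\<And>u. u \<noteq> 0 \<Longrightarrow> lookup u (\<iota> u :: 'n) \<noteq> (0::nat)"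
    by metis
  define e where "e i = (single i 1 :: 'n \<Rightarrow>\<^sub>0 nat)" for i
  have e: "e (\<iota> u) + (u - e (\<iota> u)) = u" if "u \<noteq> 0" for u
    using \<iota>[OF that] by (intro poly_mapping_eqI) (auto simp: e_def lookup_add lookup_minus lookup_single when_def)
  define g where "g i = (\<Sum>u\<in>{u\<in>keys f. \<iota> u = i}. single (u - e i) (lookup f u))" for i
  have "(\<Sum>i\<in>UNIV. pvar i * g i) = (\<Sum>i\<in>UNIV. \<Sum>u\<in>{u\<in>keys f. \<iota> u = i}. single (e i + (u - e i)) (lookup f u))"
    by (simp add: g_def sum_distrib_left pvar_def mult_single e_def)
  also have "\<dots> = (\<Sum>i\<in>UNIV. \<Sum>u\<in>{u\<in>keys f. \<iota> u = i}. single u (lookup f u))"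
    using assms e by (intro sum.cong refl) (metis (mono_tags, lifting) in_keys_iff mem_Collect_eq)
  also have "\<dots> = (\<Sum>u\<in>keys f. single u (lookup f u))"
    by (rule sum.group) auto
  finally have "f = (\<Sum>i\<in>UNIV. pvar i * g i)" using monomial_sum[of f] by simp
  moreover have "g i \<in> forms (d - 1)" if "f \<in> forms d" for d i
    unfolding g_def
  proof (intro forms_sum forms_single)
    fix u assume u: "u \<in> {u \<in> keys f. \<iota> u = i}"
    then have "u \<noteq> 0" using assms by (auto simp: in_keys_iff)
    then have "mdeg u = 1 + mdeg (u - e i)"
      using e[of u] u mdeg_add[of "e i" "u - e i"] by (auto simp: e_def)
    moreover have "int (mdeg u) = d" using that u by (auto simp: forms_iff in_keys_iff)
    ultimately show "int (mdeg (u - e i)) = d - 1" by simp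
  qed
  ultimately show ?thesis by blast
qed

lemma const_forms: "f \<in> forms d \<Longrightarrow> d \<noteq> 0 \<Longrightarrow> lookup f 0 = 0"
  by (force simp: forms_iff)

lemma const_hcomp: "lookup (hcomp d f) 0 = (if d = 0 then lookup f 0 else 0)"
  by (auto simp: lookup_hcomp)

lemma finite_mdeg: "finite {u :: 'n::finite \<Rightarrow>\<^sub>0 nat. mdeg u = d}"
proof -
  have "lookup ` {u :: 'n \<Rightarrow>\<^sub>0 nat. mdeg u = d} \<subseteq> Pi\<^sub>E UNIV (\<lambda>_. {..d})"
    by (auto simp: mdeg_def intro!: member_le_sum)
  then have "finite (lookup ` {u :: 'n \<Rightarrow>\<^sub>0 nat. mdeg u = d})"
    by (rule finite_subset) (intro finite_PiE, auto)
  then show ?thesis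
    by (rule finite_imageD) (auto simp: inj_on_def intro: poly_mapping_eqI)
qed

text \<open>Homogeneity is recorded as closure under components rather than by generators, because
  witnesses are constantly replaced by their components; \<open>gideal_homogeneous\<close> links the
  two forms.\<close>

definition gideal :: "('n::finite, 'k::field) mpoly set \<Rightarrow> bool"
  where "gideal I \<longleftrightarrow> 0 \<in> I \<and> (\<forall>f\<in>I. \<forall>g\<in>I. f + g \<in> I) \<and> (\<forall>f\<in>I. \<forall>h. h * f \<in> I) \<and>
    (\<forall>f\<in>I. \<forall>d. hcomp d f \<in> I)"

lemma gideal_sum: "gideal I \<Longrightarrow> (\<And>a. a \<in> A \<Longrightarrow> f a \<in> I) \<Longrightarrow> sum f A \<in> I"
  by (induction A rule: infinite_finite_induct) (auto simp: gideal_def)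

lemma gideal_uminus: "gideal I \<Longrightarrow> f \<in> I \<Longrightarrow> - f \<in> I"
  unfolding gideal_def by (metis mult_minus1)

lemma gideal_diff: "gideal I \<Longrightarrow> f \<in> I \<Longrightarrow> g \<in> I \<Longrightarrow> f - g \<in> I"
  using gideal_uminus[of I g] unfolding gideal_def by (metis diff_conv_add_uminus)

section \<open>The Koszul complex\<close>

text \<open>The index type carries no order, so an arbitrary numbering of the variables fixes the
  signs.\<close>

definition vidx :: "'n::finite \<Rightarrow> nat"
  where "vidx = (SOME f. inj f)"

lemma inj_vidx: "inj (vidx :: 'n::finite \<Rightarrow> nat)"
proof -
  have "\<exists>f :: 'n \<Rightarrow> nat. inj f"
    using finite_imp_inj_to_nat_seg[of "UNIV :: 'n set"] by auto
  then show ?thesis unfolding vidx_def by (rule someI_ex)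
qed

definition ksign :: "'n::finite \<Rightarrow> 'n set \<Rightarrow> 'a::comm_ring_1"
  where "ksign i s = (-1) ^ card {l\<in>s. vidx l < vidx i}"

text \<open>An element of the Koszul complex is the function sending \<open>s\<close> to its
  coefficient at the exterior basis vector of \<open>s\<close>, in all homological degrees at once.
  The scalars \<open>x\<close> stay general because both the variables and the constant
  \<open>1\<close> are substituted later.\<close>

definition kdiff :: "('n::finite \<Rightarrow> 'a::comm_ring_1) \<Rightarrow> ('n set \<Rightarrow> 'a) \<Rightarrow> 'n set \<Rightarrow> 'a"
  where "kdiff x z s = (\<Sum>i\<in>-s. ksign i s * x i * z (insert i s))"

definition kwedge :: "'n::finite \<Rightarrow> ('n set \<Rightarrow> 'a::comm_ring_1) \<Rightarrow> 'n set \<Rightarrow> 'a"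
  where "kwedge i z s = (if i \<in> s then ksign i (s - {i}) * z (s - {i}) else 0)"

lemma ksign_sq [simp]: "ksign i s * ksign i s = 1"
  by (simp add: ksign_def power_add[symmetric])

lemma ksign_sq' [simp]: "ksign i s * (ksign i s * a) = a"
  by (simp add: mult.assoc[symmetric])

lemma ksign_insert:
  assumes "l \<notin> s"
  shows "ksign i (insert l s) = (if vidx l < vidx i then - ksign i s else ksign i s)"
proof -
  have "{k \<in> insert l s. vidx k < vidx i} = (if vidx l < vidx i then insert l {k\<in>s. vidx k < vidx i} else {k\<in>s. vidx k < vidx i})"
    by auto
  then show ?thesis using assms by (simp add: ksign_def)
qed

lemma vidx_linear: "i \<noteq> l \<Longrightarrow> vidx i < vidx l \<longleftrightarrow> \<not> vidx l < vidx i"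
  using inj_vidx by (metis injD linorder_neqE_nat not_less_iff_gr_or_eq)

lemma ksign_swap:
  assumes "i \<notin> s" "l \<notin> s" "i \<noteq> l"
  shows "ksign l s * ksign i (insert l s) = - (ksign i s * ksign l (insert i s))"
  using assms vidx_linear[of i l] by (auto simp: ksign_insert mult.commute)

text \<open>If \<open>i\<close> lies outside \<open>s\<close>, only the summand inserting
  \<open>i\<close> survives; if \<open>i\<close> lies in \<open>s\<close>, the other summands cancel
  because exchanging two insertions flips the sign. With the variables as scalars this makes them
  act as zero on Koszul homology, with \<open>1\<close> it contracts the inverse system.\<close>

lemma koszul_homotopy:
  fixes x :: "'n::finite \<Rightarrow> 'a::comm_ring_1"
  shows "kdiff x (kwedge i z) s + kwedge i (kdiff x z) s = x i * z s"
proof (cases "i \<in> s")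
  case False
  have "kdiff x (kwedge i z) s = (\<Sum>l\<in>-s. if l = i then x i * z s else 0)"
    unfolding kdiff_def using False
    by (intro sum.cong refl) (auto simp: kwedge_def mult.assoc mult.left_commute)
  then show ?thesis using False by (simp add: kwedge_def)
next
  case True
  define t where "t = s - {i}"
  have s: "s = insert i t" "i \<notin> t" using True by (auto simp: t_def)
  have Cs: "- t = insert i (- s)" using s by auto
  have "kwedge i (kdiff x z) s = ksign i t * (ksign i t * x i * z s + (\<Sum>l\<in>-s. ksign l t * x l * z (insert l t)))"
    using True by (simp add: kwedge_def t_def[symmetric] kdiff_def Cs s)
  also have "\<dots> = x i * z s + (\<Sum>l\<in>-s. ksign i t * (ksign l t * x l * z (insert l t)))"
    by (simp add: distrib_left sum_distrib_left mult.assoc)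
  finally have 1: "kwedge i (kdiff x z) s = \<dots>" .
  have "kdiff x (kwedge i z) s = (\<Sum>l\<in>-s. - (ksign i t * (ksign l t * x l * z (insert l t))))"
    unfolding kdiff_def
  proof (intro sum.cong refl)
    fix l assume l: "l \<in> - s"
    then have "insert l s - {i} = insert l t" "l \<noteq> i" using s by auto
    moreover have "ksign l s * ksign i (insert l t) = - (ksign i t * ksign l t :: 'a)"
      using l s vidx_linear[of i l] by (auto simp: ksign_insert mult.commute)
    ultimately have 1: "insert l s - {i} = insert l t" "ksign l s * ksign i (insert l t) = - (ksign i t * ksign l t :: 'a)"
      by auto
    have "ksign l s * x l * kwedge i z (insert l s) = (ksign l s * ksign i (insert l t)) * (x l * z (insert l t))"
      using True by (simp add: kwedge_def 1(1) mult_ac)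
    also have "\<dots> = - (ksign i t * (ksign l t * x l * z (insert l t)))"
      by (simp add: 1(2) mult.assoc)
    finally show "ksign l s * x l * kwedge i z (insert l s) = - (ksign i t * (ksign l t * x l * z (insert l t)))" .
  qed
  then show ?thesis by (simp add: 1 sum_negf)
qed

text \<open>Exchanging the two inserted indices changes the sign by \<open>ksign_swap\<close>.
  Splitting the pairs by the numbering \<open>vidx\<close> makes the two halves cancel in every
  characteristic.\<close>

lemma kdiff_kdiff:
  fixes x :: "'n::finite \<Rightarrow> 'a::comm_ring_1"
  shows "kdiff x (kdiff x z) s = 0"
proof -
  define P where "P = {(l, i). l \<notin> s \<and> i \<notin> s \<and> vidx l < vidx i}"
  define Q where "Q = {(l, i). l \<notin> s \<and> i \<notin> s \<and> vidx i < vidx l}"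
  define t where "t = (\<lambda>(l, i). ksign l s * x l * (ksign i (insert l s) * x i * z (insert i (insert l s))))"
  have "kdiff x (kdiff x z) s = (\<Sum>p\<in>Sigma (-s) (\<lambda>l. - insert l s). t p)"
  proof -
    have "kdiff x (kdiff x z) s = (\<Sum>l\<in>-s. \<Sum>i\<in>- insert l s. t (l, i))"
      by (simp add: kdiff_def t_def sum_distrib_left)
    also have "\<dots> = (\<Sum>(l, i)\<in>Sigma (-s) (\<lambda>l. - insert l s). t (l, i))"
      by (rule sum.Sigma) auto
    finally show ?thesis by (simp only: case_prod_unfold prod.collapse)
  qed
  also have "Sigma (-s) (\<lambda>l. - insert l s) = P \<union> Q"
  proof -
    have "l \<noteq> i \<longleftrightarrow> vidx l < vidx i \<or> vidx i < vidx l" for l i :: 'n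
      using vidx_linear[of l i] by auto
    then show ?thesis by (auto simp: P_def Q_def)
  qed
  also have "(\<Sum>p\<in>P\<union>Q. t p) = sum t P + sum t Q"
    by (intro sum.union_disjoint) (auto simp: P_def Q_def)
  also have "sum t Q = (\<Sum>p\<in>P. t (prod.swap p))"
    by (rule sum.reindex_bij_witness[of _ prod.swap prod.swap]) (auto simp: P_def Q_def)
  also have "\<dots> = (\<Sum>p\<in>P. - t p)"
  proof (intro sum.cong refl)
    fix p assume "p \<in> P"
    then obtain l i where p: "p = (l, i)" "l \<notin> s" "i \<notin> s" "l \<noteq> i" by (auto simp: P_def)
    have "t (l, i) = (ksign l s * ksign i (insert l s)) * (x l * x i * z (insert i (insert l s)))"
      by (simp add: t_def mult_ac)
    also have "\<dots> = (- (ksign i s * ksign l (insert i s))) * (x l * x i * z (insert i (insert l s)))"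
      by (simp only: ksign_swap[OF p(3,2) p(4)[symmetric]])
    also have "\<dots> = - t (i, l)"
      by (simp add: t_def mult_ac insert_commute)
    finally show "t (prod.swap p) = - t p" by (simp add: p)
  qed
  finally show ?thesis by (simp add: sum_negf)
qed

section \<open>Tensoring a resolution with subquotients of the Koszul complex\<close>

type_synonym ('n, 'k) kvec = "'n set \<Rightarrow> ('n, 'k) mpoly"

definition ksmult :: "('n::finite, 'k::field) mpoly \<Rightarrow> ('n, 'k) kvec \<Rightarrow> ('n, 'k) kvec"
  where "ksmult f z = (\<lambda>s. f * z s)"

text \<open>The exterior basis vector of \<open>s\<close> has internal degree \<open>card s\<close>,
  so that the Koszul differential preserves internal degree.\<close>

definition khom :: "int \<Rightarrow> ('n::finite, 'k::field) kvec \<Rightarrow> bool"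
  where "khom e z \<longleftrightarrow> (\<forall>s. z s \<in> forms (e - int (card s)))"

definition khcomp :: "int \<Rightarrow> ('n::finite, 'k::field) kvec \<Rightarrow> ('n, 'k) kvec"
  where "khcomp e z = (\<lambda>s. hcomp (e - int (card s)) (z s))"

definition gsub :: "('n::finite, 'k::field) kvec set \<Rightarrow> bool"
  where "gsub M \<longleftrightarrow> 0 \<in> M \<and> (\<forall>x\<in>M. \<forall>y\<in>M. x + y \<in> M) \<and> (\<forall>x\<in>M. \<forall>f. ksmult f x \<in> M) \<and>
    (\<forall>x\<in>M. \<forall>e. khcomp e x \<in> M)"

lemma gsub_0: "gsub M \<Longrightarrow> 0 \<in> M"
  and gsub_add: "gsub M \<Longrightarrow> x \<in> M \<Longrightarrow> y \<in> M \<Longrightarrow> x + y \<in> M"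
  and gsub_smult: "gsub M \<Longrightarrow> x \<in> M \<Longrightarrow> ksmult f x \<in> M"
  and gsub_khcomp: "gsub M \<Longrightarrow> x \<in> M \<Longrightarrow> khcomp e x \<in> M"
  by (auto simp: gsub_def)

lemma ksmult_minus1: "ksmult (-1) z = - z"
  by (auto simp: ksmult_def fun_eq_iff)

lemma gsub_uminus: "gsub M \<Longrightarrow> x \<in> M \<Longrightarrow> - x \<in> M"
  using gsub_smult[of M x "-1"] by (simp add: ksmult_minus1)

lemma gsub_diff: "gsub M \<Longrightarrow> x \<in> M \<Longrightarrow> y \<in> M \<Longrightarrow> x - y \<in> M"
  using gsub_add[of M x "- y"] gsub_uminus[of M y] by simp

lemma gsub_sum: "gsub M \<Longrightarrow> (\<And>a. a \<in> A \<Longrightarrow> f a \<in> M) \<Longrightarrow> sum f A \<in> M"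
  by (induction A rule: infinite_finite_induct) (auto intro: gsub_0 gsub_add)

lemma gsub_diff_trans: "gsub M \<Longrightarrow> x - y \<in> M \<Longrightarrow> y \<in> M \<Longrightarrow> x \<in> M"
  using gsub_add[of M "x - y" y] by simp

lemma sum_fun_apply: "(sum f A) s = (\<Sum>a\<in>A. f a s)"
  for f :: "'a \<Rightarrow> 'b \<Rightarrow> 'c::ab_group_add"
  by (induction A rule: infinite_finite_induct) auto

lemma khom_add: "khom e x \<Longrightarrow> khom e y \<Longrightarrow> khom e (x + y)"
  and khom_diff: "khom e x \<Longrightarrow> khom e y \<Longrightarrow> khom e (x - y)"
  and khom_0: "khom e 0"
  by (auto simp: khom_def intro: forms_add forms_diff)

lemma khom_smult: "f \<in> forms d \<Longrightarrow> khom e x \<Longrightarrow> d + e = c \<Longrightarrow> khom c (ksmult f x)"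
  unfolding khom_def ksmult_def by (auto intro!: forms_mult_eq)

lemma khom_sum: "(\<And>a. a \<in> A \<Longrightarrow> khom e (f a)) \<Longrightarrow> khom e (sum f A)"
  by (induction A rule: infinite_finite_induct) (auto intro: khom_0 khom_add)

lemma khcomp_khom [simp]: "khom e (khcomp e z)"
  by (simp add: khom_def khcomp_def)

lemma khcomp_eq: "khom e z \<Longrightarrow> khcomp e z = z"
  by (auto simp: khom_def khcomp_def hcomp_eq)

lemma khcomp_eq_0: "khom d z \<Longrightarrow> d \<noteq> e \<Longrightarrow> khcomp e z = 0"
  by (auto simp: khom_def khcomp_def fun_eq_iff intro!: hcomp_eq_0)

lemma khcomp_diff: "khcomp e (x - y) = khcomp e x - khcomp e y"
  by (auto simp: khcomp_def fun_eq_iff hcomp_diff)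

lemma ksmult_add: "ksmult f (x + y) = ksmult f x + ksmult f y"
  and ksmult_diff: "ksmult f (x - y) = ksmult f x - ksmult f y"
  and ksmult_add_left: "ksmult (f + g) x = ksmult f x + ksmult g x"
  and ksmult_diff_left: "ksmult (f - g) x = ksmult f x - ksmult g x"
  and ksmult_mult: "ksmult (f * g) x = ksmult f (ksmult g x)"
  and ksmult_0_left [simp]: "ksmult 0 x = 0"
  and ksmult_0 [simp]: "ksmult f 0 = 0"
  and ksmult_1 [simp]: "ksmult 1 x = x"
  by (auto simp: ksmult_def fun_eq_iff algebra_simps)

lemma ksmult_sum_left: "ksmult (sum f A) x = (\<Sum>a\<in>A. ksmult (f a) x)"
  by (induction A rule: infinite_finite_induct) (simp_all add: ksmult_add_left)

lemma ksmult_sum: "ksmult f (sum x A) = (\<Sum>a\<in>A. ksmult f (x a))"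
  by (simp add: ksmult_def fun_eq_iff sum_fun_apply sum_distrib_left)

text \<open>A polynomial without constant term is a combination of the variables.\<close>

lemma gsub_max_ideal:
  assumes "gsub N" "\<And>i. ksmult (pvar i) g \<in> N" "lookup f 0 = 0"
  shows "ksmult f g \<in> N"
proof -
  obtain h where "f = (\<Sum>i\<in>UNIV. pvar i * h i)"
    using max_ideal_decomp[OF assms(3)] by blast
  then have "ksmult f g = (\<Sum>i\<in>UNIV. ksmult (h i) (ksmult (pvar i) g))"
    by (simp add: ksmult_sum_left ksmult_mult[symmetric] mult.commute)
  moreover have "\<dots> \<in> N" by (intro gsub_sum gsub_smult[OF assms(1) assms(2)] assms(1))
  ultimately show ?thesis by metis
qed

abbreviation kd :: "('n::finite, 'k::field) kvec \<Rightarrow> ('n, 'k) kvec"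
  where "kd \<equiv> kdiff pvar"

lemma kd_add: "kd (x + y) = kd x + kd y"
  and kd_diff: "kd (x - y) = kd x - kd y"
  and kd_0: "kd 0 = 0"
  and kd_smult: "kd (ksmult f x) = ksmult f (kd x)"
  by (auto simp: kdiff_def ksmult_def fun_eq_iff algebra_simps sum.distrib sum_subtractf sum_distrib_left)

lemma kd_sum: "kd (sum x A) = (\<Sum>a\<in>A. kd (x a))"
proof (induction A rule: infinite_finite_induct)
  case (insert a F)
  then show ?case by (simp only: sum.insert kd_add not_False_eq_True)
qed (simp_all only: sum.infinite sum.empty kd_0 not_False_eq_True)

lemma ksign_mult_forms: "f \<in> forms d \<Longrightarrow> ksign i s * f \<in> forms d"
proof -
  have "ksign i s = (1 :: ('a, 'b) mpoly) \<or> ksign i s = (- 1 :: ('a, 'b) mpoly)"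
    unfolding ksign_def by (metis minus_one_power_iff)
  then show "f \<in> forms d \<Longrightarrow> ksign i s * f \<in> forms d"
    by (auto intro: forms_uminus)
qed

lemma khom_kd: "khom e z \<Longrightarrow> khom e (kd z)"
  unfolding khom_def kdiff_def mult.assoc
  by (intro allI forms_sum ksign_mult_forms forms_mult_eq[OF forms_pvar]) auto

lemma hcomp_ksign_mult: "hcomp d (ksign i s * f) = ksign i s * hcomp d f"
proof -
  have "ksign i s = (1 :: ('a, 'b) mpoly) \<or> ksign i s = (- 1 :: ('a, 'b) mpoly)"
    unfolding ksign_def by (metis minus_one_power_iff)
  then show ?thesis
    by (auto simp: hcomp_uminus)
qed

lemma khcomp_kd: "khcomp e (kd z) = kd (khcomp e z)"
proof
  fix s
  have "khcomp e (kd z) s = (\<Sum>i\<in>-s. ksign i s * (pvar i * hcomp (e - int (card s) - 1) (z (insert i s))))"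
    by (simp add: khcomp_def kdiff_def hcomp_sum mult.assoc hcomp_ksign_mult hcomp_mult[OF forms_pvar])
  also have "\<dots> = kd (khcomp e z) s"
    unfolding kdiff_def by (intro sum.cong refl) (auto simp: khcomp_def mult.assoc diff_diff_eq add.commute)
  finally show "khcomp e (kd z) s = kd (khcomp e z) s" .
qed

section \<open>Koszul chains, cycles and boundaries modulo \<open>I\<close>\<close>

locale graded_ideal =
  fixes I :: "('n::finite, 'k::field) mpoly set"
  assumes gI: "gideal I"
    and I_max: "f \<in> I \<Longrightarrow> lookup f 0 = 0"
begin

lemma I_0: "0 \<in> I" and I_add: "f \<in> I \<Longrightarrow> g \<in> I \<Longrightarrow> f + g \<in> I"
  and I_mult: "f \<in> I \<Longrightarrow> h * f \<in> I" and I_hcomp: "f \<in> I \<Longrightarrow> hcomp d f \<in> I"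
  using gI by (auto simp: gideal_def)

lemma I_mult': "f \<in> I \<Longrightarrow> f * h \<in> I"
  using I_mult by (simp add: mult.commute)

lemmas I_sum = gideal_sum[OF gI] and I_diff = gideal_diff[OF gI] and I_uminus = gideal_uminus[OF gI]

text \<open>\<open>Kos i\<close> lives over the polynomial ring; the Koszul module of
  \<open>S / I\<close> is \<open>Kos i\<close> modulo \<open>IKos i\<close>. Likewise
  \<open>Zyc i\<close> and \<open>Bnd i\<close> are full preimages of the cycles and boundaries, so
  everything is an honest chain of submodules of \<open>Kos i\<close>.\<close>

definition Kos :: "nat \<Rightarrow> ('n, 'k) kvec set"
  where "Kos i = {z. \<forall>s. card s \<noteq> i \<longrightarrow> z s = 0}"

definition IKos :: "nat \<Rightarrow> ('n, 'k) kvec set"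
  where "IKos i = {z \<in> Kos i. \<forall>s. z s \<in> I}"

definition Zyc :: "nat \<Rightarrow> ('n, 'k) kvec set"
  where "Zyc i = {z \<in> Kos i. \<forall>s. kd z s \<in> I}"

definition Bnd :: "nat \<Rightarrow> ('n, 'k) kvec set"
  where "Bnd i = {z \<in> Kos i. \<exists>w\<in>Kos (Suc i). \<forall>s. (z - kd w) s \<in> I}"

lemma gsub_Kos: "gsub (Kos i)"
  by (auto simp: gsub_def Kos_def ksmult_def khcomp_def)

lemma gsub_IKos: "gsub (IKos i)"
  using gsub_Kos[of i] by (auto simp: gsub_def IKos_def ksmult_def khcomp_def intro: I_0 I_add I_mult I_hcomp)

lemma gsub_Zyc: "gsub (Zyc i)"
  using gsub_Kos[of i]
  by (auto simp: gsub_def Zyc_def kd_0 kd_add kd_smult khcomp_kd[symmetric] intro: I_0 I_add)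
    (auto simp: ksmult_def khcomp_def intro: I_mult I_hcomp)

lemma kd_Kos: "z \<in> Kos (Suc i) \<Longrightarrow> kd z \<in> Kos i"
  unfolding Kos_def kdiff_def by (auto intro!: sum.neutral simp: card_insert_if)

lemma kd_I: "(\<And>s. z s \<in> I) \<Longrightarrow> kd z s \<in> I"
  unfolding kdiff_def by (intro I_sum I_mult) auto

lemma gsub_Bnd: "gsub (Bnd i)"
  unfolding gsub_def
proof (intro conjI ballI allI)
  show "0 \<in> Bnd i"
    using gsub_0[OF gsub_Kos] I_0 by (auto simp: Bnd_def kd_0 intro!: bexI[of _ 0])
next
  fix x y assume "x \<in> Bnd i" "y \<in> Bnd i"
  then obtain w v where *: "x \<in> Kos i" "y \<in> Kos i" "w \<in> Kos (Suc i)" "v \<in> Kos (Suc i)"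
    "\<And>s. (x - kd w) s \<in> I" "\<And>s. (y - kd v) s \<in> I" by (auto simp: Bnd_def)
  have "(x + y - kd (w + v)) s \<in> I" for s
    using I_add[OF *(5,6), of s s] by (simp add: kd_add algebra_simps)
  then show "x + y \<in> Bnd i" using * gsub_add[OF gsub_Kos] unfolding Bnd_def by blast
next
  fix x f assume "x \<in> Bnd i"
  then obtain w where *: "x \<in> Kos i" "w \<in> Kos (Suc i)" "\<And>s. (x - kd w) s \<in> I" by (auto simp: Bnd_def)
  have "(ksmult f x - kd (ksmult f w)) s \<in> I" for s
    using I_mult[OF *(3), of f s] by (simp add: kd_smult) (simp add: ksmult_def algebra_simps)
  then show "ksmult f x \<in> Bnd i" using * gsub_smult[OF gsub_Kos] unfolding Bnd_def by blast
next
  fix x e assume "x \<in> Bnd i"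
  then obtain w where *: "x \<in> Kos i" "w \<in> Kos (Suc i)" "\<And>s. (x - kd w) s \<in> I" by (auto simp: Bnd_def)
  have "khcomp e x - kd (khcomp e w) = khcomp e (x - kd w)"
    by (simp only: khcomp_diff khcomp_kd)
  then have "(khcomp e x - kd (khcomp e w)) s \<in> I" for s
    using I_hcomp[OF *(3)] by (simp only: khcomp_def)
  then show "khcomp e x \<in> Bnd i" using * gsub_khcomp[OF gsub_Kos] unfolding Bnd_def by blast
qed

text \<open>The component of degree \<open>e\<close> of any witness is again a witness, as
  \<open>kd\<close> and membership in \<open>I\<close> are compatible with components.\<close>

lemma Bnd_hom:
  assumes "z \<in> Bnd i" "khom e z"
  obtains w where "w \<in> Kos (Suc i)" "khom e w" "z - kd w \<in> IKos i"
proof -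
  obtain w where *: "z \<in> Kos i" "w \<in> Kos (Suc i)" "\<And>s. (z - kd w) s \<in> I"
    using assms by (auto simp: Bnd_def)
  have "(z - kd (khcomp e w)) s \<in> I" for s
  proof -
    have "z - kd (khcomp e w) = khcomp e (z - kd w)"
      using khcomp_eq[OF assms(2)] by (simp add: khcomp_diff khcomp_kd)
    then show ?thesis using *(3) by (auto simp: khcomp_def intro: I_hcomp)
  qed
  moreover have "z - kd (khcomp e w) \<in> Kos i"
    using * by (intro gsub_diff[OF gsub_Kos] kd_Kos gsub_khcomp[OF gsub_Kos]) auto
  ultimately show ?thesis using * gsub_khcomp[OF gsub_Kos]
    by (intro that[of "khcomp e w"]) (auto simp: IKos_def)
qed

lemma IKos_sub_Bnd: "IKos i \<subseteq> Bnd i"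
  using gsub_0[OF gsub_Kos] by (auto simp: Bnd_def IKos_def kd_0 intro!: bexI[of _ 0])

lemma Bnd_sub_Zyc: "Bnd i \<subseteq> Zyc i"
proof
  fix z assume "z \<in> Bnd i"
  then obtain w where *: "z \<in> Kos i" "w \<in> Kos (Suc i)" "\<And>s. (z - kd w) s \<in> I" by (auto simp: Bnd_def)
  have "kd z s \<in> I" for s
    using kd_I[of "z - kd w" s] *(3) by (simp add: kd_diff kdiff_kdiff)
  then show "z \<in> Zyc i" using * by (simp add: Zyc_def)
qed

lemma Zyc_sub_Kos: "Zyc i \<subseteq> Kos i"
  by (auto simp: Zyc_def)

lemma IKos_sub_Zyc: "IKos i \<subseteq> Zyc i"
  using IKos_sub_Bnd Bnd_sub_Zyc by blast

lemma smult_I_Kos: "f \<in> I \<Longrightarrow> z \<in> Kos i \<Longrightarrow> ksmult f z \<in> IKos i"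
  by (auto simp: IKos_def Kos_def ksmult_def intro: I_mult')

lemma kd_in_Bnd: "w \<in> Kos (Suc i) \<Longrightarrow> kd w \<in> Bnd i"
  using kd_Kos[of w i] I_0 by (auto simp: Bnd_def intro!: bexI[of _ w])

lemma kwedge_Kos: "z \<in> Kos i \<Longrightarrow> kwedge l z \<in> Kos (Suc i)"
  using card_Suc_Diff1[of _ l] unfolding Kos_def kwedge_def by fastforce

text \<open>Wedging with a basis vector is a null homotopy for multiplication by its variable. So
  \<open>Zyc i\<close> modulo \<open>Bnd i\<close> is a vector space over \<open>k\<close>.\<close>

lemma pvar_Zyc: "z \<in> Zyc i \<Longrightarrow> ksmult (pvar l) z \<in> Bnd i"
proof -
  assume z: "z \<in> Zyc i"
  then have 1: "kwedge l z \<in> Kos (Suc i)" using kwedge_Kos Zyc_sub_Kos by blast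
  have "(ksmult (pvar l) z - kd (kwedge l z)) s \<in> I" for s
  proof -
    have "(ksmult (pvar l) z - kd (kwedge l z)) s = kwedge l (kd z) s"
      using koszul_homotopy[of pvar l z s] by (simp add: ksmult_def algebra_simps)
    then show ?thesis using z by (auto simp: kwedge_def Zyc_def I_0 intro: I_mult)
  qed
  moreover have "ksmult (pvar l) z \<in> Kos i"
    using z Zyc_sub_Kos by (intro gsub_smult[OF gsub_Kos]) auto
  ultimately show ?thesis using 1 unfolding Bnd_def by blast
qed

text \<open>This identifies \<open>Kos 0\<close> modulo \<open>Bnd 0\<close> with the residue field,
  which thereby becomes a subquotient of the Koszul complex itself.\<close>

lemma Bnd_0_iff: "z \<in> Bnd 0 \<longleftrightarrow> z \<in> Kos 0 \<and> lookup (z {}) 0 = 0"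
proof
  assume "z \<in> Bnd 0"
  then obtain w where *: "z \<in> Kos 0" "w \<in> Kos 1" "\<And>s. (z - kd w) s \<in> I" by (auto simp: Bnd_def)
  have "lookup (kd w {}) 0 = 0"
    by (simp add: kdiff_def lookup_sum const_mult const_forms[OF forms_pvar])
  then show "z \<in> Kos 0 \<and> lookup (z {}) 0 = 0"
    using I_max[OF *(3)[of "{}"]] * by (simp add: lookup_minus)
next
  assume z: "z \<in> Kos 0 \<and> lookup (z {}) 0 = 0"
  then obtain g where g: "z {} = (\<Sum>i\<in>UNIV. pvar i * g i)"
    using max_ideal_decomp by blast
  define w :: "('n, 'k) kvec" where "w s = (if card s = 1 then g (the_elem s) else 0)" for s
  have w: "w \<in> Kos (Suc 0)" by (simp add: Kos_def w_def)
  have "(z - kd w) s = 0" for s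
  proof (cases "s = {}")
    case True
    then show ?thesis by (simp add: kdiff_def w_def g ksign_def)
  next
    case False
    then have "card s \<noteq> 0" by simp
    then show ?thesis using z kd_Kos[OF w] by (simp add: Kos_def)
  qed
  then show "z \<in> Bnd 0" using z w I_0 by (auto simp: Bnd_def intro!: bexI[of _ w])
qed

end

text \<open>A graded free resolution of the residue field over \<open>S / I\<close>, with the matrices lifted to
  polynomials, so that all equations hold modulo \<open>I\<close>; \<open>\<alpha>\<close> is the augmentation.\<close>

locale lifted_resolution = graded_ideal I
  for I :: "('n::finite, 'k::field) mpoly set" +
  fixes r :: "nat \<Rightarrow> nat" and dg :: "nat \<Rightarrow> nat \<Rightarrow> int"
    and A :: "nat \<Rightarrow> nat \<Rightarrow> nat \<Rightarrow> ('n, 'k) mpoly" and \<alpha> :: "nat \<Rightarrow> 'k"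
  assumes A_hom: "a < r p \<Longrightarrow> b < r (Suc p) \<Longrightarrow> A p a b \<in> forms (dg (Suc p) b - dg p a)"
    and aug_deg: "a < r 0 \<Longrightarrow> dg 0 a \<noteq> 0 \<Longrightarrow> \<alpha> a = 0"
    and aug_surj: "\<exists>a<r 0. \<alpha> a \<noteq> 0"
    and complex_0: "b < r 1 \<Longrightarrow> (\<Sum>a<r 0. \<alpha> a * lookup (A 0 a b) 0) = 0"
    and exact_0: "(\<Sum>a<r 0. \<alpha> a * lookup (x a) 0) = 0 \<Longrightarrow>
      \<exists>y. \<forall>a<r 0. x a - (\<Sum>b<r 1. A 0 a b * y b) \<in> I"
    and complex_Suc: "a < r p \<Longrightarrow> c < r (Suc (Suc p)) \<Longrightarrow> (\<Sum>b<r (Suc p). A p a b * A (Suc p) b c) \<in> I"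
    and exact_Suc: "(\<And>a. a < r p \<Longrightarrow> (\<Sum>b<r (Suc p). A p a b * x b) \<in> I) \<Longrightarrow>
      \<exists>y. \<forall>b<r (Suc p). x b - (\<Sum>c<r (Suc (Suc p)). A (Suc p) b c * y c) \<in> I"
begin

definition D :: "nat \<Rightarrow> (nat \<Rightarrow> ('n, 'k) kvec) \<Rightarrow> nat \<Rightarrow> ('n, 'k) kvec"
  where "D p x a = (\<Sum>b<r (Suc p). ksmult (A p a b) (x b))"

definition chain :: "nat \<Rightarrow> int \<Rightarrow> ('n, 'k) kvec set \<Rightarrow> (nat \<Rightarrow> ('n, 'k) kvec) \<Rightarrow> bool"
  where "chain p j M x \<longleftrightarrow> (\<forall>b<r p. x b \<in> M \<and> khom (j - dg p b) (x b))"

text \<open>Homological degree \<open>0\<close> has no outgoing differential; there the condition is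
  void.\<close>

definition cycle :: "nat \<Rightarrow> ('n, 'k) kvec set \<Rightarrow> (nat \<Rightarrow> ('n, 'k) kvec) \<Rightarrow> bool"
  where "cycle p N x \<longleftrightarrow> (\<forall>q. p = Suc q \<longrightarrow> (\<forall>a<r q. D q x a \<in> N))"

text \<open>Vanishing of the degree \<open>j\<close> part of the \<open>p\<close>-th homology of the resolution tensored with
  \<open>M / N\<close>.\<close>

definition van :: "nat \<Rightarrow> int \<Rightarrow> ('n, 'k) kvec set \<Rightarrow> ('n, 'k) kvec set \<Rightarrow> bool"
  where "van p j M N \<longleftrightarrow> (\<forall>x. chain p j M x \<and> cycle p N x \<longrightarrow>
    (\<exists>y. chain (Suc p) j M y \<and> (\<forall>b<r p. x b - D p y b \<in> N)))"

lemma vanD: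
  assumes "van p j M N" "chain p j M x" "cycle p N x"
  obtains y where "chain (Suc p) j M y" "\<And>b. b < r p \<Longrightarrow> x b - D p y b \<in> N"
  using assms by (auto simp: van_def)

lemma vanI:
  assumes "\<And>x. chain p j M x \<Longrightarrow> cycle p N x \<Longrightarrow>
    \<exists>y. chain (Suc p) j M y \<and> (\<forall>b<r p. x b - D p y b \<in> N)"
  shows "van p j M N"
  using assms by (auto simp: van_def)

section \<open>Long exact sequences for the resolution with coefficients in subquotients\<close>

lemma D_add: "D p (\<lambda>b. x b + y b) a = D p x a + D p y a"
  and D_diff: "D p (\<lambda>b. x b - y b) a = D p x a - D p y a"
  by (auto simp: D_def ksmult_add ksmult_diff sum.distrib sum_subtractf)

lemma D_mem: "gsub M \<Longrightarrow> (\<And>b. b < r (Suc p) \<Longrightarrow> x b \<in> M) \<Longrightarrow> D p x a \<in> M"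
  unfolding D_def by (intro gsub_sum gsub_smult) auto

lemma D_cong_mod:
  assumes "gsub M" "\<And>b. b < r (Suc p) \<Longrightarrow> x b - y b \<in> M"
  shows "D p x a - D p y a \<in> M"
  using D_mem[OF assms(1), of p "\<lambda>b. x b - y b" a] assms(2) by (simp add: D_diff)

lemma D_khom:
  assumes "\<And>b. b < r (Suc p) \<Longrightarrow> khom (j - dg (Suc p) b) (x b)" "a < r p"
  shows "khom (j - dg p a) (D p x a)"
  unfolding D_def using assms by (intro khom_sum khom_smult[OF A_hom]) auto

lemma chain_D: "gsub M \<Longrightarrow> chain (Suc p) j M x \<Longrightarrow> chain p j M (D p x)"
  unfolding chain_def by (auto intro: D_mem D_khom)

lemma chain_add: "gsub M \<Longrightarrow> chain p j M x \<Longrightarrow> chain p j M y \<Longrightarrow> chain p j M (\<lambda>b. x b + y b)"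
  unfolding chain_def by (auto intro: gsub_add khom_add)

lemma chain_diff: "gsub M \<Longrightarrow> chain p j M x \<Longrightarrow> chain p j M y \<Longrightarrow> chain p j M (\<lambda>b. x b - y b)"
  unfolding chain_def by (auto intro: gsub_diff khom_diff)

lemma chain_mono: "M \<subseteq> M' \<Longrightarrow> chain p j M x \<Longrightarrow> chain p j M' x"
  unfolding chain_def by auto

lemma cycle_mono: "M \<subseteq> M' \<Longrightarrow> cycle p M x \<Longrightarrow> cycle p M' x"
  unfolding cycle_def by auto

text \<open>Products of consecutive matrices vanish only modulo \<open>I\<close>, so the
  differential squares to zero on \<open>M / N\<close> once \<open>I M\<close> lies in
  \<open>N\<close>. This condition accompanies all exact sequences below.\<close>

lemma D_D:
  assumes "\<And>f z. f \<in> I \<Longrightarrow> z \<in> M \<Longrightarrow> ksmult f z \<in> N" "gsub N"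
    "\<And>b. b < r (Suc (Suc p)) \<Longrightarrow> x b \<in> M" "a < r p"
  shows "D p (D (Suc p) x) a \<in> N"
proof -
  have "D p (D (Suc p) x) a = (\<Sum>b<r (Suc p). \<Sum>c<r (Suc (Suc p)). ksmult (A p a b * A (Suc p) b c) (x c))"
    by (simp add: D_def ksmult_sum ksmult_mult)
  also have "\<dots> = (\<Sum>c<r (Suc (Suc p)). ksmult (\<Sum>b<r (Suc p). A p a b * A (Suc p) b c) (x c))"
    by (subst sum.swap) (simp add: ksmult_sum_left)
  also have "\<dots> \<in> N"
    using assms complex_Suc by (intro gsub_sum) auto
  finally show ?thesis .
qed

lemma cycle_D:
  assumes "\<And>f z. f \<in> I \<Longrightarrow> z \<in> M \<Longrightarrow> ksmult f z \<in> N" "gsub N" "chain (Suc p) j M x"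
  shows "cycle p N (D p x)"
  unfolding cycle_def
proof (intro allI impI)
  fix q a assume "p = Suc q" "a < r q"
  then show "D q (D p x) a \<in> N"
    using assms(3) by (auto simp: chain_def intro!: D_D[OF assms(1,2)])
qed

lemma cycle_diff: "gsub N \<Longrightarrow> cycle p N x \<Longrightarrow> cycle p N y \<Longrightarrow> cycle p N (\<lambda>b. x b - y b)"
  unfolding cycle_def by (auto simp: D_diff intro: gsub_diff)

text \<open>Exactness at the middle term \<open>M3 / M1\<close> of the long exact sequence: the
  cycle is corrected into \<open>M2\<close> and then killed there.\<close>

lemma van_trans:
  assumes IM: "\<And>f z. f \<in> I \<Longrightarrow> z \<in> M3 \<Longrightarrow> ksmult f z \<in> M1"
    and g: "gsub M1" "gsub M2" "gsub M3" and sub: "M1 \<subseteq> M2" "M2 \<subseteq> M3"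
    and v: "van p j M2 M1" "van p j M3 M2"
  shows "van p j M3 M1"
proof (rule vanI)
  fix x assume x: "chain p j M3 x" "cycle p M1 x"
  obtain y where y: "chain (Suc p) j M3 y" "\<And>b. b < r p \<Longrightarrow> x b - D p y b \<in> M2"
    using vanD[OF v(2) x(1) cycle_mono[OF sub(1) x(2)]] by blast
  let ?x = "\<lambda>b. x b - D p y b"
  have "chain p j M3 ?x" using x y g by (intro chain_diff chain_D)
  then have 1: "chain p j M2 ?x" using y(2) by (simp add: chain_def)
  have 2: "cycle p M1 ?x" using x(2) cycle_D[OF IM g(1) y(1)] g by (intro cycle_diff)
  obtain z where z: "chain (Suc p) j M2 z" "\<And>b. b < r p \<Longrightarrow> ?x b - D p z b \<in> M1"
    using vanD[OF v(1) 1 2] by blast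
  show "\<exists>y. chain (Suc p) j M3 y \<and> (\<forall>b<r p. x b - D p y b \<in> M1)"
    using chain_add[OF g(3) y(1) chain_mono[OF sub(2) z(1)]] z(2)
    by (intro exI[of _ "\<lambda>b. y b + z b"]) (auto simp: D_add diff_diff_eq)
qed

text \<open>Exactness at \<open>M3 / M2\<close>, between the map from \<open>M3 / M1\<close> and the
  connecting map to \<open>M2 / M1\<close>, which lowers the homological degree by one.\<close>

lemma van_quotient:
  assumes IM: "\<And>f z. f \<in> I \<Longrightarrow> z \<in> M3 \<Longrightarrow> ksmult f z \<in> M1"
    and g: "gsub M1" "gsub M2" "gsub M3" and sub: "M1 \<subseteq> M2" "M2 \<subseteq> M3"
    and v: "van p j M2 M1" "van (Suc p) j M3 M1"
  shows "van (Suc p) j M3 M2"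
proof (rule vanI)
  fix x assume x: "chain (Suc p) j M3 x" "cycle (Suc p) M2 x"
  have 1: "chain p j M2 (D p x)"
    using chain_D[OF g(3) x(1)] x(2) by (simp add: chain_def cycle_def)
  obtain y where y: "chain (Suc p) j M2 y" "\<And>b. b < r p \<Longrightarrow> D p x b - D p y b \<in> M1"
    using vanD[OF v(1) 1 cycle_D[OF IM g(1) x(1)]] by blast
  have 2: "cycle (Suc p) M1 (\<lambda>b. x b - y b)"
    using y(2) by (simp add: cycle_def D_diff)
  obtain w where w: "chain (Suc (Suc p)) j M3 w" "\<And>b. b < r (Suc p) \<Longrightarrow> x b - y b - D (Suc p) w b \<in> M1"
    using vanD[OF v(2) chain_diff[OF g(3) x(1) chain_mono[OF sub(2) y(1)]] 2] by blast
  have "x b - D (Suc p) w b \<in> M2" if "b < r (Suc p)" for b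
  proof -
    have "x b - D (Suc p) w b = (x b - y b - D (Suc p) w b) + y b" by simp
    also have "\<dots> \<in> M2"
      by (rule gsub_add[OF g(2)]) (use w(2)[OF that] y(1) that sub in \<open>auto simp: chain_def\<close>)
    finally show ?thesis .
  qed
  then show "\<exists>y. chain (Suc (Suc p)) j M3 y \<and> (\<forall>b<r (Suc p). x b - D (Suc p) y b \<in> M2)"
    using w(1) by blast
qed

text \<open>Exactness at \<open>M2 / M1\<close>, between the connecting map out of
  \<open>M3 / M2\<close> in degree \<open>Suc p\<close> and the map to
  \<open>M3 / M1\<close>.\<close>

lemma van_sub:
  assumes IM: "\<And>f z. f \<in> I \<Longrightarrow> z \<in> M3 \<Longrightarrow> ksmult f z \<in> M1"
    and g: "gsub M1" "gsub M2" "gsub M3" and sub: "M1 \<subseteq> M2" "M2 \<subseteq> M3"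
    and v: "van (Suc p) j M3 M2" "van p j M3 M1"
  shows "van p j M2 M1"
proof (rule vanI)
  fix x assume x: "chain p j M2 x" "cycle p M1 x"
  obtain y where y: "chain (Suc p) j M3 y" "\<And>b. b < r p \<Longrightarrow> x b - D p y b \<in> M1"
    using vanD[OF v(2) chain_mono[OF sub(2) x(1)] x(2)] by blast
  have "D p y b \<in> M2" if "b < r p" for b
  proof -
    have "D p y b = x b - (x b - D p y b)" by simp
    also have "\<dots> \<in> M2"
      by (rule gsub_diff[OF g(2)]) (use y(2)[OF that] x(1) that sub in \<open>auto simp: chain_def\<close>)
    finally show ?thesis .
  qed
  then have "cycle (Suc p) M2 y" by (simp add: cycle_def)
  then obtain w where w: "chain (Suc (Suc p)) j M3 w" "\<And>b. b < r (Suc p) \<Longrightarrow> y b - D (Suc p) w b \<in> M2"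
    using vanD[OF v(1) y(1)] by blast
  have "chain (Suc p) j M3 (\<lambda>b. y b - D (Suc p) w b)"
    using g y w by (intro chain_diff chain_D)
  then have 1: "chain (Suc p) j M2 (\<lambda>b. y b - D (Suc p) w b)"
    using w(2) by (simp add: chain_def)
  have "x b - D p (\<lambda>b. y b - D (Suc p) w b) b \<in> M1" if "b < r p" for b
  proof -
    have "D p (D (Suc p) w) b \<in> M1"
      using w(1) that by (auto simp: chain_def intro!: D_D[OF IM g(1)])
    then have "(x b - D p y b) + D p (D (Suc p) w) b \<in> M1"
      using y(2)[OF that] g by (intro gsub_add)
    then show ?thesis by (simp add: D_diff algebra_simps)
  qed
  then show "\<exists>y. chain (Suc p) j M2 y \<and> (\<forall>b<r p. x b - D p y b \<in> M1)"
    using 1 by blast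
qed

section \<open>Vanishing for the free modules \<open>Kos i\<close> modulo
  \<open>IKos i\<close>\<close>

lemma exact_Suc_hom:
  assumes x: "\<And>b. b < r (Suc p) \<Longrightarrow> x b \<in> forms (e - dg (Suc p) b)"
    and "\<And>a. a < r p \<Longrightarrow> (\<Sum>b<r (Suc p). A p a b * x b) \<in> I"
  shows "\<exists>y. (\<forall>c<r (Suc (Suc p)). y c \<in> forms (e - dg (Suc (Suc p)) c)) \<and>
    (\<forall>b<r (Suc p). x b - (\<Sum>c<r (Suc (Suc p)). A (Suc p) b c * y c) \<in> I)"
proof -
  obtain y where y: "\<And>b. b < r (Suc p) \<Longrightarrow> x b - (\<Sum>c<r (Suc (Suc p)). A (Suc p) b c * y c) \<in> I"
    using exact_Suc[OF assms(2)] by blast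
  \<comment> \<open>The matrix entries are homogeneous, so the right component of each entry of a
    solution solves the problem in degree \<open>e\<close>.\<close>
  have "x b - (\<Sum>c<r (Suc (Suc p)). A (Suc p) b c * hcomp (e - dg (Suc (Suc p)) c) (y c)) \<in> I"
    if "b < r (Suc p)" for b
  proof -
    have "hcomp (e - dg (Suc p) b) (x b - (\<Sum>c<r (Suc (Suc p)). A (Suc p) b c * y c)) \<in> I"
      using y that I_hcomp by blast
    then show ?thesis
      using that by (simp add: hcomp_diff hcomp_eq[OF x] hcomp_sum hcomp_mult[OF A_hom])
  qed
  then show ?thesis by (intro exI[of _ "\<lambda>c. hcomp (e - dg (Suc (Suc p)) c) (y c)"]) auto
qed

lemma exact_0_hom:
  assumes x: "\<And>b. b < r 0 \<Longrightarrow> x b \<in> forms (e - dg 0 b)" and e: "e \<noteq> 0"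
  shows "\<exists>y. (\<forall>c<r (Suc 0). y c \<in> forms (e - dg (Suc 0) c)) \<and>
    (\<forall>b<r 0. x b - (\<Sum>c<r (Suc 0). A 0 b c * y c) \<in> I)"
proof -
  \<comment> \<open>\<open>\<alpha> a\<close> is nonzero only at basis elements of degree
    \<open>0\<close>, and there \<open>x a\<close> is a form of degree \<open>e \<noteq> 0\<close>
    without constant term: the augmentation vanishes automatically.\<close>
  have "\<alpha> a * lookup (x a) 0 = 0" if "a < r 0" for a
    using aug_deg[OF that] const_forms[OF x[OF that]] e by (cases "dg 0 a = 0") auto
  then have "(\<Sum>a<r 0. \<alpha> a * lookup (x a) 0) = 0" by (simp add: sum.neutral)
  then obtain y where y: "\<And>b. b < r 0 \<Longrightarrow> x b - (\<Sum>c<r (Suc 0). A 0 b c * y c) \<in> I"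
    using exact_0[of x] by auto
  have "x b - (\<Sum>c<r (Suc 0). A 0 b c * hcomp (e - dg (Suc 0) c) (y c)) \<in> I"
    if "b < r 0" for b
  proof -
    have "hcomp (e - dg 0 b) (x b - (\<Sum>c<r (Suc 0). A 0 b c * y c)) \<in> I"
      using y that I_hcomp by blast
    then show ?thesis
      using that by (simp add: hcomp_diff hcomp_eq[OF x] hcomp_sum hcomp_mult[OF A_hom])
  qed
  then show ?thesis by (intro exI[of _ "\<lambda>c. hcomp (e - dg (Suc 0) c) (y c)"]) auto
qed

lemma D_apply: "D p x a s = (\<Sum>b<r (Suc p). A p a b * x b s)"
  by (simp add: D_def sum_fun_apply ksmult_def)

text \<open>\<open>Kos i\<close> modulo \<open>IKos i\<close> is free over \<open>S / I\<close> on
  the subsets of size \<open>i\<close>, all placed in degree \<open>i\<close>; the problem separates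
  into one polynomial system per subset, shifted by \<open>i\<close>.\<close>

lemma van_Kos_aux:
  assumes "\<And>s x. chain p j (Kos i) x \<Longrightarrow> cycle p (IKos i) x \<Longrightarrow> card s = i \<Longrightarrow>
    \<exists>y. (\<forall>c<r (Suc p). y c \<in> forms (j - int i - dg (Suc p) c)) \<and>
      (\<forall>b<r p. x b s - (\<Sum>c<r (Suc p). A p b c * y c) \<in> I)"
  shows "van p j (Kos i) (IKos i)"
proof (rule vanI)
  fix x assume x: "chain p j (Kos i) x" "cycle p (IKos i) x"
  then have "\<exists>y. \<forall>s. card s = i \<longrightarrow> (\<forall>c<r (Suc p). y s c \<in> forms (j - int i - dg (Suc p) c)) \<and>
      (\<forall>b<r p. x b s - (\<Sum>c<r (Suc p). A p b c * y s c) \<in> I)"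
    by (intro choice allI) (use assms in blast)
  then obtain y where y: "\<And>s c. card s = i \<Longrightarrow> c < r (Suc p) \<Longrightarrow> y s c \<in> forms (j - int i - dg (Suc p) c)"
    "\<And>s b. card s = i \<Longrightarrow> b < r p \<Longrightarrow> x b s - (\<Sum>c<r (Suc p). A p b c * y s c) \<in> I"
    by blast
  define y' :: "nat \<Rightarrow> ('n, 'k) kvec" where "y' c s = (if card s = i then y s c else 0)" for c s
  have "chain (Suc p) j (Kos i) y'"
    using y(1) by (auto simp: chain_def Kos_def khom_def y'_def diff_diff_eq add.commute)
  moreover have "x b - D p y' b \<in> IKos i" if "b < r p" for b
  proof -
    have "(x b - D p y' b) s \<in> I" for s
      using y(2) that x(1) by (cases "card s = i") (auto simp: D_apply y'_def chain_def Kos_def I_0)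
    moreover have "x b - D p y' b \<in> Kos i"
      using x(1) that by (intro gsub_diff[OF gsub_Kos] D_mem[OF gsub_Kos]) (auto simp: chain_def Kos_def y'_def)
    ultimately show ?thesis by (simp add: IKos_def)
  qed
  ultimately show "\<exists>y. chain (Suc p) j (Kos i) y \<and> (\<forall>b<r p. x b - D p y b \<in> IKos i)" by blast
qed

lemma van_Kos_Suc: "van (Suc p) j (Kos i) (IKos i)"
proof (rule van_Kos_aux)
  fix s :: "'n set" and x assume x: "chain (Suc p) j (Kos i) x" "cycle (Suc p) (IKos i) x" and s: "card s = i"
  have "x b s \<in> forms (j - int i - dg (Suc p) b)" if "b < r (Suc p)" for b
    using x(1) that s by (auto simp: chain_def khom_def diff_diff_eq add.commute)
  moreover have "(\<Sum>b<r (Suc p). A p a b * x b s) \<in> I" if "a < r p" for a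
    using x(2) that by (auto simp: cycle_def IKos_def D_apply)
  ultimately show "\<exists>y. (\<forall>c<r (Suc (Suc p)). y c \<in> forms (j - int i - dg (Suc (Suc p)) c)) \<and>
      (\<forall>b<r (Suc p). x b s - (\<Sum>c<r (Suc (Suc p)). A (Suc p) b c * y c) \<in> I)"
    by (rule exact_Suc_hom)
qed

text \<open>The homology here is a sum of copies of \<open>k\<close> in degree \<open>i\<close>,
  whence the excluded value of \<open>j\<close>.\<close>

lemma van_Kos_0:
  assumes "j \<noteq> int i"
  shows "van 0 j (Kos i) (IKos i)"
proof (rule van_Kos_aux)
  fix s :: "'n set" and x assume x: "chain 0 j (Kos i) x" "cycle 0 (IKos i) x" and s: "card s = i"
  have "x b s \<in> forms (j - int i - dg 0 b)" if "b < r 0" for b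
    using x(1) that s by (auto simp: chain_def khom_def diff_diff_eq add.commute)
  then show "\<exists>y. (\<forall>c<r (Suc 0). y c \<in> forms (j - int i - dg (Suc 0) c)) \<and>
      (\<forall>b<r 0. x b s - (\<Sum>c<r (Suc 0). A 0 b c * y c) \<in> I)"
    by (rule exact_0_hom) (use assms in auto)
qed

lemma kd_D: "kd (D p x a) = D p (\<lambda>b. kd (x b)) a"
  by (simp add: D_def kd_sum kd_smult)

end

section \<open>Boundaries, cycles and Koszul homology as coefficients\<close>

context lifted_resolution
begin

text \<open>\<open>kd\<close> induces an isomorphism from \<open>Kos (Suc i)\<close> modulo
  \<open>Zyc (Suc i)\<close> onto \<open>Bnd i\<close> modulo \<open>IKos i\<close>. Chains are
  lifted along it by \<open>Bnd_hom\<close>, bounded there, and pushed down.\<close>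

lemma van_Bnd:
  assumes "van p j (Kos (Suc i)) (Zyc (Suc i))"
  shows "van p j (Bnd i) (IKos i)"
proof (rule vanI)
  fix x assume x: "chain p j (Bnd i) x" "cycle p (IKos i) x"
  have "\<forall>b. \<exists>w. b < r p \<longrightarrow> w \<in> Kos (Suc i) \<and> khom (j - dg p b) w \<and> x b - kd w \<in> IKos i"
    using x(1) Bnd_hom by (metis chain_def)
  then obtain w where w: "\<And>b. b < r p \<Longrightarrow> w b \<in> Kos (Suc i)" "\<And>b. b < r p \<Longrightarrow> khom (j - dg p b) (w b)"
    "\<And>b. b < r p \<Longrightarrow> x b - kd (w b) \<in> IKos i"
    by metis
  have 1: "chain p j (Kos (Suc i)) w" using w by (simp add: chain_def)
  have "D q w a \<in> Zyc (Suc i)" if "p = Suc q" "a < r q" for q a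
  proof -
    have "D q x a - D q (\<lambda>b. kd (w b)) a \<in> IKos i"
      using w(3) that by (intro D_cong_mod gsub_IKos) auto
    moreover have "D q x a \<in> IKos i" using x(2) that by (simp add: cycle_def)
    ultimately have "D q x a - (D q x a - D q (\<lambda>b. kd (w b)) a) \<in> IKos i"
      using gsub_diff[OF gsub_IKos] by blast
    then have "kd (D q w a) \<in> IKos i" by (simp add: kd_D)
    moreover have "D q w a \<in> Kos (Suc i)"
      using w(1) that by (intro D_mem gsub_Kos) auto
    ultimately show ?thesis by (simp add: Zyc_def IKos_def)
  qed
  then have "cycle p (Zyc (Suc i)) w" by (simp add: cycle_def)
  then obtain y where y: "chain (Suc p) j (Kos (Suc i)) y" "\<And>b. b < r p \<Longrightarrow> w b - D p y b \<in> Zyc (Suc i)"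
    using vanD[OF assms 1] by blast
  have "chain (Suc p) j (Bnd i) (\<lambda>c. kd (y c))"
    using y(1) by (auto simp: chain_def intro: kd_in_Bnd khom_kd)
  moreover have "x b - D p (\<lambda>c. kd (y c)) b \<in> IKos i" if "b < r p" for b
  proof -
    have "kd (w b - D p y b) \<in> IKos i"
      using y(2)[OF that] kd_Kos by (auto simp: Zyc_def IKos_def)
    then have "(x b - kd (w b)) + kd (w b - D p y b) \<in> IKos i"
      using w(3)[OF that] gsub_add[OF gsub_IKos] by blast
    then show ?thesis by (simp add: kd_diff kd_D)
  qed
  ultimately show "\<exists>y. chain (Suc p) j (Bnd i) y \<and> (\<forall>b<r p. x b - D p y b \<in> IKos i)" by blast
qed

text \<open>The same isomorphism read backwards, needed for the lower bound in homological degree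
  two.\<close>

lemma van_Kos_Zyc:
  assumes "van p j (Bnd i) (IKos i)"
  shows "van p j (Kos (Suc i)) (Zyc (Suc i))"
proof (rule vanI)
  fix x assume x: "chain p j (Kos (Suc i)) x" "cycle p (Zyc (Suc i)) x"
  have 1: "chain p j (Bnd i) (\<lambda>b. kd (x b))"
    using x(1) by (auto simp: chain_def intro: kd_in_Bnd khom_kd)
  have "D q (\<lambda>b. kd (x b)) a \<in> IKos i" if "p = Suc q" "a < r q" for q a
    using x(2) that kd_Kos by (auto simp: cycle_def kd_D[symmetric] Zyc_def IKos_def)
  then have "cycle p (IKos i) (\<lambda>b. kd (x b))" by (simp add: cycle_def)
  then obtain y where y: "chain (Suc p) j (Bnd i) y" "\<And>b. b < r p \<Longrightarrow> kd (x b) - D p y b \<in> IKos i"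
    using vanD[OF assms 1] by blast
  have "\<forall>b. \<exists>w. b < r (Suc p) \<longrightarrow> w \<in> Kos (Suc i) \<and> khom (j - dg (Suc p) b) w \<and> y b - kd w \<in> IKos i"
    using y(1) Bnd_hom by (metis chain_def)
  then obtain w where w: "\<And>b. b < r (Suc p) \<Longrightarrow> w b \<in> Kos (Suc i)" "\<And>b. b < r (Suc p) \<Longrightarrow> khom (j - dg (Suc p) b) (w b)"
    "\<And>b. b < r (Suc p) \<Longrightarrow> y b - kd (w b) \<in> IKos i"
    by metis
  have "x b - D p w b \<in> Zyc (Suc i)" if "b < r p" for b
  proof -
    have "D p y b - D p (\<lambda>b. kd (w b)) b \<in> IKos i"
      using w(3) by (intro D_cong_mod gsub_IKos)
    then have "(kd (x b) - D p y b) + (D p y b - D p (\<lambda>b. kd (w b)) b) \<in> IKos i"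
      using y(2)[OF that] gsub_add[OF gsub_IKos] by blast
    then have "kd (x b - D p w b) \<in> IKos i" by (simp add: kd_diff kd_D)
    moreover have "x b - D p w b \<in> Kos (Suc i)"
      using x(1) that w(1) by (intro gsub_diff D_mem gsub_Kos) (auto simp: chain_def)
    ultimately show ?thesis by (simp add: Zyc_def IKos_def)
  qed
  then show "\<exists>y. chain (Suc p) j (Kos (Suc i)) y \<and> (\<forall>b<r p. x b - D p y b \<in> Zyc (Suc i))"
    using w(1,2) by (auto simp: chain_def)
qed

text \<open>One step of a filtration whose factors are copies of the residue field.\<close>

definition adjoin :: "('n, 'k) kvec set \<Rightarrow> ('n, 'k) kvec \<Rightarrow> ('n, 'k) kvec set"
  where "adjoin N g = {z. \<exists>c. z - ksmult (pconst c) g \<in> N}"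

lemma adjoin_smult:
  assumes "gsub N" "\<And>i. ksmult (pvar i) g \<in> N"
  shows "ksmult f g \<in> adjoin N g"
proof -
  have "ksmult (f - pconst (lookup f 0)) g \<in> N"
    by (rule gsub_max_ideal[OF assms]) (auto simp: lookup_minus pconst_def)
  then show ?thesis by (auto simp: adjoin_def ksmult_diff_left)
qed

lemma adjoin_sub: "N \<subseteq> adjoin N g"
  by (auto simp: adjoin_def intro: exI[of _ 0])

text \<open>Constant multiples of \<open>g\<close> suffice because the variables send
  \<open>g\<close> into \<open>N\<close>; homogeneity of \<open>g\<close> gives closure under
  components.\<close>

lemma gsub_adjoin:
  assumes N: "gsub N" and g: "\<And>i. ksmult (pvar i) g \<in> N" and h: "khom e g"
  shows "gsub (adjoin N g)"
  unfolding gsub_def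
proof (intro conjI ballI allI)
  show "0 \<in> adjoin N g" using gsub_0[OF N] adjoin_sub by blast
next
  fix x y assume "x \<in> adjoin N g" "y \<in> adjoin N g"
  then obtain c d where "x - ksmult (pconst c) g \<in> N" "y - ksmult (pconst d) g \<in> N" by (auto simp: adjoin_def)
  then have "(x - ksmult (pconst c) g) + (y - ksmult (pconst d) g) \<in> N" using gsub_add[OF N] by blast
  moreover have "(x - ksmult (pconst c) g) + (y - ksmult (pconst d) g) = x + y - ksmult (pconst (c + d)) g"
    by (simp add: pconst_add ksmult_add_left)
  ultimately show "x + y \<in> adjoin N g" unfolding adjoin_def by auto
next
  fix x f assume "x \<in> adjoin N g"
  then obtain c where c: "x - ksmult (pconst c) g \<in> N" by (auto simp: adjoin_def)
  obtain d where d: "ksmult (f * pconst c) g - ksmult (pconst d) g \<in> N"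
    using adjoin_smult[OF N g, of "f * pconst c"] by (auto simp: adjoin_def)
  have "ksmult f (x - ksmult (pconst c) g) + (ksmult (f * pconst c) g - ksmult (pconst d) g) \<in> N"
    using gsub_add[OF N gsub_smult[OF N c] d] .
  moreover have "ksmult f (x - ksmult (pconst c) g) + (ksmult (f * pconst c) g - ksmult (pconst d) g)
      = ksmult f x - ksmult (pconst d) g"
    by (simp add: ksmult_diff ksmult_mult)
  ultimately show "ksmult f x \<in> adjoin N g" by (auto simp: adjoin_def)
next
  fix x d assume "x \<in> adjoin N g"
  then obtain c where c: "x - ksmult (pconst c) g \<in> N" by (auto simp: adjoin_def)
  then have 1: "khcomp d x - khcomp d (ksmult (pconst c) g) \<in> N"
    using gsub_khcomp[OF N c] by (simp add: khcomp_diff)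
  have 2: "khom e (ksmult (pconst c) g)" using khom_smult[OF forms_pconst h] by simp
  show "khcomp d x \<in> adjoin N g"
  proof (cases "d = e")
    case True
    then show ?thesis using 1 khcomp_eq[OF 2] by (auto simp: adjoin_def)
  next
    case False
    then show ?thesis using 1 khcomp_eq_0[OF 2, of d] adjoin_sub by auto
  qed
qed

lemma van_refl: "gsub N \<Longrightarrow> van p j N N"
  unfolding van_def chain_def cycle_def
  by (intro allI impI exI[of _ "\<lambda>_. 0"]) (auto simp: gsub_0 khom_0 D_def)

definition unit0 :: "('n, 'k) mpoly \<Rightarrow> ('n, 'k) kvec"
  where "unit0 f = (\<lambda>s. if s = {} then f else 0)"

lemma unit0_Kos: "unit0 f \<in> Kos 0"
  by (auto simp: unit0_def Kos_def)

lemma unit0_eq: "z \<in> Kos 0 \<Longrightarrow> z = unit0 (z {})"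
  by (auto simp: unit0_def Kos_def fun_eq_iff)

text \<open>Unless \<open>g\<close> already lies in \<open>N\<close>, the factor is \<open>k\<close>
  placed in degree \<open>e\<close> with basis the class of \<open>g\<close>, and the coefficients
  of a chain form a chain over \<open>k\<close> of degree \<open>j - e\<close>.\<close>

lemma van_adjoin:
  assumes N: "gsub N" and g: "\<And>i. ksmult (pvar i) g \<in> N" and h: "khom e g"
    and v: "van p (j - e) (Kos 0) (Bnd 0)"
  shows "van p j (adjoin N g) N"
proof (cases "g \<in> N")
  case True
  have "z \<in> N" if z: "z \<in> adjoin N g" for z
  proof -
    obtain c where "z - ksmult (pconst c) g \<in> N" using z by (auto simp: adjoin_def)
    then show ?thesis by (rule gsub_diff_trans[OF N _ gsub_smult[OF N True]])
  qed
  then have "adjoin N g = N" using adjoin_sub[of N g] by blast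
  then show ?thesis using van_refl[OF N] by simp
next
  case gN: False
  show ?thesis
  proof (rule vanI)
    fix x assume x: "chain p j (adjoin N g) x" "cycle p N x"
    have "\<forall>b. \<exists>c. b < r p \<longrightarrow> x b - ksmult (pconst c) g \<in> N"
      using x(1) by (auto simp: chain_def adjoin_def)
    then obtain c where c: "\<And>b. b < r p \<Longrightarrow> x b - ksmult (pconst (c b)) g \<in> N" by metis
    \<comment> \<open>A coefficient is kept only where the degree matches; elsewhere the component
      of degree \<open>j - dg p b\<close> shows that \<open>x b\<close> itself lies in
      \<open>N\<close>.\<close>
    define d where "d b = (if dg p b = j - e then pconst (c b) else 0 :: ('n, 'k) mpoly)" for b
    have xd: "x b - ksmult (d b) g \<in> N" if b: "b < r p" for b
    proof (cases "dg p b = j - e")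
      case True
      then show ?thesis using c[OF b] by (simp add: d_def)
    next
      case False
      have "khom e (ksmult (pconst (c b)) g)" using khom_smult[OF forms_pconst h] by simp
      then have "khcomp (j - dg p b) (x b - ksmult (pconst (c b)) g) = x b"
        using x(1) b False by (simp add: khcomp_diff khcomp_eq khcomp_eq_0 chain_def)
      then show ?thesis using gsub_khcomp[OF N c[OF b], of "j - dg p b"] False by (simp add: d_def)
    qed
    have d_forms: "d b \<in> forms (j - e - dg p b)" for b
      using forms_pconst by (auto simp: d_def)
    have "khom (j - e - dg p b) (unit0 (d b))" for b
      using d_forms[of b] by (simp add: khom_def unit0_def)
    then have 1: "chain p (j - e) (Kos 0) (\<lambda>b. unit0 (d b))"
      unfolding chain_def using unit0_Kos by blast
    have D_unit0: "D q (\<lambda>b. unit0 (f b)) a = unit0 (\<Sum>b<r (Suc q). A q a b * f b)" for q f a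
      by (auto simp: fun_eq_iff D_apply unit0_def)
    have "D q (\<lambda>b. unit0 (d b)) a \<in> Bnd 0" if q: "p = Suc q" "a < r q" for q a
    proof -
      define f where "f = (\<Sum>b<r (Suc q). A q a b * d b)"
      have "D q x a - D q (\<lambda>b. ksmult (d b) g) a \<in> N"
        using xd q by (intro D_cong_mod N) auto
      moreover have "D q x a \<in> N" using x(2) q by (simp add: cycle_def)
      ultimately have "D q x a - (D q x a - D q (\<lambda>b. ksmult (d b) g) a) \<in> N"
        using gsub_diff[OF N] by blast
      then have "ksmult f g \<in> N" by (simp add: D_def f_def ksmult_sum_left ksmult_mult)
      moreover have "ksmult (f - pconst (lookup f 0)) g \<in> N"
        by (rule gsub_max_ideal[OF N g]) (auto simp: lookup_minus pconst_def)
      ultimately have "ksmult f g - ksmult (f - pconst (lookup f 0)) g \<in> N"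
        using gsub_diff[OF N] by blast
      then have "ksmult (pconst (lookup f 0)) g \<in> N"
        by (simp add: ksmult_diff_left)
      \<comment> \<open>Dividing by a nonzero constant term would put \<open>g\<close> into
        \<open>N\<close>.\<close>
      then have "ksmult (pconst (inverse (lookup f 0)) * pconst (lookup f 0)) g \<in> N"
        using gsub_smult[OF N] by (simp add: ksmult_mult)
      then have "lookup f 0 = 0"
        using gN by (cases "lookup f 0 = 0") (auto simp: pconst_mult[symmetric])
      then show ?thesis by (simp add: D_unit0 f_def[symmetric] Bnd_0_iff unit0_Kos) (simp add: unit0_def)
    qed
    then have "cycle p (Bnd 0) (\<lambda>b. unit0 (d b))" by (simp add: cycle_def)
    then obtain y where y: "chain (Suc p) (j - e) (Kos 0) y" "\<And>b. b < r p \<Longrightarrow> unit0 (d b) - D p y b \<in> Bnd 0"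
      using vanD[OF v 1] by blast
    let ?y = "\<lambda>c. ksmult (y c {}) g"
    have "chain (Suc p) j (adjoin N g) ?y"
      unfolding chain_def
    proof (intro allI impI conjI)
      fix c assume c: "c < r (Suc p)"
      show "?y c \<in> adjoin N g" by (rule adjoin_smult[OF N g])
      have "y c {} \<in> forms (j - e - dg (Suc p) c)"
        using y(1) c by (auto simp: chain_def khom_def dest!: spec[of _ c] spec[of _ "{}"])
      then show "khom (j - dg (Suc p) c) (?y c)" by (rule khom_smult[OF _ h]) simp
    qed
    moreover have "x b - D p ?y b \<in> N" if b: "b < r p" for b
    proof -
      have "lookup (d b - (\<Sum>c<r (Suc p). A p b c * y c {})) 0 = 0"
        using y(2)[OF b] by (simp add: Bnd_0_iff unit0_def D_apply)
      then have "ksmult (d b - (\<Sum>c<r (Suc p). A p b c * y c {})) g \<in> N"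
        by (rule gsub_max_ideal[OF N g])
      then have "(x b - ksmult (d b) g) + ksmult (d b - (\<Sum>c<r (Suc p). A p b c * y c {})) g \<in> N"
        using gsub_add[OF N xd[OF b]] by blast
      then show ?thesis by (simp add: ksmult_diff_left ksmult_sum_left ksmult_mult D_def)
    qed
    ultimately show "\<exists>y. chain (Suc p) j (adjoin N g) y \<and> (\<forall>b<r p. x b - D p y b \<in> N)" by blast
  qed
qed

text \<open>The elements of \<open>G\<close> are adjoined one by one; each factor is zero or a
  shifted copy of \<open>k\<close>, and \<open>van_trans\<close> climbs the filtration.\<close>

lemma van_finite_ext:
  assumes N: "gsub N" and NZ: "N \<subseteq> Zc" and Zc: "gsub Zc"
    and IZ: "\<And>f z. f \<in> I \<Longrightarrow> z \<in> Zc \<Longrightarrow> ksmult f z \<in> N"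
    and G: "finite G" "G \<subseteq> Zc" "\<And>z i. z \<in> Zc \<Longrightarrow> ksmult (pvar i) z \<in> N"
      "\<And>z. z \<in> G \<Longrightarrow> \<exists>e. khom e z \<and> van p (j - e) (Kos 0) (Bnd 0)"
  shows "\<exists>M. gsub M \<and> N \<subseteq> M \<and> G \<subseteq> M \<and> M \<subseteq> Zc \<and> van p j M N"
  using G(1,2,4)
proof (induction G rule: finite_induct)
  case empty
  then show ?case using van_refl[OF N] N NZ by blast
next
  case (insert g G)
  then obtain M where M: "gsub M" "N \<subseteq> M" "G \<subseteq> M" "M \<subseteq> Zc" "van p j M N" by auto
  obtain e where e: "khom e g" "van p (j - e) (Kos 0) (Bnd 0)" using insert.prems(2)[of g] by blast
  have g: "\<And>i. ksmult (pvar i) g \<in> M" using G(3) insert M by auto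
  have sub: "adjoin M g \<subseteq> Zc"
  proof
    fix z assume "z \<in> adjoin M g"
    then obtain c where "z - ksmult (pconst c) g \<in> M" by (auto simp: adjoin_def)
    moreover have "g \<in> Zc" using insert.prems(1) by blast
    ultimately show "z \<in> Zc" using M(4) gsub_smult[OF Zc, of g "pconst c"] gsub_diff_trans[OF Zc] by blast
  qed
  have "van p j (adjoin M g) N"
    using sub by (intro van_trans[OF IZ N M(1) gsub_adjoin[OF M(1) g e(1)] M(2) adjoin_sub M(5) van_adjoin[OF M(1) g e]]) auto
  moreover have "g \<in> adjoin M g"
    using gsub_0[OF M(1)] by (auto simp: adjoin_def intro: exI[of _ 1])
  ultimately show ?case
    using sub M adjoin_sub[of M g] gsub_adjoin[OF M(1) g e(1)] by (intro exI[of _ "adjoin M g"]) auto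
qed

text \<open>No finiteness of Koszul homology has to be known: a chain has finitely many entries.
  Those of degree at most \<open>h\<close> are adjoined to \<open>Bnd i\<close>, and those of larger
  degree are boundaries by assumption, so the chain lives in a finite extension of
  \<open>Bnd i\<close>.\<close>

lemma van_Zyc_Bnd:
  assumes h: "\<And>e z. z \<in> Zyc i \<Longrightarrow> khom e z \<Longrightarrow> real_of_int e > h \<Longrightarrow> z \<in> Bnd i"
    and v: "\<And>e. real_of_int e \<le> h \<Longrightarrow> van p (j - e) (Kos 0) (Bnd 0)"
  shows "van p j (Zyc i) (Bnd i)"
proof (rule vanI)
  fix x assume x: "chain p j (Zyc i) x" "cycle p (Bnd i) x"
  define G where "G = x ` {b. b < r p \<and> real_of_int (j - dg p b) \<le> h}"
  have IZ: "ksmult f z \<in> Bnd i" if "f \<in> I" "z \<in> Zyc i" for f z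
    using smult_I_Kos[OF that(1)] that Zyc_sub_Kos IKos_sub_Bnd by blast
  have "\<exists>M. gsub M \<and> Bnd i \<subseteq> M \<and> G \<subseteq> M \<and> M \<subseteq> Zyc i \<and> van p j M (Bnd i)"
  proof (rule van_finite_ext[OF gsub_Bnd Bnd_sub_Zyc gsub_Zyc IZ])
    show "finite G" by (simp add: G_def)
    show "G \<subseteq> Zyc i" using x(1) by (auto simp: G_def chain_def)
    show "\<And>z l. z \<in> Zyc i \<Longrightarrow> ksmult (pvar l) z \<in> Bnd i" by (rule pvar_Zyc)
    show "\<exists>e. khom e z \<and> van p (j - e) (Kos 0) (Bnd 0)" if z: "z \<in> G" for z
    proof -
      obtain b where "z = x b" "b < r p" "real_of_int (j - dg p b) \<le> h" using z by (auto simp: G_def)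
      then show ?thesis using x(1) v[of "j - dg p b"] unfolding chain_def by blast
    qed
  qed
  then obtain M where M: "gsub M" "Bnd i \<subseteq> M" "G \<subseteq> M" "M \<subseteq> Zyc i" "van p j M (Bnd i)" by blast
  have "x b \<in> M" if "b < r p" for b
  proof (cases "real_of_int (j - dg p b) \<le> h")
    case True
    then show ?thesis using that M(3) by (auto simp: G_def)
  next
    case False
    then have "x b \<in> Bnd i" using x(1) that by (intro h[of "x b" "j - dg p b"]) (auto simp: chain_def)
    then show ?thesis using M(2) by blast
  qed
  then have "chain p j M x" using x(1) by (simp add: chain_def)
  then obtain y where "chain (Suc p) j M y" "\<And>b. b < r p \<Longrightarrow> x b - D p y b \<in> Bnd i"
    using vanD[OF M(5) _ x(2)] by blast
  then show "\<exists>y. chain (Suc p) j (Zyc i) y \<and> (\<forall>b<r p. x b - D p y b \<in> Bnd i)"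
    using chain_mono[OF M(4)] by blast
qed

text \<open>In homological degree \<open>0\<close> every chain is a cycle, so enlarging
  \<open>N\<close> only weakens the claim.\<close>

lemma van_weaken:
  assumes "van 0 j M N" "N \<subseteq> N'"
  shows "van 0 j M N'"
proof (rule vanI)
  fix x assume "chain 0 j M x" "cycle 0 N' x"
  then obtain y where "chain (Suc 0) j M y" "\<And>b. b < r 0 \<Longrightarrow> x b - D 0 y b \<in> N"
    using vanD[OF assms(1), of x] by (auto simp: cycle_def)
  then show "\<exists>y. chain (Suc 0) j M y \<and> (\<forall>b<r 0. x b - D 0 y b \<in> N')" using assms(2) by blast
qed

text \<open>The degree form of Serre's bound for the Poincare series of the residue field in terms of
  Koszul homology.\<close>

theorem van_residue_field:
  fixes a h :: "nat \<Rightarrow> real"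
  assumes a: "a 0 = 0" "\<And>p. real p \<le> a p"
    and ah: "\<And>q i. i \<ge> 1 \<Longrightarrow> a q + h i \<le> a (q + i + 1)"
    and h: "\<And>i e z. i \<ge> 1 \<Longrightarrow> z \<in> Zyc i \<Longrightarrow> khom e z \<Longrightarrow> real_of_int e > h i \<Longrightarrow> z \<in> Bnd i"
  shows "real_of_int j > a p \<Longrightarrow> van p j (Kos 0) (Bnd 0)"
proof (induction p arbitrary: j rule: less_induct)
  case (less p)
  show ?case
  proof (cases p)
    case 0
    then show ?thesis
      using less.prems a(1) by (auto intro!: van_weaken[OF van_Kos_0 IKos_sub_Bnd])
  next
    case (Suc p')
    have IK: "f \<in> I \<Longrightarrow> z \<in> Kos i \<Longrightarrow> ksmult f z \<in> IKos i" for f z i by (rule smult_I_Kos)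
    have IZ: "f \<in> I \<Longrightarrow> z \<in> Zyc i \<Longrightarrow> ksmult f z \<in> IKos i" for f z i using IK Zyc_sub_Kos by blast
    \<comment> \<open>Passing from \<open>Bnd i\<close> to \<open>Zyc (Suc i)\<close> lowers
      \<open>q\<close> and raises \<open>i\<close> by one, so \<open>q + i + 1\<close> stays
      constant along this inner induction. Each passage meets one Koszul homology module, whose
      copies of \<open>k\<close> are covered by the outer induction.\<close>
    have "van q l (Bnd i) (IKos i)" if "q \<le> p'" "real_of_int l > a (q + i + 1)" for q i l
      using that
    proof (induction q arbitrary: i)
      case 0
      \<comment> \<open>\<open>Bnd i\<close> modulo \<open>IKos i\<close> is an image of
        \<open>Kos (Suc i)\<close>, which is generated in degree \<open>i + 1\<close>; this is where
        \<open>a\<close> must dominate the identity.\<close>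
      have "real_of_int l > real (Suc i)" using 0 a(2)[of "Suc i"] by simp
      then have "l \<noteq> int (Suc i)" by linarith
      then show ?case
        by (intro van_Bnd van_weaken[OF van_Kos_0 IKos_sub_Zyc])
    next
      case (Suc q)
      have "van q l (Zyc (Suc i)) (Bnd (Suc i))"
      proof (rule van_Zyc_Bnd[where h = "h (Suc i)"])
        show "\<And>e z. z \<in> Zyc (Suc i) \<Longrightarrow> khom e z \<Longrightarrow> h (Suc i) < real_of_int e \<Longrightarrow> z \<in> Bnd (Suc i)"
          by (rule h[of "Suc i"]) auto
        fix e assume "real_of_int e \<le> h (Suc i)"
        then have "real_of_int (l - e) > a q"
          using Suc.prems ah[of "Suc i" q] by (simp add: algebra_simps)
        then show "van q (l - e) (Kos 0) (Bnd 0)"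
          using Suc.prems \<open>p = Suc p'\<close> by (intro less.IH) auto
      qed
      moreover have "van q l (Bnd (Suc i)) (IKos (Suc i))"
        using Suc.prems by (intro Suc.IH) (auto simp: algebra_simps)
      ultimately have "van q l (Zyc (Suc i)) (IKos (Suc i))"
        by (intro van_trans[OF IZ gsub_IKos gsub_Bnd gsub_Zyc IKos_sub_Bnd Bnd_sub_Zyc]) auto
      then show ?case
        by (intro van_Bnd van_quotient[OF IK gsub_IKos gsub_Zyc gsub_Kos IKos_sub_Zyc Zyc_sub_Kos] van_Kos_Suc) auto
    qed
    \<comment> \<open>The maximal ideal is \<open>Bnd 0\<close>; one last connecting map leads from
      \<open>k\<close> to it.\<close>
    from this[of p' 0 j] have "van p' j (Bnd 0) (IKos 0)" using less.prems Suc by simp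
    then show ?thesis unfolding Suc
      using Bnd_sub_Zyc Zyc_sub_Kos
      by (intro van_quotient[OF IK gsub_IKos gsub_Bnd gsub_Kos IKos_sub_Bnd] van_Kos_Suc) auto
  qed
qed

text \<open>The recursion is run backwards at its lowest stage: two connecting maps carry the
  vanishing over to \<open>k\<close> tensored with \<open>Zyc 1\<close> modulo
  \<open>IKos 1\<close>. So a cycle of degree \<open>j\<close> is, modulo \<open>IKos 1\<close>, a
  combination of cycles with coefficients in the maximal ideal, and \<open>pvar_Zyc\<close> makes
  that a boundary.\<close>

theorem van_2_imp_Bnd:
  assumes v: "van 2 j (Kos 0) (Bnd 0)" and j: "j \<noteq> 1" and z: "z \<in> Zyc 1" "khom j z"
  shows "z \<in> Bnd 1"
proof -
  have IK: "f \<in> I \<Longrightarrow> z \<in> Kos i \<Longrightarrow> ksmult f z \<in> IKos i" for f z i by (rule smult_I_Kos)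
  have "van (Suc 0) j (Bnd 0) (IKos 0)"
  proof (rule van_sub[OF _ gsub_IKos gsub_Bnd gsub_Kos IKos_sub_Bnd])
    show "van (Suc (Suc 0)) j (Kos 0) (Bnd 0)" using v by (simp only: numeral_2_eq_2)
    show "Bnd 0 \<subseteq> Kos 0" using Bnd_sub_Zyc Zyc_sub_Kos by blast
  qed (rule IK van_Kos_Suc; assumption)+
  then have v1: "van (Suc 0) j (Kos (Suc 0)) (Zyc (Suc 0))" by (rule van_Kos_Zyc)
  have v2: "van 0 j (Kos (Suc 0)) (IKos (Suc 0))" using j by (intro van_Kos_0) simp
  have v0: "van 0 j (Zyc 1) (IKos 1)"
    unfolding One_nat_def
    by (rule van_sub[OF _ gsub_IKos gsub_Zyc gsub_Kos IKos_sub_Zyc Zyc_sub_Kos v1 v2]) (rule IK)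
  \<comment> \<open>This basis element has degree \<open>0\<close> by \<open>aug_deg\<close>.
    Placing \<open>z\<close> there and contracting with \<open>\<alpha>\<close> afterwards returns a
    nonzero multiple of \<open>z\<close>.\<close>
  obtain a where a: "a < r 0" "\<alpha> a \<noteq> 0" using aug_surj by blast
  define x where "x b = (if b = a then z else 0)" for b
  have x: "chain 0 j (Zyc 1) x"
    using z aug_deg[OF a(1)] a(2) by (cases "dg 0 a = 0") (auto simp: chain_def x_def gsub_0[OF gsub_Zyc] khom_0)
  obtain y where y: "chain (Suc 0) j (Zyc 1) y" "\<And>b. b < r 0 \<Longrightarrow> x b - D 0 y b \<in> IKos 1"
    by (rule vanD[OF v0 x]) (auto simp: cycle_def)
  have 1: "(\<Sum>b<r 0. ksmult (pconst (\<alpha> b)) (x b - D 0 y b)) \<in> Bnd 1"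
    using y(2) IKos_sub_Bnd by (intro gsub_sum gsub_smult gsub_Bnd) auto
  \<comment> \<open>These coefficients have no constant term, since the augmentation kills the image
    of the first matrix.\<close>
  define f where "f c = (\<Sum>b<r 0. pconst (\<alpha> b) * A 0 b c)" for c
  have "(\<Sum>b<r 0. ksmult (pconst (\<alpha> b)) (D 0 y b)) = (\<Sum>b<r 0. \<Sum>c<r (Suc 0). ksmult (pconst (\<alpha> b) * A 0 b c) (y c))"
    by (simp add: D_def ksmult_sum ksmult_mult)
  also have "\<dots> = (\<Sum>c<r (Suc 0). ksmult (f c) (y c))"
    by (subst sum.swap) (simp add: ksmult_sum_left f_def)
  also have "\<dots> \<in> Bnd 1"
  proof (intro gsub_sum gsub_Bnd)
    fix c assume c: "c \<in> {..<r (Suc 0)}"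
    have "ksmult (pvar i) (y c) \<in> Bnd 1" for i using y(1) c by (auto simp: chain_def intro: pvar_Zyc)
    moreover have "lookup (f c) 0 = 0"
      using complex_0[of c] c by (simp add: f_def lookup_sum lookup_pconst_mult)
    ultimately show "ksmult (f c) (y c) \<in> Bnd 1" by (rule gsub_max_ideal[OF gsub_Bnd])
  qed
  finally have 2: "(\<Sum>b<r 0. ksmult (pconst (\<alpha> b)) (D 0 y b)) \<in> Bnd 1" .
  have "(\<Sum>b<r 0. ksmult (pconst (\<alpha> b)) (x b)) \<in> Bnd 1"
    using gsub_add[OF gsub_Bnd 1 2] by (simp add: ksmult_diff sum_subtractf)
  moreover have "(\<Sum>b<r 0. ksmult (pconst (\<alpha> b)) (x b)) = (\<Sum>b<r 0. if b = a then ksmult (pconst (\<alpha> a)) z else 0)"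
    by (intro sum.cong) (auto simp: x_def)
  ultimately have "ksmult (pconst (\<alpha> a)) z \<in> Bnd 1" using a(1) by simp
  then have "ksmult (pconst (inverse (\<alpha> a))) (ksmult (pconst (\<alpha> a)) z) \<in> Bnd 1"
    by (rule gsub_smult[OF gsub_Bnd])
  then show ?thesis using a(2) by (simp add: ksmult_mult[symmetric] pconst_mult[symmetric])
qed

end

section \<open>Existence of resolutions by free modules of finite rank\<close>

definition fscale :: "'k::field \<Rightarrow> ('a \<Rightarrow> ('n::finite, 'k) mpoly) \<Rightarrow> 'a \<Rightarrow> ('n, 'k) mpoly"
  where "fscale c x = (\<lambda>a. pconst c * x a)"

definition pscale :: "'k::field \<Rightarrow> ('n::finite, 'k) mpoly \<Rightarrow> ('n, 'k) mpoly"
  where "pscale c f = pconst c * f"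

interpretation fvs: vector_space fscale
  by unfold_locales (auto simp: fscale_def fun_eq_iff pconst_add pconst_mult algebra_simps)

interpretation pvs: vector_space pscale
  by unfold_locales (auto simp: pscale_def pconst_add pconst_mult algebra_simps)

lemma (in vector_space) finite_spanning_subset:
  assumes "V \<subseteq> span T" "finite T"
  obtains B where "finite B" "B \<subseteq> V" "independent B" "V \<subseteq> span B"
  using maximal_independent_subset[of V] independent_span_bound[OF assms(2)] assms(1)
  by (metis subset_trans)

lemma monomial_span: "f \<in> forms d \<Longrightarrow> f = (\<Sum>u\<in>keys f. pconst (lookup f u) * single u 1)"
  using monomial_sum[of f] by (simp add: pconst_def mult_single)

context graded_ideal
begin

text \<open>Modulo \<open>I\<close> only the degrees from \<open>0\<close> to \<open>R\<close>
  count. \<open>T\<close> may exceed this window because one common set of total degrees, shifted by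
  \<open>dg a\<close>, has to serve all coordinates \<open>a\<close>.\<close>

lemma hcomp_window:
  assumes "\<And>d. d > R \<Longrightarrow> forms d \<subseteq> I" "finite T" "{0..R} \<subseteq> T"
  shows "f - (\<Sum>d\<in>T. hcomp d f) \<in> I"
proof -
  obtain N where N: "f = (\<Sum>d\<in>{..<N::nat}. hcomp (int d) f)" using hcomp_decomp by blast
  have bad: "hcomp d f \<in> I" if "d \<notin> {0..R}" for d
    using that assms(1)[of d] hcomp_forms[of d f] forms_neg[of "hcomp d f" d] I_0 by (cases "d < 0") auto
  have "f = (\<Sum>d\<in>int ` {..<N}. hcomp d f)" by (subst sum.reindex) (use N in auto)
  also have "\<dots> = (\<Sum>d\<in>int ` {..<N} \<inter> {0..R}. hcomp d f) + (\<Sum>d\<in>int ` {..<N} - {0..R}. hcomp d f)"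
    by (rule sum.Int_Diff) auto
  finally have 1: "f - (\<Sum>d\<in>int ` {..<N} \<inter> {0..R}. hcomp d f) \<in> I"
    using I_sum[of "int ` {..<N} - {0..R}" "\<lambda>d. hcomp d f"] bad
    by (metis DiffD2 add_diff_cancel_left')
  have "(\<Sum>d\<in>int ` {..<N} \<inter> {0..R}. hcomp d f) = (\<Sum>d\<in>{0..R}. hcomp d f)"
  proof (rule sum.mono_neutral_left)
    show "\<forall>d\<in>{0..R} - int ` {..<N} \<inter> {0..R}. hcomp d f = 0"
    proof
      fix d assume d: "d \<in> {0..R} - int ` {..<N} \<inter> {0..R}"
      then have dN: "d \<notin> int ` {..<N}" by auto
      have "hcomp d f = (\<Sum>e\<in>{..<N}. hcomp d (hcomp (int e) f))"
        using arg_cong[OF N, of "hcomp d"] by (simp add: hcomp_sum)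
      also have "\<dots> = 0"
        using dN by (intro sum.neutral ballI hcomp_eq_0[OF hcomp_forms]) auto
      finally show "hcomp d f = 0" .
    qed
  qed auto
  moreover have "(\<Sum>d\<in>T. hcomp d f) = (\<Sum>d\<in>{0..R}. hcomp d f) + (\<Sum>d\<in>T - {0..R}. hcomp d f)"
    using sum.subset_diff[OF assms(3,2), of "\<lambda>d. hcomp d f"] by (simp add: add.commute)
  moreover have "(\<Sum>d\<in>T - {0..R}. hcomp d f) \<in> I" by (intro I_sum bad) auto
  ultimately show ?thesis using I_diff[OF 1] by (simp add: diff_diff_eq)
qed

text \<open>Graded submodules, containing all multiples of \<open>I\<close>, of the free module with
  basis degrees \<open>dg\<close>. Vectors are functions on all naturals; the last clause makes the
  entries from \<open>r\<close> on arbitrary.\<close>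

definition graded_relations :: "nat \<Rightarrow> (nat \<Rightarrow> int) \<Rightarrow> (nat \<Rightarrow> ('n, 'k) mpoly) set \<Rightarrow> bool"
  where "graded_relations r dg Q \<longleftrightarrow>
    (\<forall>x\<in>Q. \<forall>y\<in>Q. (\<lambda>a. x a + y a) \<in> Q) \<and> (\<forall>x\<in>Q. \<forall>f. (\<lambda>a. f * x a) \<in> Q) \<and>
    (\<forall>x\<in>Q. \<forall>j. (\<lambda>a. hcomp (j - dg a) (x a)) \<in> Q) \<and>
    (\<forall>x. (\<forall>a<r. x a \<in> I) \<longrightarrow> x \<in> Q)"

lemma
  assumes "graded_relations r dg Q"
  shows graded_relations_add: "x \<in> Q \<Longrightarrow> y \<in> Q \<Longrightarrow> (\<lambda>a. x a + y a) \<in> Q"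
    and graded_relations_smult: "x \<in> Q \<Longrightarrow> (\<lambda>a. f * x a) \<in> Q"
    and graded_relations_hcomp: "x \<in> Q \<Longrightarrow> (\<lambda>a. hcomp (j - dg a) (x a)) \<in> Q"
    and graded_relations_I: "(\<And>a. a < r \<Longrightarrow> x a \<in> I) \<Longrightarrow> x \<in> Q"
  using assms by (auto simp: graded_relations_def)

lemma graded_relations_cong:
  assumes "graded_relations r dg Q" "x \<in> Q" "\<And>a. a < r \<Longrightarrow> y a - x a \<in> I"
  shows "y \<in> Q"
  using graded_relations_add[OF assms(1,2) graded_relations_I[OF assms(1), of "\<lambda>a. y a - x a"]] assms(3)
  by simp

lemma graded_relations_sum:
  assumes "graded_relations r dg Q" "\<And>c. c \<in> E \<Longrightarrow> x c \<in> Q"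
  shows "(\<lambda>a. \<Sum>c\<in>E. x c a) \<in> Q"
  using assms(2)
proof (induction E rule: infinite_finite_induct)
  case (insert c E)
  then have "(\<lambda>a. x c a + (\<Sum>c\<in>E. x c a)) \<in> Q"
    by (intro graded_relations_add[OF assms(1)]) auto
  then show ?case using insert by simp
qed (auto intro!: graded_relations_I[OF assms(1)] I_0)

text \<open>This replaces an appeal to Noetherianity. Modulo \<open>I\<close> a relation is the sum
  of its components in the finitely many total degrees \<open>j\<close> with \<open>j - dg a\<close>
  between \<open>0\<close> and \<open>R\<close> for some \<open>a\<close>, and each component varies
  in a finite-dimensional space. Finite spanning sets of these spaces become the columns of
  \<open>A\<close>.\<close>

lemma relations_generators:
  assumes R: "\<And>d. d > R \<Longrightarrow> forms d \<subseteq> I" and Q: "graded_relations r dg Q"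
  shows "\<exists>(r' :: nat) dg' A. (\<forall>a<r. \<forall>c<r'. A a c \<in> forms (dg' c - dg a)) \<and>
    Q = {x. \<exists>y. \<forall>a<r. x a - (\<Sum>c<r'. A a c * y c) \<in> I}"
proof -
  define V where "V j = {x \<in> Q. (\<forall>a<r. x a \<in> forms (j - dg a)) \<and> (\<forall>a\<ge>r. x a = 0)}" for j
  define T where "T j = (\<lambda>(a, u) b. if b = a then single u 1 else (0 :: ('n, 'k) mpoly)) `
    Sigma {..<r} (\<lambda>a. {u. int (mdeg u) = j - dg a})" for j
  have finT: "finite (T j)" for j
  proof -
    have "finite {u :: 'n \<Rightarrow>\<^sub>0 nat. int (mdeg u) = d}" for d
      using finite_mdeg[of "nat d"] by (rule finite_subset[rotated]) auto
    then show ?thesis unfolding T_def by auto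
  qed
  have VT: "V j \<subseteq> fvs.span (T j)" for j
  proof
    fix x assume x: "x \<in> V j"
    define s where "s a u = (\<lambda>b. if b = a then single u 1 else (0 :: ('n, 'k) mpoly))" for a :: nat and u :: "'n \<Rightarrow>\<^sub>0 nat"
    have "x = (\<Sum>a<r. \<Sum>u\<in>keys (x a). fscale (lookup (x a) u) (s a u))"
    proof
      fix b
      have "(\<Sum>a<r. \<Sum>u\<in>keys (x a). fscale (lookup (x a) u) (s a u)) b
        = (\<Sum>a<r. if a = b then \<Sum>u\<in>keys (x a). pconst (lookup (x a) u) * single u 1 else 0)"
        unfolding sum_fun_apply by (intro sum.cong refl) (auto simp: fscale_def s_def)
      also have "\<dots> = x b"
        using x monomial_span[of "x b"] by (auto simp: V_def not_less)
      finally show "x b = (\<Sum>a<r. \<Sum>u\<in>keys (x a). fscale (lookup (x a) u) (s a u)) b" by simp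
    qed
    also have "\<dots> \<in> fvs.span (T j)"
    proof (intro fvs.span_sum fvs.span_scale fvs.span_base)
      fix a u assume "a \<in> {..<r}" "u \<in> keys (x a)"
      then have "(a, u) \<in> Sigma {..<r} (\<lambda>a. {u. int (mdeg u) = j - dg a})"
        using x by (auto simp: V_def forms_iff in_keys_iff)
      then show "s a u \<in> T j" unfolding T_def s_def by (auto intro!: image_eqI[of _ _ "(a, u)"])
    qed
    finally show "x \<in> fvs.span (T j)" .
  qed
  have "\<exists>B. finite B \<and> B \<subseteq> V j \<and> V j \<subseteq> fvs.span B" for j
    using fvs.finite_spanning_subset[OF VT finT, of j] by metis
  then obtain B where B: "\<And>j. finite (B j)" "\<And>j. B j \<subseteq> V j" "\<And>j. V j \<subseteq> fvs.span (B j)" by metis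
  define J where "J = (\<lambda>(a, d). dg a + d) ` ({..<r} \<times> {0..R})"
  \<comment> \<open>Pairs of a total degree and a vector, so that each column remembers its
    degree.\<close>
  define E where "E = Sigma J B"
  have finE: "finite E" unfolding E_def J_def using B(1) by auto
  define r' where "r' = card E"
  obtain e where e: "bij_betw e {..<r'} E"
    using ex_bij_betw_nat_finite[OF finE] unfolding r'_def atLeast0LessThan by blast
  define A where "A a c = snd (e c) a" for a c
  have col: "(\<lambda>a. A a c) \<in> V (fst (e c))" if "c < r'" for c
  proof -
    have "e c \<in> E" using e that by (auto simp: bij_betw_def)
    then have "snd (e c) \<in> V (fst (e c))" using B(2)[of "fst (e c)"] by (auto simp: E_def)
    then show ?thesis by (simp add: A_def)
  qed
  have "Q = {x. \<exists>y. \<forall>a<r. x a - (\<Sum>c<r'. A a c * y c) \<in> I}"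
  proof (intro equalityI subsetI CollectI)
    fix x assume x: "x \<in> Q"
    define xj where "xj j = (\<lambda>a. if a < r then hcomp (j - dg a) (x a) else 0)" for j
    have "xj j \<in> V j" for j
    proof -
      have "(\<lambda>a. hcomp (j - dg a) (x a)) \<in> Q" by (rule graded_relations_hcomp[OF Q x])
      then have "xj j \<in> Q" by (rule graded_relations_cong[OF Q]) (simp add: xj_def I_0)
      then show ?thesis by (simp add: V_def xj_def)
    qed
    then have "\<exists>k. xj j = (\<Sum>b\<in>B j. fscale (k b) b)" for j
      using B(3)[of j] fvs.span_finite[OF B(1), of j] by (smt (verit) imageE subsetD)
    then obtain k where k: "\<And>j. xj j = (\<Sum>b\<in>B j. fscale (k j b) b)" by metis
    define y :: "nat \<Rightarrow> ('n, 'k) mpoly" where "y c = pconst (k (fst (e c)) (snd (e c)))" for c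
    have "x a - (\<Sum>c<r'. A a c * y c) \<in> I" if a: "a < r" for a
    proof -
      have "(\<Sum>c<r'. A a c * y c) = (\<Sum>p\<in>E. snd p a * pconst (k (fst p) (snd p)))"
        using sum.reindex_bij_betw[OF e, of "\<lambda>p. snd p a * pconst (k (fst p) (snd p))"]
        by (simp add: A_def y_def)
      also have "\<dots> = (\<Sum>j\<in>J. \<Sum>b\<in>B j. b a * pconst (k j b))"
        unfolding E_def by (subst sum.Sigma) (auto simp: J_def B(1) case_prod_unfold)
      also have "\<dots> = (\<Sum>j\<in>J. xj j a)"
        by (intro sum.cong refl) (simp add: k sum_fun_apply fscale_def mult.commute)
      also have "\<dots> = (\<Sum>d\<in>(\<lambda>j. j - dg a) ` J. hcomp d (x a))"
        by (subst sum.reindex) (auto simp: inj_on_def xj_def a)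
      finally have eq: "(\<Sum>c<r'. A a c * y c) = \<dots>" .
      have "{0..R} \<subseteq> (\<lambda>j. j - dg a) ` J"
      proof
        fix d assume "d \<in> {0..R}"
        then have "dg a + d \<in> J" using a unfolding J_def by (intro image_eqI[of _ _ "(a, d)"]) auto
        then show "d \<in> (\<lambda>j. j - dg a) ` J" by (intro image_eqI[of _ _ "dg a + d"]) auto
      qed
      then show ?thesis unfolding eq
        by (intro hcomp_window[OF R]) (auto simp: J_def)
    qed
    then show "\<exists>y. \<forall>a<r. x a - (\<Sum>c<r'. A a c * y c) \<in> I" by blast
  next
    fix x assume "x \<in> {x. \<exists>y. \<forall>a<r. x a - (\<Sum>c<r'. A a c * y c) \<in> I}"
    then obtain y where y: "\<And>a. a < r \<Longrightarrow> x a - (\<Sum>c<r'. A a c * y c) \<in> I" by blast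
    have "(\<lambda>a. \<Sum>c<r'. y c * A a c) \<in> Q"
    proof (rule graded_relations_sum[OF Q])
      fix c assume "c \<in> {..<r'}"
      then have "(\<lambda>a. A a c) \<in> Q" using col[of c] by (simp add: V_def)
      then show "(\<lambda>a. y c * A a c) \<in> Q" by (rule graded_relations_smult[OF Q])
    qed
    then show "x \<in> Q" using y by (intro graded_relations_cong[OF Q, of _ x]) (auto simp: mult.commute)
  qed
  moreover have "\<forall>a<r. \<forall>c<r'. A a c \<in> forms (fst (e c) - dg a)"
    using col by (simp add: V_def)
  ultimately show ?thesis by (intro exI[of _ r'] exI[of _ "\<lambda>c. fst (e c)"] exI[of _ A] conjI)
qed

lemma kernel_relations:
  assumes A: "\<And>a b. a < r \<Longrightarrow> b < r' \<Longrightarrow> A a b \<in> forms (dg' b - dg a)"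
  shows "graded_relations r' dg' {x. \<forall>a<r. (\<Sum>b<r'. A a b * x b) \<in> I}"
  unfolding graded_relations_def
proof (intro conjI ballI allI impI; clarify?)
  fix x y a assume "\<forall>a<r. (\<Sum>b<r'. A a b * x b) \<in> I" "\<forall>a<r. (\<Sum>b<r'. A a b * y b) \<in> I" "a < r"
  then show "(\<Sum>b<r'. A a b * (x b + y b)) \<in> I"
    using I_add by (simp add: distrib_left sum.distrib)
next
  fix x f a assume "\<forall>a<r. (\<Sum>b<r'. A a b * x b) \<in> I" "a < r"
  then have "f * (\<Sum>b<r'. A a b * x b) \<in> I" using I_mult by blast
  then show "(\<Sum>b<r'. A a b * (f * x b)) \<in> I" by (simp add: sum_distrib_left mult.left_commute)
next
  fix x j a assume "\<forall>a<r. (\<Sum>b<r'. A a b * x b) \<in> I" "a < r"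
  then have "hcomp (j - dg a) (\<Sum>b<r'. A a b * x b) \<in> I" using I_hcomp by blast
  also have "hcomp (j - dg a) (\<Sum>b<r'. A a b * x b) = (\<Sum>b<r'. A a b * hcomp (j - dg' b) (x b))"
    unfolding hcomp_sum using A \<open>a < r\<close> by (intro sum.cong refl) (simp add: hcomp_mult[OF A])
  finally show "(\<Sum>b<r'. A a b * hcomp (j - dg' b) (x b)) \<in> I" .
next
  fix x a assume "\<forall>b<r'. x b \<in> I" "a < r"
  then show "(\<Sum>b<r'. A a b * x b) \<in> I" by (intro I_sum I_mult) auto
qed

theorem lifted_resolution_exists:
  assumes R: "\<And>d. d > R \<Longrightarrow> forms d \<subseteq> I"
  shows "\<exists>r dg A \<alpha>. lifted_resolution I r dg A \<alpha>"
proof -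
  have gen: "\<exists>(r' :: nat) dg' A. (\<forall>a<r. \<forall>c<r'. A a c \<in> forms (dg' c - dg a)) \<and>
    Q = {x. \<exists>y. \<forall>a<r. x a - (\<Sum>c<r'. A a c * y c) \<in> I}" if "graded_relations r dg Q" for r dg Q
    by (rule relations_generators[OF _ that, where R = R]) (rule R)
  \<comment> \<open>A single generator of degree \<open>0\<close> maps to \<open>1\<close> in
    \<open>k\<close>; its relations form the maximal ideal.\<close>
  define Q0 where "Q0 = {x :: nat \<Rightarrow> ('n, 'k) mpoly. lookup (x 0) 0 = 0}"
  have gr0: "graded_relations 1 (\<lambda>_. 0) Q0"
    by (auto simp: graded_relations_def Q0_def lookup_add const_mult const_hcomp I_max)
  obtain r1 :: nat and dg1 A0 where A0: "(\<forall>a<1. \<forall>c<r1. A0 a c \<in> forms (dg1 c - 0)) \<and>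
    Q0 = {x. \<exists>y. \<forall>a<1::nat. x a - (\<Sum>c<r1. A0 a c * y c) \<in> I}"
    using gen[OF gr0] by (elim exE) (rule that)
  \<comment> \<open>A state is one matrix with the ranks and degrees of its target and source;
    \<open>?R\<close> makes the columns of the next matrix generate, modulo \<open>I\<close>, the
    kernel of the present one.\<close>
  let ?P = "\<lambda>n :: nat. \<lambda>(r :: nat, dg :: nat \<Rightarrow> int, r' :: nat, dg' :: nat \<Rightarrow> int, A). (\<forall>a<r. \<forall>c<r'. A a c \<in> forms (dg' c - dg a)) \<and>
    (n = 0 \<longrightarrow> r = (1::nat) \<and> dg = (\<lambda>_. 0) \<and> Q0 = {x. \<exists>y. \<forall>a<1::nat. x a - (\<Sum>c<r'. A a c * y c) \<in> I})"
  let ?R = "\<lambda>n :: nat. \<lambda>(r :: nat, dg :: nat \<Rightarrow> int, r', dg', A) (s, eg, s' :: nat, eg' :: nat \<Rightarrow> int, B). s = r' \<and> eg = dg' \<and>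
    {x. \<forall>a<r. (\<Sum>b<r'. A a b * x b) \<in> I} = {x. \<exists>y. \<forall>b<r'. x b - (\<Sum>c<s'. B b c * y c) \<in> I}"
  have "\<exists>f. \<forall>n. ?P n (f n) \<and> ?R n (f n) (f (Suc n))"
  proof (rule dependent_nat_choice)
    show "\<exists>st. ?P 0 st" using A0 by (intro exI[of _ "(1::nat, (\<lambda>_. 0) :: nat \<Rightarrow> int, r1, dg1, A0)"]) simp
  next
    fix st n assume st: "?P n st"
    obtain r dg r' dg' A where st': "st = (r, dg, r', dg', A)" by (cases st)
    have gr: "graded_relations r' dg' {x. \<forall>a<r. (\<Sum>b<r'. A a b * x b) \<in> I}"
      using st st' by (intro kernel_relations[where dg = dg]) auto
    obtain s' :: nat and eg' B where "(\<forall>a<r'. \<forall>c<s'. B a c \<in> forms (eg' c - dg' a)) \<and>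
      {x. \<forall>a<r. (\<Sum>b<r'. A a b * x b) \<in> I} = {x. \<exists>y. \<forall>a<r'. x a - (\<Sum>c<s'. B a c * y c) \<in> I}"
      using gen[OF gr] by (elim exE) (rule that)
    then show "\<exists>st'. ?P (Suc n) st' \<and> ?R n st st'"
      by (intro exI[of _ "(r', dg', s', eg', B)"]) (simp add: st')
  qed
  then obtain f where f': "\<forall>n. ?P n (f n) \<and> ?R n (f n) (f (Suc n))" ..
  have f: "?P n (f n)" "?R n (f n) (f (Suc n))" for n
    by (rule conjunct1[OF spec[OF f', of n]], rule conjunct2[OF spec[OF f', of n]])
  define r where "r n = fst (f n)" for n
  define dg where "dg n = fst (snd (f n))" for n
  define A where "A n = snd (snd (snd (snd (f n))))" for n
  have f_eq: "f n = (r n, dg n, r (Suc n), dg (Suc n), A n)" for n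
  proof -
    obtain a b c d e where 1: "f n = (a, b, c, d, e)" by (cases "f n")
    obtain a' b' c' d' e' where 2: "f (Suc n) = (a', b', c', d', e')" by (cases "f (Suc n)")
    show ?thesis using f(2)[of n] unfolding r_def dg_def A_def 1 2 by simp
  qed
  have P: "a < r n \<Longrightarrow> c < r (Suc n) \<Longrightarrow> A n a c \<in> forms (dg (Suc n) c - dg n a)" for n a c
    using f(1)[of n] by (simp add: f_eq)
  have P0: "r 0 = 1" "dg 0 = (\<lambda>_. 0)" "Q0 = {x. \<exists>y. \<forall>a<1::nat. x a - (\<Sum>c<r 1. A 0 a c * y c) \<in> I}"
    using f(1)[of 0] by (simp_all add: f_eq)
  have Q: "{x. \<forall>a<r n. (\<Sum>b<r (Suc n). A n a b * x b) \<in> I}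
      = {x. \<exists>y. \<forall>b<r (Suc n). x b - (\<Sum>c<r (Suc (Suc n)). A (Suc n) b c * y c) \<in> I}" for n
    using f(2)[of n] by (simp add: f_eq)
  \<comment> \<open>Unit vectors extract columns, which shows that the columns belong to the
    relations that they generate.\<close>
  have col: "(\<Sum>c<m. B b c * (if c = d then 1 else 0)) = B b d" if "d < m" for m d b and B :: "nat \<Rightarrow> nat \<Rightarrow> ('n, 'k) mpoly"
    using that by (simp add: if_distrib[of "\<lambda>t. _ * t"] cong: if_cong)
  have "lifted_resolution I r dg A (\<lambda>_. 1)"
  proof unfold_locales
    fix b assume b: "b < r 1"
    have "(\<lambda>a. A 0 a b) \<in> Q0"
      unfolding P0(3) using b col[of b "r 1" "A 0"] I_0
      by (intro CollectI exI[of _ "\<lambda>c. if c = b then 1 else 0"]) auto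
    then show "(\<Sum>a<r 0. 1 * lookup (A 0 a b) 0) = 0" by (simp add: P0(1) Q0_def)
  next
    fix x :: "nat \<Rightarrow> ('n, 'k) mpoly" assume "(\<Sum>a<r 0. 1 * lookup (x a) 0) = 0"
    then have "x \<in> Q0" by (simp add: P0(1) Q0_def)
    then show "\<exists>y. \<forall>a<r 0. x a - (\<Sum>b<r 1. A 0 a b * y b) \<in> I"
      unfolding P0(3) by (simp add: P0(1))
  next
    fix a p c assume a: "a < r p" and c: "c < r (Suc (Suc p))"
    have "(\<lambda>b. A (Suc p) b c) \<in> {x. \<forall>a<r p. (\<Sum>b<r (Suc p). A p a b * x b) \<in> I}"
      unfolding Q using c col[of c "r (Suc (Suc p))" "A (Suc p)"] I_0
      by (intro CollectI exI[of _ "\<lambda>d. if d = c then 1 else 0"]) auto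
    then show "(\<Sum>b<r (Suc p). A p a b * A (Suc p) b c) \<in> I" using a by simp
  next
    fix p and x :: "nat \<Rightarrow> ('n, 'k) mpoly" assume "\<And>a. a < r p \<Longrightarrow> (\<Sum>b<r (Suc p). A p a b * x b) \<in> I"
    then have "x \<in> {x. \<forall>a<r p. (\<Sum>b<r (Suc p). A p a b * x b) \<in> I}" by simp
    then show "\<exists>y. \<forall>b<r (Suc p). x b - (\<Sum>c<r (Suc (Suc p)). A (Suc p) b c * y c) \<in> I"
      unfolding Q by simp
  qed (use P P0 in auto)
  then show ?thesis by blast
qed

end

section \<open>The quotient ring and its residue field\<close>

lemma poly_alg_simps [simp]:
  "carrier poly_alg = UNIV" "f \<otimes>\<^bsub>poly_alg\<^esub> g = f * g" "f \<oplus>\<^bsub>poly_alg\<^esub> g = f + g"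
  "\<zero>\<^bsub>poly_alg\<^esub> = 0" "\<one>\<^bsub>poly_alg\<^esub> = 1"
  by (simp_all add: ring_of_type_algebra_def)

interpretation poly_alg: cring "poly_alg :: ('n::finite, 'k::field) mpoly ring"
  by (rule cring_from_type_algebra)

lemma a_minus_poly_alg [simp]: "\<ominus>\<^bsub>poly_alg\<^esub> f = - f"
  by (rule poly_alg.minus_equality) auto

lemma minus_poly_alg [simp]: "f \<ominus>\<^bsub>poly_alg\<^esub> g = f - g"
  by (simp add: a_minus_def)

lemma ideal_poly_alg_iff:
  "ideal I poly_alg \<longleftrightarrow> 0 \<in> I \<and> (\<forall>f\<in>I. \<forall>g\<in>I. f + g \<in> I) \<and> (\<forall>f\<in>I. \<forall>h. h * f \<in> I)"
proof
  assume "ideal I poly_alg"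
  then interpret ideal I poly_alg .
  show "0 \<in> I \<and> (\<forall>f\<in>I. \<forall>g\<in>I. f + g \<in> I) \<and> (\<forall>f\<in>I. \<forall>h. h * f \<in> I)"
    using additive_subgroup.zero_closed[OF is_additive_subgroup] additive_subgroup.a_closed[OF is_additive_subgroup] I_l_closed by auto
next
  assume I: "0 \<in> I \<and> (\<forall>f\<in>I. \<forall>g\<in>I. f + g \<in> I) \<and> (\<forall>f\<in>I. \<forall>h. h * f \<in> I)"
  have "subgroup I (add_monoid poly_alg)"
  proof (rule poly_alg.add.subgroupI)
    show "\<ominus>\<^bsub>poly_alg\<^esub> f \<in> I" if "f \<in> I" for f
      unfolding a_minus_poly_alg using that I by (metis mult_minus1)
  qed (use I in auto)
  then show "ideal I poly_alg"
    using I by (intro idealI poly_alg.ring_axioms) (auto simp: mult.commute)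
qed

text \<open>A module whose elements are classes \<open>h f\<close> of polynomials, over a ring whose elements are
  classes \<open>\<rho> f\<close> of polynomials.\<close>

locale class_module =
  fixes M :: "('a, 'b) module" and \<rho> :: "('n::finite, 'k::field) mpoly \<Rightarrow> 'a"
    and h :: "('n, 'k) mpoly \<Rightarrow> 'b" and N :: "('n, 'k) mpoly set"
  assumes carrier: "carrier M = range h"
    and add: "h f \<oplus>\<^bsub>M\<^esub> h g = h (f + g)"
    and zero: "\<zero>\<^bsub>M\<^esub> = h 0"
    and eq_iff: "h f = h g \<longleftrightarrow> f - g \<in> N"
    and smult: "\<rho> f \<odot>\<^bsub>M\<^esub> h g = h (f * g)"
begin

lemma comm_group_add: "comm_group (add_monoid M)"
proof (rule comm_groupI)
  fix x assume "x \<in> carrier (add_monoid M)"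
  then obtain f where "x = h f" by (auto simp: carrier)
  then show "\<exists>y\<in>carrier (add_monoid M). y \<otimes>\<^bsub>add_monoid M\<^esub> x = \<one>\<^bsub>add_monoid M\<^esub>"
    by (intro bexI[of _ "h (- f)"]) (auto simp: carrier add zero)
qed (auto simp: carrier add zero ac_simps)

lemma finsum_h:
  assumes "finite A" "\<And>b. b \<in> A \<Longrightarrow> t b = h (f b)"
  shows "(\<Oplus>\<^bsub>M\<^esub>b\<in>A. t b) = h (sum f A)"
proof -
  interpret comm_group "add_monoid M" by (rule comm_group_add)
  have "(\<Otimes>\<^bsub>add_monoid M\<^esub>b\<in>A. t b) = h (sum f A)"
    using assms
  proof (induction A rule: finite_induct)
    case empty
    show ?case unfolding finprod_empty by (simp add: zero)
  next
    case (insert a A)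
    then have "(\<Otimes>\<^bsub>add_monoid M\<^esub>b\<in>insert a A. t b) = t a \<otimes>\<^bsub>add_monoid M\<^esub> (\<Otimes>\<^bsub>add_monoid M\<^esub>b\<in>A. t b)"
      by (intro finprod_insert) (auto simp: carrier)
    then show ?case using insert by (simp add: add)
  qed
  then show ?thesis by (simp add: finsum_def)
qed

definition tup :: "nat \<Rightarrow> (nat \<Rightarrow> ('n, 'k) mpoly) \<Rightarrow> nat \<Rightarrow> 'b"
  where "tup m x = (\<lambda>a\<in>{..<m}. h (x a))"

lemma tup_apply: "a < m \<Longrightarrow> tup m x a = h (x a)"
  by (simp add: tup_def)

lemma tup_eq_iff: "tup m x = tup m y \<longleftrightarrow> (\<forall>a<m. x a - y a \<in> N)"
  by (auto simp: tup_def fun_eq_iff restrict_def eq_iff)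

lemma carrier_copies: "carrier (copies M m) = range (tup m)"
proof (intro equalityI subsetI)
  fix x assume "x \<in> carrier (copies M m)"
  then have x: "x \<in> (\<Pi>\<^sub>E a\<in>{..<m}. range h)" by (simp add: copies_def carrier)
  then have "\<forall>a. \<exists>f. a < m \<longrightarrow> x a = h f" by (auto simp: PiE_def)
  then obtain f where "\<And>a. a < m \<Longrightarrow> x a = h (f a)" by metis
  then have "x = tup m f" using x by (intro ext) (auto simp: tup_def PiE_def extensional_def)
  then show "x \<in> range (tup m)" by blast
qed (auto simp: copies_def carrier tup_def PiE_def extensional_def)

lemma one_copies: "\<one>\<^bsub>copies M m\<^esub> = tup m (\<lambda>_. 0)"
  by (simp add: copies_def zero tup_def)

lemma mult_copies: "tup m x \<otimes>\<^bsub>copies M m\<^esub> tup m y = tup m (\<lambda>a. x a + y a)"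
  by (auto simp: copies_def tup_def add fun_eq_iff)

lemma group_copies: "group (copies M m)"
  unfolding copies_def by (intro product_group comm_group.axioms(2) comm_group_add)

lemma mat_map_tup:
  assumes "\<And>a b. a < m \<Longrightarrow> b < m' \<Longrightarrow> B a b = \<rho> (A a b)"
  shows "mat_map M m m' B (tup m' x) = tup m (\<lambda>a. \<Sum>b<m'. A a b * x b)"
  unfolding mat_map_def tup_def[of m]
proof (rule restrict_ext)
  fix a assume "a \<in> {..<m}"
  then show "(\<Oplus>\<^bsub>M\<^esub>b\<in>{..<m'}. B a b \<odot>\<^bsub>M\<^esub> tup m' x b) = h (\<Sum>b<m'. A a b * x b)"
    using assms by (intro finsum_h) (auto simp: tup_apply smult)
qed

end

context graded_ideal
begin

definition cls :: "('n, 'k) mpoly \<Rightarrow> ('n, 'k) mpoly set"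
  where "cls f = I +>\<^bsub>poly_alg\<^esub> f"

definition rcls :: "('n, 'k) mpoly \<Rightarrow> ('n, 'k) mpoly set set"
  where "rcls f = irrelevant_ideal (quot_alg I) (quot_forms I) +>\<^bsub>quot_alg I\<^esub> cls f"

lemma ideal_I: "ideal I poly_alg"
  using I_0 I_add I_mult by (simp add: ideal_poly_alg_iff)

lemma cring_quot: "cring (quot_alg I)"
  unfolding quot_alg_def by (rule ideal.quotient_is_cring[OF ideal_I poly_alg.is_cring])

lemma cls_hom: "cls \<in> ring_hom poly_alg (quot_alg I)"
  using ideal.rcos_ring_hom[OF ideal_I] unfolding cls_def quot_alg_def by simp

lemma cls_eq_iff: "cls f = cls g \<longleftrightarrow> f - g \<in> I"
  using poly_alg.quotient_eq_iff_same_a_r_cos[OF ideal_I, of f g] by (simp add: cls_def)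

lemma carrier_quot: "carrier (quot_alg I) = range cls"
  by (auto simp: quot_alg_def FactRing_def A_RCOSETS_def' cls_def)

lemma cls_mult: "cls f \<otimes>\<^bsub>quot_alg I\<^esub> cls g = cls (f * g)"
  and cls_add: "cls f \<oplus>\<^bsub>quot_alg I\<^esub> cls g = cls (f + g)"
  and cls_one: "\<one>\<^bsub>quot_alg I\<^esub> = cls 1"
  using cls_hom by (auto simp: ring_hom_def)

lemma cls_zero: "\<zero>\<^bsub>quot_alg I\<^esub> = cls 0"
  using ring_hom_zero[OF cls_hom poly_alg.ring_axioms] cring_quot by (simp add: cring.axioms(1))

lemma quot_forms_eq: "quot_forms I d = cls ` forms d"
  by (simp add: quot_forms_def cls_def)

lemma cls_uminus: "\<ominus>\<^bsub>quot_alg I\<^esub> cls f = cls (- f)"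
proof -
  interpret Q: cring "quot_alg I" by (rule cring_quot)
  show ?thesis by (rule Q.minus_equality) (auto simp: carrier_quot cls_add cls_zero)
qed

lemma ideal_cls_image:
  assumes "I \<subseteq> J" "ideal J poly_alg"
  shows "ideal (cls ` J) (quot_alg I)"
proof -
  interpret Q: cring "quot_alg I" by (rule cring_quot)
  have J: "0 \<in> J" "\<And>f g. f \<in> J \<Longrightarrow> g \<in> J \<Longrightarrow> f + g \<in> J" "\<And>f g. f \<in> J \<Longrightarrow> g * f \<in> J"
    using assms(2) by (auto simp: ideal_poly_alg_iff)
  have neg: "- f \<in> J" if "f \<in> J" for f using J(3)[OF that, of "-1"] by simp
  show ?thesis
  proof (rule idealI)
    show "subgroup (cls ` J) (add_monoid (quot_alg I))"
    proof (rule Q.add.subgroupI)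
      show "cls ` J \<noteq> {}" using J(1) by blast
      show "a \<in> cls ` J \<Longrightarrow> \<ominus>\<^bsub>quot_alg I\<^esub> a \<in> cls ` J" for a
        using cls_uminus neg by auto
    qed (auto simp: carrier_quot cls_add J(2))
    show "x \<otimes>\<^bsub>quot_alg I\<^esub> a \<in> cls ` J" if "a \<in> cls ` J" "x \<in> carrier (quot_alg I)" for a x
      using that J(3) by (auto simp: carrier_quot cls_mult)
    then show "a \<otimes>\<^bsub>quot_alg I\<^esub> x \<in> cls ` J" if "a \<in> cls ` J" "x \<in> carrier (quot_alg I)" for a x
      using that Q.m_comm[of a x] by (auto simp: carrier_quot)
  qed (rule Q.ring_axioms)
qed

text \<open>The positive components of a polynomial without constant term map to generators, and its
  component of degree \<open>0\<close> is zero.\<close>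

lemma irrelevant_eq: "irrelevant_ideal (quot_alg I) (quot_forms I) = cls ` {f. lookup f 0 = 0}"
proof
  interpret Q: cring "quot_alg I" by (rule cring_quot)
  let ?m = "{f :: ('n, 'k) mpoly. lookup f 0 = 0}"
  let ?G = "\<Union>d\<in>{1..}. quot_forms I d"
  have "ideal (cls ` ?m) (quot_alg I)"
    using I_max by (intro ideal_cls_image) (auto simp: ideal_poly_alg_iff lookup_add const_mult)
  then show "irrelevant_ideal (quot_alg I) (quot_forms I) \<subseteq> cls ` ?m"
    unfolding irrelevant_ideal_def
    by (rule Q.genideal_minimal) (auto simp: quot_forms_eq intro!: imageI const_forms)
  have G: "?G \<subseteq> carrier (quot_alg I)" by (auto simp: carrier_quot quot_forms_eq)
  then interpret J: ideal "Idl\<^bsub>quot_alg I\<^esub> ?G" "quot_alg I" by (rule Q.genideal_ideal)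
  show "cls ` ?m \<subseteq> irrelevant_ideal (quot_alg I) (quot_forms I)"
    unfolding irrelevant_ideal_def
  proof (intro image_subsetI)
    fix f :: "('n, 'k) mpoly" assume f: "f \<in> ?m"
    obtain K where K: "f = (\<Sum>d\<in>{..<K::nat}. hcomp (int d) f)" using hcomp_decomp by blast
    have "cls (\<Sum>d\<in>T. hcomp (int d) f) \<in> Idl\<^bsub>quot_alg I\<^esub> ?G" if "finite T" for T
      using that
    proof (induction T rule: finite_induct)
      case empty
      then show ?case using J.zero_closed by (simp add: cls_zero)
    next
      case (insert d T)
      have "cls (hcomp (int d) f) \<in> Idl\<^bsub>quot_alg I\<^esub> ?G"
      proof (cases "d = 0")
        case True
        then have "hcomp (int d) f = 0"
          using forms_0_eq_pconst[OF hcomp_forms[of 0 f]] f const_hcomp[of 0 f] by simp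
        then show ?thesis using J.zero_closed by (simp add: cls_zero)
      next
        case False
        then have "cls (hcomp (int d) f) \<in> ?G" by (auto simp: quot_forms_eq intro!: bexI[of _ "int d"])
        then show ?thesis using Q.genideal_self[OF G] by blast
      qed
      then show ?case using insert J.a_closed by (simp add: cls_add[symmetric])
    qed
    from this[of "{..<K}"] show "cls f \<in> Idl\<^bsub>quot_alg I\<^esub> ?G" using K by simp
  qed
qed

lemma ideal_irrelevant: "ideal (irrelevant_ideal (quot_alg I) (quot_forms I)) (quot_alg I)"
  unfolding irrelevant_eq
  using I_max by (intro ideal_cls_image) (auto simp: ideal_poly_alg_iff lookup_add const_mult)

lemma rcls_eq_iff: "rcls f = rcls g \<longleftrightarrow> f - g \<in> {f. lookup f 0 = 0}"
proof -
  interpret Q: cring "quot_alg I" by (rule cring_quot)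
  have "rcls f = rcls g \<longleftrightarrow> cls f \<ominus>\<^bsub>quot_alg I\<^esub> cls g \<in> irrelevant_ideal (quot_alg I) (quot_forms I)"
    unfolding rcls_def using Q.quotient_eq_iff_same_a_r_cos[OF ideal_irrelevant, of "cls f" "cls g"]
    by (simp add: carrier_quot)
  also have "cls f \<ominus>\<^bsub>quot_alg I\<^esub> cls g = cls (f - g)"
    by (simp add: a_minus_def cls_uminus cls_add)
  also have "cls (f - g) \<in> irrelevant_ideal (quot_alg I) (quot_forms I) \<longleftrightarrow> lookup (f - g) 0 = 0"
  proof
    assume "cls (f - g) \<in> irrelevant_ideal (quot_alg I) (quot_forms I)"
    then obtain e where "cls (f - g) = cls e" "lookup e 0 = 0"
      unfolding irrelevant_eq by blast
    then show "lookup (f - g) 0 = 0"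
      using I_max[of "f - g - e"] by (simp add: cls_eq_iff lookup_minus)
  qed (simp add: irrelevant_eq)
  finally show ?thesis by simp
qed

abbreviation resf :: "(('n, 'k) mpoly set, ('n, 'k) mpoly set set) module"
  where "resf \<equiv> residue_field (quot_alg I) (quot_forms I)"

sublocale ring_module: class_module "self_module (quot_alg I)" cls cls I
  by unfold_locales (auto simp: self_module_def carrier_quot cls_add cls_zero cls_eq_iff cls_mult)

lemma rcls_props:
  shows "carrier resf = range rcls"
    and "rcls f \<oplus>\<^bsub>resf\<^esub> rcls g = rcls (f + g)"
    and "\<zero>\<^bsub>resf\<^esub> = rcls 0"
    and "cls f \<odot>\<^bsub>resf\<^esub> rcls g = rcls (f * g)"
proof -
  let ?m = "irrelevant_ideal (quot_alg I) (quot_forms I)"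
  interpret m: ideal ?m "quot_alg I" by (rule ideal_irrelevant)
  have hom: "(+>\<^bsub>quot_alg I\<^esub>) ?m \<in> ring_hom (quot_alg I) (quot_alg I Quot ?m)"
    by (rule m.rcos_ring_hom)
  show "carrier resf = range rcls"
    by (auto simp: residue_field_def Let_def FactRing_def A_RCOSETS_def' carrier_quot rcls_def)
  show "rcls f \<oplus>\<^bsub>resf\<^esub> rcls g = rcls (f + g)"
    using ring_hom_add[OF hom, of "cls f" "cls g"]
    by (simp add: residue_field_def Let_def rcls_def carrier_quot cls_add)
  show "\<zero>\<^bsub>resf\<^esub> = rcls 0"
    using ring_hom_zero[OF hom] m.quotient_is_ring cring_quot
    by (simp add: residue_field_def Let_def rcls_def cls_zero cring.axioms(1))
  show "cls f \<odot>\<^bsub>resf\<^esub> rcls g = rcls (f * g)"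
    using ring_hom_mult[OF hom, of "cls f" "cls g"]
    by (simp add: residue_field_def Let_def rcls_def carrier_quot cls_mult)
qed

sublocale field_module: class_module resf cls rcls "{f. lookup f 0 = 0}"
  by unfold_locales (auto simp: rcls_props rcls_eq_iff)

lemma augmentation_tup:
  assumes "\<And>a. a < rank F 0 \<Longrightarrow> aug F a = rcls (pconst (\<alpha> a))"
  shows "augmentation (quot_alg I) (quot_forms I) F (ring_module.tup (rank F 0) x)
    = rcls (\<Sum>a<rank F 0. x a * pconst (\<alpha> a))"
  unfolding augmentation_def
  using assms by (intro field_module.finsum_h) (auto simp: ring_module.tup_apply field_module.smult)

lemma rcls_aug_zero: "rcls (\<Sum>a<r. x a * pconst (\<alpha> a)) = \<zero>\<^bsub>resf\<^esub> \<longleftrightarrow>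
    (\<Sum>a<r. \<alpha> a * lookup (x a) 0) = 0"
  by (simp add: rcls_props(3) rcls_eq_iff lookup_sum const_mult pconst_def mult.commute)

lemma differential_tup:
  assumes "\<And>a b. a < rank F i \<Longrightarrow> b < rank F (Suc i) \<Longrightarrow> dmat F (Suc i) a b = cls (A a b)"
  shows "differential (self_module (quot_alg I)) F i (ring_module.tup (rank F (Suc i)) x)
      = ring_module.tup (rank F i) (\<lambda>a. \<Sum>b<rank F (Suc i). A a b * x b)"
    and "differential resf F i (field_module.tup (rank F (Suc i)) x)
      = field_module.tup (rank F i) (\<lambda>a. \<Sum>b<rank F (Suc i). A a b * x b)"
  unfolding differential_def
  using assms by (auto intro!: ring_module.mat_map_tup field_module.mat_map_tup)

lemma differential_image:
  assumes "\<And>a b. a < rank F i \<Longrightarrow> b < rank F (Suc i) \<Longrightarrow> dmat F (Suc i) a b = cls (A a b)"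
  shows "ring_module.tup (rank F i) x \<in> differential (self_module (quot_alg I)) F i
      ` carrier (copies (self_module (quot_alg I)) (rank F (Suc i))) \<longleftrightarrow>
    (\<exists>y. \<forall>a<rank F i. x a - (\<Sum>b<rank F (Suc i). A a b * y b) \<in> I)"
proof -
  have "differential (self_module (quot_alg I)) F i ` carrier (copies (self_module (quot_alg I)) (rank F (Suc i)))
    = range (\<lambda>y. ring_module.tup (rank F i) (\<lambda>a. \<Sum>b<rank F (Suc i). A a b * y b))"
    unfolding ring_module.carrier_copies using differential_tup(1)[where F = F and A = A, OF assms]
    by (simp add: image_image)
  then show ?thesis by (auto simp: ring_module.tup_eq_iff image_iff)
qed

section \<open>Translation between resolutions over \<open>S / I\<close> and polynomial
  matrices\<close>

definition matches where
  "matches F A \<alpha> \<longleftrightarrow>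
    (\<forall>i a b. a < rank F i \<longrightarrow> b < rank F (Suc i) \<longrightarrow> dmat F (Suc i) a b = cls (A i a b)) \<and>
    (\<forall>a<rank F 0. aug F a = rcls (pconst (\<alpha> a)))"

lemma exactness_lift:
  assumes "matches F A \<alpha>"
  shows "{x \<in> carrier (copies (self_module (quot_alg I)) (rank F 0)).
        augmentation (quot_alg I) (quot_forms I) F x = \<zero>\<^bsub>resf\<^esub>}
      = differential (self_module (quot_alg I)) F 0 ` carrier (copies (self_module (quot_alg I)) (rank F 1)) \<longleftrightarrow>
    (\<forall>x. (\<Sum>a<rank F 0. \<alpha> a * lookup (x a) 0) = 0 \<longleftrightarrow>
      (\<exists>y. \<forall>a<rank F 0. x a - (\<Sum>b<rank F 1. A 0 a b * y b) \<in> I))"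
    (is "?A = ?B \<longleftrightarrow> _")
    and "{x \<in> carrier (copies (self_module (quot_alg I)) (rank F (Suc i))).
            differential (self_module (quot_alg I)) F i x = \<one>\<^bsub>copies (self_module (quot_alg I)) (rank F i)\<^esub>}
         = differential (self_module (quot_alg I)) F (Suc i)
             ` carrier (copies (self_module (quot_alg I)) (rank F (Suc (Suc i)))) \<longleftrightarrow>
    (\<forall>x. (\<forall>a<rank F i. (\<Sum>b<rank F (Suc i). A i a b * x b) \<in> I) \<longleftrightarrow>
      (\<exists>y. \<forall>b<rank F (Suc i). x b - (\<Sum>c<rank F (Suc (Suc i)). A (Suc i) b c * y c) \<in> I))"
    (is "?C = ?D \<longleftrightarrow> _")
proof -
  have d: "\<And>i a b. a < rank F i \<Longrightarrow> b < rank F (Suc i) \<Longrightarrow> dmat F (Suc i) a b = cls (A i a b)"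
    and \<alpha>: "\<And>a. a < rank F 0 \<Longrightarrow> aug F a = rcls (pconst (\<alpha> a))"
    using assms by (auto simp: matches_def)
  have sub: "differential (self_module (quot_alg I)) F i ` carrier (copies (self_module (quot_alg I)) (rank F (Suc i)))
      \<subseteq> range (ring_module.tup (rank F i))" for i
    unfolding ring_module.carrier_copies using differential_tup(1)[where F = F and A = "A i", OF d] by auto
  have eq: "S = T \<longleftrightarrow> (\<forall>x. ring_module.tup m x \<in> S \<longleftrightarrow> ring_module.tup m x \<in> T)"
    if "S \<subseteq> range (ring_module.tup m)" "T \<subseteq> range (ring_module.tup m)" for S T m
    using that by blast
  have "ring_module.tup (rank F 0) x \<in> ?A \<longleftrightarrow> (\<Sum>a<rank F 0. \<alpha> a * lookup (x a) 0) = 0" for x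
    by (simp add: ring_module.carrier_copies augmentation_tup[where F = F, OF \<alpha>] rcls_aug_zero)
  moreover have "ring_module.tup (rank F 0) x \<in> ?B \<longleftrightarrow>
      (\<exists>y. \<forall>a<rank F 0. x a - (\<Sum>b<rank F 1. A 0 a b * y b) \<in> I)" for x
    using differential_image[where F = F and i = 0 and A = "A 0", OF d] by simp
  moreover have "?A \<subseteq> range (ring_module.tup (rank F 0))" "?B \<subseteq> range (ring_module.tup (rank F 0))"
    using sub[of 0] by (auto simp: ring_module.carrier_copies)
  ultimately show "?A = ?B \<longleftrightarrow> (\<forall>x. (\<Sum>a<rank F 0. \<alpha> a * lookup (x a) 0) = 0 \<longleftrightarrow>
      (\<exists>y. \<forall>a<rank F 0. x a - (\<Sum>b<rank F 1. A 0 a b * y b) \<in> I))"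
    using eq[of ?A "rank F 0" ?B] by simp
  have "ring_module.tup (rank F (Suc i)) x \<in> ?C \<longleftrightarrow> (\<forall>a<rank F i. (\<Sum>b<rank F (Suc i). A i a b * x b) \<in> I)" for x
    by (auto simp: ring_module.carrier_copies differential_tup(1)[where F = F and A = "A i", OF d]
        ring_module.one_copies ring_module.tup_eq_iff)
  moreover have "ring_module.tup (rank F (Suc i)) x \<in> ?D \<longleftrightarrow>
      (\<exists>y. \<forall>b<rank F (Suc i). x b - (\<Sum>c<rank F (Suc (Suc i)). A (Suc i) b c * y c) \<in> I)" for x
    using differential_image[where F = F and i = "Suc i" and A = "A (Suc i)", OF d] by simp
  moreover have "?C \<subseteq> range (ring_module.tup (rank F (Suc i)))" "?D \<subseteq> range (ring_module.tup (rank F (Suc i)))"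
    using sub[of "Suc i"] by (auto simp: ring_module.carrier_copies)
  ultimately show "?C = ?D \<longleftrightarrow> (\<forall>x. (\<forall>a<rank F i. (\<Sum>b<rank F (Suc i). A i a b * x b) \<in> I) \<longleftrightarrow>
      (\<exists>y. \<forall>b<rank F (Suc i). x b - (\<Sum>c<rank F (Suc (Suc i)). A (Suc i) b c * y c) \<in> I))"
    using eq[of ?C "rank F (Suc i)" ?D] by simp
qed

lemma resolution_lift:
  assumes F: "graded_free_resolution (quot_alg I) (quot_forms I) F"
  shows "\<exists>A \<alpha>. lifted_resolution I (rank F) (bdeg F) A \<alpha> \<and> matches F A \<alpha>"
proof -
  have H: "homogeneous_data (quot_alg I) (quot_forms I) F"
    using F by (simp add: graded_free_resolution_def)
  define A where "A i a b = (SOME f. f \<in> forms (bdeg F (Suc i) b - bdeg F i a) \<and> dmat F (Suc i) a b = cls f)" for i a b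
  have "A i a b \<in> forms (bdeg F (Suc i) b - bdeg F i a) \<and> dmat F (Suc i) a b = cls (A i a b)"
    if "a < rank F i" "b < rank F (Suc i)" for i a b
  proof -
    have "dmat F (Suc i) a b \<in> cls ` forms (bdeg F (Suc i) b - bdeg F i a)"
      using H that by (simp add: homogeneous_data_def quot_forms_eq)
    then have "\<exists>f. f \<in> forms (bdeg F (Suc i) b - bdeg F i a) \<and> dmat F (Suc i) a b = cls f" by blast
    then show ?thesis unfolding A_def by (rule someI_ex)
  qed
  then have A: "\<And>i a b. a < rank F i \<Longrightarrow> b < rank F (Suc i) \<Longrightarrow> A i a b \<in> forms (bdeg F (Suc i) b - bdeg F i a)"
    "\<And>i a b. a < rank F i \<Longrightarrow> b < rank F (Suc i) \<Longrightarrow> dmat F (Suc i) a b = cls (A i a b)"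
    by blast+
  have "\<exists>c. a < rank F 0 \<longrightarrow> (bdeg F 0 a \<noteq> 0 \<longrightarrow> c = 0) \<and> aug F a = rcls (pconst c)" for a
  proof (cases "a < rank F 0")
    case a: True
    then have "aug F a \<in> range rcls" "bdeg F 0 a \<noteq> 0 \<longrightarrow> aug F a = rcls 0"
      using H by (simp_all add: homogeneous_data_def rcls_props)
    then obtain f where f: "aug F a = rcls f" "bdeg F 0 a \<noteq> 0 \<longrightarrow> rcls f = rcls 0" by auto
    have "rcls f = rcls (pconst (lookup f 0))" by (simp add: rcls_eq_iff lookup_minus pconst_def)
    then show ?thesis using f by (auto intro: exI[of _ "lookup f 0"] simp: rcls_eq_iff)
  qed auto
  then obtain \<alpha> where \<alpha>: "\<And>a. a < rank F 0 \<Longrightarrow> bdeg F 0 a \<noteq> 0 \<Longrightarrow> \<alpha> a = 0"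
    "\<And>a. a < rank F 0 \<Longrightarrow> aug F a = rcls (pconst (\<alpha> a))"
    by metis
  have m: "matches F A \<alpha>" using A \<alpha> by (simp add: matches_def)
  have e0: "(\<Sum>a<rank F 0. \<alpha> a * lookup (x a) 0) = 0 \<longleftrightarrow>
      (\<exists>y. \<forall>a<rank F 0. x a - (\<Sum>b<rank F 1. A 0 a b * y b) \<in> I)" for x
    using F exactness_lift(1)[OF m] unfolding graded_free_resolution_def by blast
  have eS: "(\<forall>a<rank F i. (\<Sum>b<rank F (Suc i). A i a b * x b) \<in> I) \<longleftrightarrow>
      (\<exists>y. \<forall>b<rank F (Suc i). x b - (\<Sum>c<rank F (Suc (Suc i)). A (Suc i) b c * y c) \<in> I)" for x i
    using F exactness_lift(2)[OF m, of i] unfolding graded_free_resolution_def by blast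
  have col: "(\<Sum>c<m. B b c * (if c = d then 1 else 0)) = B b d" if "d < m" for m d b and B :: "nat \<Rightarrow> nat \<Rightarrow> ('n, 'k) mpoly"
    using that by (simp add: if_distrib[of "\<lambda>t. _ * t"] cong: if_cong)
  have "lifted_resolution I (rank F) (bdeg F) A \<alpha>"
  proof unfold_locales
    \<comment> \<open>Otherwise the augmentation would be zero, although \<open>1\<close> has a
      nonzero class in \<open>k\<close>.\<close>
    show "\<exists>a<rank F 0. \<alpha> a \<noteq> 0"
    proof (rule ccontr)
      assume "\<not> (\<exists>a<rank F 0. \<alpha> a \<noteq> 0)"
      then have 0: "augmentation (quot_alg I) (quot_forms I) F (ring_module.tup (rank F 0) x) = rcls 0" for x
        using augmentation_tup[where F = F, OF \<alpha>(2)] by simp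
      have "augmentation (quot_alg I) (quot_forms I) F ` range (ring_module.tup (rank F 0)) = range rcls"
        using F unfolding graded_free_resolution_def ring_module.carrier_copies rcls_props(1) by (elim conjE)
      then obtain x where "rcls 1 = augmentation (quot_alg I) (quot_forms I) F (ring_module.tup (rank F 0) x)"
        by (metis (no_types, lifting) image_iff rangeI)
      then show False by (simp add: 0 rcls_eq_iff)
    qed
  next
    fix b assume "b < rank F 1"
    then show "(\<Sum>a<rank F 0. \<alpha> a * lookup (A 0 a b) 0) = 0"
      unfolding e0 using col[of b "rank F 1" "A 0"] I_0
      by (intro exI[of _ "\<lambda>c. if c = b then 1 else 0"]) auto
  next
    fix a p c assume a: "a < rank F p" and c: "c < rank F (Suc (Suc p))"
    have "\<exists>y. \<forall>b<rank F (Suc p). A (Suc p) b c - (\<Sum>d<rank F (Suc (Suc p)). A (Suc p) b d * y d) \<in> I"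
      using col[of c "rank F (Suc (Suc p))" "A (Suc p)"] c I_0
      by (intro exI[of _ "\<lambda>d. if d = c then 1 else 0"]) auto
    then show "(\<Sum>b<rank F (Suc p). A p a b * A (Suc p) b c) \<in> I"
      using a unfolding eS[symmetric] by blast
  next
    fix p and x :: "nat \<Rightarrow> ('n, 'k) mpoly" assume "\<And>a. a < rank F p \<Longrightarrow> (\<Sum>b<rank F (Suc p). A p a b * x b) \<in> I"
    then show "\<exists>y. \<forall>b<rank F (Suc p). x b - (\<Sum>c<rank F (Suc (Suc p)). A (Suc p) b c * y c) \<in> I"
      unfolding eS[symmetric] by blast
  qed (use A \<alpha> e0 in auto)
  then show ?thesis using m by blast
qed

lemma lift_resolution:
  assumes "lifted_resolution I r dg A \<alpha>"
  shows "\<exists>F. graded_free_resolution (quot_alg I) (quot_forms I) F"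
proof -
  interpret lifted_resolution I r dg A \<alpha> by fact
  \<comment> \<open>\<open>A\<close> is indexed by the target of a map and \<open>dmat\<close> by
    its source, hence the shift by one.\<close>
  define F where "F = \<lparr>rank = r, bdeg = dg, dmat = (\<lambda>i a b. cls (A (i - 1) a b)), aug = (\<lambda>a. rcls (pconst (\<alpha> a)))\<rparr>"
  have m: "matches F A \<alpha>" by (simp add: matches_def F_def)
  have F: "rank F = r" "bdeg F = dg" by (simp_all add: F_def)
  have hom: "homogeneous_data (quot_alg I) (quot_forms I) F"
    using A_hom aug_deg by (auto simp: homogeneous_data_def F_def quot_forms_eq rcls_props)
  have surj: "augmentation (quot_alg I) (quot_forms I) F ` carrier (copies (self_module (quot_alg I)) (rank F 0)) = carrier resf"
  proof -
    have aug: "augmentation (quot_alg I) (quot_forms I) F (ring_module.tup (rank F 0) x)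
      = rcls (\<Sum>a<rank F 0. x a * pconst (\<alpha> a))" for x
      using m by (intro augmentation_tup) (simp add: matches_def)
    obtain a where a: "a < r 0" "\<alpha> a \<noteq> 0" using aug_surj by blast
    have "rcls f \<in> range (\<lambda>x. augmentation (quot_alg I) (quot_forms I) F (ring_module.tup (rank F 0) x))" for f
    proof
      have "(\<Sum>b<rank F 0. (if b = a then f * pconst (inverse (\<alpha> a)) else 0) * pconst (\<alpha> b)) = f"
        using a by (simp add: F if_distrib[of "\<lambda>t. t * _"] mult.assoc pconst_mult[symmetric] cong: if_cong)
      then show "rcls f = augmentation (quot_alg I) (quot_forms I) F (ring_module.tup (rank F 0) (\<lambda>b. if b = a then f * pconst (inverse (\<alpha> a)) else 0))"
        by (simp add: aug)
    qed simp
    moreover have "augmentation (quot_alg I) (quot_forms I) F (ring_module.tup (rank F 0) x) \<in> range rcls" for x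
      by (simp add: aug)
    ultimately show ?thesis
      unfolding ring_module.carrier_copies rcls_props(1) image_image by blast
  qed
  have I_eq: "x \<in> I \<longleftrightarrow> y \<in> I" if "x - y \<in> I" for x y
    using I_add[OF that, of y] I_diff[of x "x - y"] that by auto
  have e0: "(\<Sum>a<r 0. \<alpha> a * lookup (x a) 0) = 0 \<longleftrightarrow>
      (\<exists>y. \<forall>a<r 0. x a - (\<Sum>b<r 1. A 0 a b * y b) \<in> I)" for x
  proof
    assume "\<exists>y. \<forall>a<r 0. x a - (\<Sum>b<r 1. A 0 a b * y b) \<in> I"
    then obtain y where y: "\<And>a. a < r 0 \<Longrightarrow> x a - (\<Sum>b<r 1. A 0 a b * y b) \<in> I" by blast
    have "lookup (x a) 0 = (\<Sum>b<r 1. lookup (A 0 a b) 0 * lookup (y b) 0)"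
      if "a < r 0" for a
      using I_max[OF y[OF that]] by (simp add: lookup_minus lookup_sum const_mult)
    then have "(\<Sum>a<r 0. \<alpha> a * lookup (x a) 0)
        = (\<Sum>a<r 0. \<Sum>b<r 1. \<alpha> a * lookup (A 0 a b) 0 * lookup (y b) 0)"
      by (simp add: sum_distrib_left mult.assoc)
    also have "\<dots> = (\<Sum>b<r 1. (\<Sum>a<r 0. \<alpha> a * lookup (A 0 a b) 0) * lookup (y b) 0)"
      by (subst sum.swap) (simp add: sum_distrib_right)
    also have "\<dots> = 0" using complex_0 by simp
    finally show "(\<Sum>a<r 0. \<alpha> a * lookup (x a) 0) = 0" .
  qed (rule exact_0)
  have eS: "(\<forall>a<r i. (\<Sum>b<r (Suc i). A i a b * x b) \<in> I) \<longleftrightarrow>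
      (\<exists>y. \<forall>b<r (Suc i). x b - (\<Sum>c<r (Suc (Suc i)). A (Suc i) b c * y c) \<in> I)" for x i
  proof
    assume "\<exists>y. \<forall>b<r (Suc i). x b - (\<Sum>c<r (Suc (Suc i)). A (Suc i) b c * y c) \<in> I"
    then obtain y where y: "\<And>b. b < r (Suc i) \<Longrightarrow> x b - (\<Sum>c<r (Suc (Suc i)). A (Suc i) b c * y c) \<in> I" by blast
    show "\<forall>a<r i. (\<Sum>b<r (Suc i). A i a b * x b) \<in> I"
    proof (intro allI impI)
      fix a assume a: "a < r i"
      have "(\<Sum>b<r (Suc i). A i a b * (x b - (\<Sum>c<r (Suc (Suc i)). A (Suc i) b c * y c))) \<in> I"
        using y by (intro I_sum I_mult) auto
      moreover have "(\<Sum>b<r (Suc i). A i a b * (\<Sum>c<r (Suc (Suc i)). A (Suc i) b c * y c))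
          = (\<Sum>c<r (Suc (Suc i)). (\<Sum>b<r (Suc i). A i a b * A (Suc i) b c) * y c)"
        unfolding sum_distrib_left sum_distrib_right by (subst sum.swap) (simp add: mult.assoc)
      moreover have "\<dots> \<in> I" by (rule I_sum, rule I_mult', rule complex_Suc[OF a]) simp
      ultimately show "(\<Sum>b<r (Suc i). A i a b * x b) \<in> I"
        using I_eq by (simp add: right_diff_distrib sum_subtractf)
    qed
  qed (use exact_Suc in blast)
  have "graded_free_resolution (quot_alg I) (quot_forms I) F"
    unfolding graded_free_resolution_def
  proof (intro conjI allI)
    show "{x \<in> carrier (copies (self_module (quot_alg I)) (rank F 0)).
        augmentation (quot_alg I) (quot_forms I) F x = \<zero>\<^bsub>resf\<^esub>}
      = differential (self_module (quot_alg I)) F 0 ` carrier (copies (self_module (quot_alg I)) (rank F 1))"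
      using e0 by (intro exactness_lift(1)[OF m, THEN iffD2]) (simp add: F)
    show "{x \<in> carrier (copies (self_module (quot_alg I)) (rank F (Suc i))).
            differential (self_module (quot_alg I)) F i x = \<one>\<^bsub>copies (self_module (quot_alg I)) (rank F i)\<^esub>}
         = differential (self_module (quot_alg I)) F (Suc i)
             ` carrier (copies (self_module (quot_alg I)) (rank F (Suc (Suc i))))" for i
      using eS[of i] by (intro exactness_lift(2)[OF m, THEN iffD2]) (simp add: F)
  qed (use hom surj in auto)
  then show ?thesis by blast
qed

end

lemma trivial_FactGroup_iff:
  assumes G: "group G" and B: "subgroup B G" and C: "C \<subseteq> carrier G" "\<one>\<^bsub>G\<^esub> \<in> C"
  shows "trivial_group (G\<lparr>carrier := C\<rparr> Mod B) \<longleftrightarrow> C \<subseteq> B"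
proof -
  interpret group G by fact
  have rc: "B #>\<^bsub>G\<lparr>carrier := C\<rparr>\<^esub> x = B #>\<^bsub>G\<^esub> x" for x by (simp add: r_coset_def)
  have carr: "carrier (G\<lparr>carrier := C\<rparr> Mod B) = (\<lambda>x. B #>\<^bsub>G\<^esub> x) ` C"
    by (auto simp: FactGroup_def RCOSETS_def rc)
  have join: "B #>\<^bsub>G\<^esub> x = B \<longleftrightarrow> x \<in> B" if "x \<in> carrier G" for x
    using coset_join1[OF _ that B] coset_join2[OF that B] subgroup.subset[OF B] by auto
  show ?thesis
  proof
    assume "trivial_group (G\<lparr>carrier := C\<rparr> Mod B)"
    then have "(\<lambda>x. B #>\<^bsub>G\<^esub> x) ` C = {B}"
      unfolding trivial_group_def carr by (simp add: FactGroup_def)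
    then have "B #>\<^bsub>G\<^esub> x = B" if "x \<in> C" for x using that by blast
    then show "C \<subseteq> B" using join C(1) by (meson subset_iff)
  next
    assume CB: "C \<subseteq> B"
    have "B #>\<^bsub>G\<^esub> x = B" if "x \<in> C" for x using join CB C(1) that by (meson subset_iff)
    then have "(\<lambda>x. B #>\<^bsub>G\<^esub> x) ` C = {B}" using C(2) by (metis image_constant image_cong)
    moreover have "B <#>\<^bsub>G\<lparr>carrier := C\<rparr>\<^esub> B = B"
      using subgroup_mult_id[OF B] by (simp add: set_mult_def)
    ultimately have "carrier (G\<lparr>carrier := C\<rparr> Mod B) = {B}" "\<one>\<^bsub>G\<lparr>carrier := C\<rparr> Mod B\<^esub> = B"
      "B \<otimes>\<^bsub>G\<lparr>carrier := C\<rparr> Mod B\<^esub> B = B"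
      unfolding carr by (simp_all add: FactGroup_def)
    then show "trivial_group (G\<lparr>carrier := C\<rparr> Mod B)"
      unfolding trivial_group_def by (intro conjI groupI) auto
  qed
qed

section \<open>Vanishing of \<open>Tor\<close> in terms of polynomial representatives\<close>

context graded_ideal
begin

abbreviation "ktup \<equiv> field_module.tup"

text \<open>\<open>k\<close> sits in degree \<open>0\<close>, where forms of nonzero degree have
  class zero; so tuples concentrated in degree \<open>j\<close> are represented by forms of the
  complementary degrees.\<close>

lemma tensor_component_eq:
  "tensor_component (quot_alg I) (quot_forms I) F i j
    = {ktup (rank F i) x | x. \<forall>a<rank F i. x a \<in> forms (j - bdeg F i a)}"
proof (intro equalityI subsetI)
  fix t assume t: "t \<in> tensor_component (quot_alg I) (quot_forms I) F i j"
  then obtain x where x: "t = ktup (rank F i) x"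
    by (auto simp: tensor_component_def field_module.carrier_copies)
  define y :: "nat \<Rightarrow> ('n, 'k) mpoly" where "y a = (if bdeg F i a = j then pconst (lookup (x a) 0) else 0)" for a
  have "rcls (x a) = rcls (y a)" if "a < rank F i" for a
  proof (cases "bdeg F i a = j")
    case True
    then show ?thesis by (simp add: rcls_eq_iff y_def lookup_minus pconst_def)
  next
    case False
    then have "t a = rcls 0" using t that by (simp add: tensor_component_def rcls_props(3))
    then show ?thesis using that False by (simp add: x field_module.tup_apply y_def)
  qed
  then have "t = ktup (rank F i) y" unfolding x by (simp add: field_module.tup_eq_iff rcls_eq_iff)
  moreover have "\<forall>a<rank F i. y a \<in> forms (j - bdeg F i a)" by (simp add: y_def forms_pconst)
  ultimately show "t \<in> {ktup (rank F i) x | x. \<forall>a<rank F i. x a \<in> forms (j - bdeg F i a)}" by blast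
next
  fix t assume "t \<in> {ktup (rank F i) x | x. \<forall>a<rank F i. x a \<in> forms (j - bdeg F i a)}"
  then obtain x where x: "t = ktup (rank F i) x" "\<And>a. a < rank F i \<Longrightarrow> x a \<in> forms (j - bdeg F i a)" by blast
  have "rcls (x a) = rcls 0" if "a < rank F i" "bdeg F i a \<noteq> j" for a
    using const_forms[OF x(2)[OF that(1)]] that by (simp add: rcls_eq_iff)
  then show "t \<in> tensor_component (quot_alg I) (quot_forms I) F i j"
    by (auto simp: tensor_component_def field_module.carrier_copies x(1) field_module.tup_apply rcls_props(3))
qed

lemma Tor_trivial_iff:
  fixes A :: "nat \<Rightarrow> nat \<Rightarrow> nat \<Rightarrow> ('n, 'k) mpoly"
  assumes A: "\<And>i a b. a < rank F i \<Longrightarrow> b < rank F (Suc i) \<Longrightarrow> dmat F (Suc i) a b = cls (A i a b)"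
  shows "trivial_group (copies resf (rank F i) \<lparr>carrier := tensor_cycles (quot_alg I) (quot_forms I) F i j\<rparr>
       Mod tensor_boundaries (quot_alg I) (quot_forms I) F i j) \<longleftrightarrow>
    (\<forall>x. (\<forall>a<rank F i. x a \<in> forms (j - bdeg F i a)) \<and>
      (\<forall>q. i = Suc q \<longrightarrow> (\<forall>a<rank F q. lookup (\<Sum>b<rank F i. A q a b * x b) 0 = 0)) \<longrightarrow>
      (\<exists>y. (\<forall>c<rank F (Suc i). y c \<in> forms (j - bdeg F (Suc i) c)) \<and>
        (\<forall>b<rank F i. lookup (x b - (\<Sum>c<rank F (Suc i). A i b c * y c)) 0 = 0)))"
proof -
  let ?C = "tensor_cycles (quot_alg I) (quot_forms I) F i j"
  let ?B = "tensor_boundaries (quot_alg I) (quot_forms I) F i j"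
  note d = differential_tup(2)[where F = F and A = "A _", OF A]
  have B: "?B = {ktup (rank F i) (\<lambda>a. \<Sum>b<rank F (Suc i). A i a b * y b) | y.
      \<forall>a<rank F (Suc i). y a \<in> forms (j - bdeg F (Suc i) a)}"
  proof -
    have "?B = differential resf F i ` (ktup (rank F (Suc i)) ` {y. \<forall>a<rank F (Suc i). y a \<in> forms (j - bdeg F (Suc i) a)})"
      unfolding tensor_boundaries_def tensor_component_eq by (simp add: setcompr_eq_image)
    also have "\<dots> = (\<lambda>y. ktup (rank F i) (\<lambda>a. \<Sum>b<rank F (Suc i). A i a b * y b)) ` {y. \<forall>a<rank F (Suc i). y a \<in> forms (j - bdeg F (Suc i) a)}"
      unfolding image_image by (simp add: d)
    finally show ?thesis by (simp add: setcompr_eq_image)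
  qed
  have one: "\<one>\<^bsub>copies resf m\<^esub> = ktup m (\<lambda>_. 0)" for m by (rule field_module.one_copies)
  interpret G: group "copies resf (rank F i)" by (rule field_module.group_copies)
  have inv: "inv\<^bsub>copies resf (rank F i)\<^esub> ktup (rank F i) x = ktup (rank F i) (\<lambda>a. - x a)" for x
    by (rule G.inv_equality) (auto simp: field_module.mult_copies one field_module.carrier_copies)
  have sub: "subgroup ?B (copies resf (rank F i))"
  proof (rule G.subgroupI)
    show "?B \<subseteq> carrier (copies resf (rank F i))" by (auto simp: B field_module.carrier_copies)
    show "?B \<noteq> {}" unfolding B by (auto intro: exI[of _ "\<lambda>_. 0"])
  next
    fix t assume "t \<in> ?B"
    then obtain y where "t = ktup (rank F i) (\<lambda>a. \<Sum>b<rank F (Suc i). A i a b * y b)"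
      "\<forall>a<rank F (Suc i). y a \<in> forms (j - bdeg F (Suc i) a)" unfolding B by blast
    then show "inv\<^bsub>copies resf (rank F i)\<^esub> t \<in> ?B"
      unfolding B by (auto simp: inv sum_negf intro!: exI[of _ "\<lambda>a. - y a"] forms_uminus)
  next
    fix t u assume "t \<in> ?B" "u \<in> ?B"
    then obtain y z where "t = ktup (rank F i) (\<lambda>a. \<Sum>b<rank F (Suc i). A i a b * y b)"
      "\<forall>a<rank F (Suc i). y a \<in> forms (j - bdeg F (Suc i) a)"
      "u = ktup (rank F i) (\<lambda>a. \<Sum>b<rank F (Suc i). A i a b * z b)"
      "\<forall>a<rank F (Suc i). z a \<in> forms (j - bdeg F (Suc i) a)" unfolding B by blast
    then show "t \<otimes>\<^bsub>copies resf (rank F i)\<^esub> u \<in> ?B"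
      unfolding B by (auto simp: field_module.mult_copies distrib_left sum.distrib intro!: exI[of _ "\<lambda>a. y a + z a"] forms_add)
  qed
  have C: "?C = {ktup (rank F i) x | x. (\<forall>a<rank F i. x a \<in> forms (j - bdeg F i a)) \<and>
      (\<forall>q. i = Suc q \<longrightarrow> (\<forall>a<rank F q. lookup (\<Sum>b<rank F i. A q a b * x b) 0 = 0))}"
    unfolding tensor_cycles_def tensor_component_eq
    by (auto simp: d one field_module.tup_eq_iff)
  have "trivial_group (copies resf (rank F i) \<lparr>carrier := ?C\<rparr> Mod ?B) \<longleftrightarrow> ?C \<subseteq> ?B"
    by (rule trivial_FactGroup_iff[OF G.group_axioms sub])
      (auto simp: C field_module.carrier_copies one intro!: exI[of _ "\<lambda>_. 0"])
  also have "\<dots> \<longleftrightarrow> (\<forall>x. (\<forall>a<rank F i. x a \<in> forms (j - bdeg F i a)) \<and>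
      (\<forall>q. i = Suc q \<longrightarrow> (\<forall>a<rank F q. lookup (\<Sum>b<rank F i. A q a b * x b) 0 = 0)) \<longrightarrow>
      ktup (rank F i) x \<in> ?B)"
    unfolding C by blast
  also have "\<dots> \<longleftrightarrow> (\<forall>x. (\<forall>a<rank F i. x a \<in> forms (j - bdeg F i a)) \<and>
      (\<forall>q. i = Suc q \<longrightarrow> (\<forall>a<rank F q. lookup (\<Sum>b<rank F i. A q a b * x b) 0 = 0)) \<longrightarrow>
      (\<exists>y. (\<forall>c<rank F (Suc i). y c \<in> forms (j - bdeg F (Suc i) c)) \<and>
        (\<forall>b<rank F i. lookup (x b - (\<Sum>c<rank F (Suc i). A i b c * y c)) 0 = 0)))"
  proof -
    have "ktup (rank F i) x \<in> ?B \<longleftrightarrow> (\<exists>y. (\<forall>c<rank F (Suc i). y c \<in> forms (j - bdeg F (Suc i) c)) \<and>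
        (\<forall>b<rank F i. lookup (x b - (\<Sum>c<rank F (Suc i). A i b c * y c)) 0 = 0))" for x
      unfolding B by (auto simp: field_module.tup_eq_iff)
    then show ?thesis by simp
  qed
  finally show ?thesis .
qed

end

context lifted_resolution
begin

lemma D_unit0: "D q (\<lambda>b. unit0 (f b)) a = unit0 (\<Sum>b<r (Suc q). A q a b * f b)"
  by (auto simp: fun_eq_iff D_apply unit0_def)

lemma unit0_Bnd_iff: "unit0 f \<in> Bnd 0 \<longleftrightarrow> lookup f 0 = 0"
  by (simp add: Bnd_0_iff unit0_Kos) (simp add: unit0_def)

lemma chain_Kos_0: "chain p j (Kos 0) (\<lambda>b. unit0 (x b)) \<longleftrightarrow> (\<forall>b<r p. x b \<in> forms (j - dg p b))"
proof -
  have "khom e (unit0 f) \<longleftrightarrow> f \<in> forms e" for e f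
    by (auto simp: khom_def unit0_def dest: spec[of _ "{}"])
  then show ?thesis by (simp add: chain_def unit0_Kos)
qed

lemma van_residue_iff:
  "van p j (Kos 0) (Bnd 0) \<longleftrightarrow>
    (\<forall>x. (\<forall>a<r p. x a \<in> forms (j - dg p a)) \<and>
      (\<forall>q. p = Suc q \<longrightarrow> (\<forall>a<r q. lookup (\<Sum>b<r p. A q a b * x b) 0 = 0)) \<longrightarrow>
      (\<exists>y. (\<forall>c<r (Suc p). y c \<in> forms (j - dg (Suc p) c)) \<and>
        (\<forall>b<r p. lookup (x b - (\<Sum>c<r (Suc p). A p b c * y c)) 0 = 0)))"
    (is "?L \<longleftrightarrow> ?R")
proof -
  have cyc: "cycle p (Bnd 0) (\<lambda>b. unit0 (x b)) \<longleftrightarrow>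
      (\<forall>q. p = Suc q \<longrightarrow> (\<forall>a<r q. lookup (\<Sum>b<r p. A q a b * x b) 0 = 0))" for x
    by (auto simp: cycle_def D_unit0 unit0_Bnd_iff)
  have diff: "unit0 f - unit0 g = unit0 (f - g)" for f g
    by (auto simp: unit0_def fun_eq_iff)
  show ?thesis
  proof
    assume v: ?L
    show ?R
    proof (intro allI impI, elim conjE)
      fix x assume "\<forall>a<r p. x a \<in> forms (j - dg p a)"
        "\<forall>q. p = Suc q \<longrightarrow> (\<forall>a<r q. lookup (\<Sum>b<r p. A q a b * x b) 0 = 0)"
      then have 1: "chain p j (Kos 0) (\<lambda>b. unit0 (x b))" and 2: "cycle p (Bnd 0) (\<lambda>b. unit0 (x b))"
        by (simp_all only: chain_Kos_0 cyc not_False_eq_True simp_thms)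
      obtain y where y: "chain (Suc p) j (Kos 0) y" "\<And>b. b < r p \<Longrightarrow> unit0 (x b) - D p y b \<in> Bnd 0"
        using vanD[OF v 1 2] by blast
      have y': "y c = unit0 (y c {})" if "c < r (Suc p)" for c
        using y(1) that by (intro unit0_eq) (simp add: chain_def)
      have "y c {} \<in> forms (j - dg (Suc p) c)" if "c < r (Suc p)" for c
        using y(1) that by (auto simp: chain_def khom_def dest!: spec[of _ c] spec[of _ "{}"])
      moreover have "lookup (x b - (\<Sum>c<r (Suc p). A p b c * y c {})) 0 = 0" if "b < r p" for b
        using y(2)[OF that] by (simp add: Bnd_0_iff D_apply unit0_def)
      ultimately show "\<exists>y. (\<forall>c<r (Suc p). y c \<in> forms (j - dg (Suc p) c)) \<and>
          (\<forall>b<r p. lookup (x b - (\<Sum>c<r (Suc p). A p b c * y c)) 0 = 0)"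
        by (intro exI[of _ "\<lambda>c. y c {}"]) blast
    qed
  next
    assume R: ?R
    show ?L
    proof (rule vanI)
      fix x assume x: "chain p j (Kos 0) x" "cycle p (Bnd 0) x"
      define f where "f b = x b {}" for b
      have xf: "x b = unit0 (f b)" if "b < r p" for b
        using x(1) that unfolding f_def by (intro unit0_eq) (simp add: chain_def)
      have "chain p j (Kos 0) (\<lambda>b. unit0 (f b))"
        using x(1) xf by (simp add: chain_def)
      then have 1: "\<forall>a<r p. f a \<in> forms (j - dg p a)" by (simp only: chain_Kos_0)
      have "D q (\<lambda>b. unit0 (f b)) a = D q x a" if "p = Suc q" for q a
        unfolding D_def using xf that by (intro sum.cong) auto
      then have "cycle p (Bnd 0) (\<lambda>b. unit0 (f b))" using x(2) by (simp add: cycle_def)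
      then obtain y where y: "\<forall>c<r (Suc p). y c \<in> forms (j - dg (Suc p) c)"
        "\<forall>b<r p. lookup (f b - (\<Sum>c<r (Suc p). A p b c * y c)) 0 = 0"
        using R 1 unfolding cyc by blast
      have "chain (Suc p) j (Kos 0) (\<lambda>c. unit0 (y c))" using y(1) by (simp only: chain_Kos_0)
      moreover have "\<forall>b<r p. x b - D p (\<lambda>c. unit0 (y c)) b \<in> Bnd 0"
        using y(2) xf by (simp add: D_unit0 diff unit0_Bnd_iff)
      ultimately show "\<exists>y. chain (Suc p) j (Kos 0) y \<and> (\<forall>b<r p. x b - D p y b \<in> Bnd 0)" by blast
    qed
  qed
qed

end

text \<open>The choice inside \<open>Tor\<close> picks a genuine resolution because one exists.
  Nothing more is known about it, so its own matrices are lifted to polynomials.\<close>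

theorem (in graded_ideal) Tor_lift:
  assumes R: "\<And>d. d > R \<Longrightarrow> forms d \<subseteq> I"
  obtains r dg A \<alpha> where "lifted_resolution I r dg A \<alpha>"
    "\<And>i j. trivial_group (Tor (quot_alg I) (quot_forms I) i j) \<longleftrightarrow>
      lifted_resolution.van r dg A i j (Kos 0) (Bnd 0)"
proof -
  obtain r' dg' A' \<alpha>' where "lifted_resolution I r' dg' A' \<alpha>'"
    using lifted_resolution_exists[where R = R] R by blast
  then have ex: "\<exists>F. graded_free_resolution (quot_alg I) (quot_forms I) F"
    by (rule lift_resolution)
  define F where "F = (SOME F. graded_free_resolution (quot_alg I) (quot_forms I) F)"
  have "graded_free_resolution (quot_alg I) (quot_forms I) F"
    unfolding F_def using ex by (rule someI_ex)
  then obtain A \<alpha> where A: "lifted_resolution I (rank F) (bdeg F) A \<alpha>" "matches F A \<alpha>"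
    using resolution_lift by blast
  show ?thesis
  proof (rule that[OF A(1)])
    fix i j
    show "trivial_group (Tor (quot_alg I) (quot_forms I) i j) \<longleftrightarrow>
      lifted_resolution.van (rank F) (bdeg F) A i j (Kos 0) (Bnd 0)"
      unfolding Tor_def Let_def F_def[symmetric] lifted_resolution.van_residue_iff[OF A(1)]
      using A(2) by (intro Tor_trivial_iff) (simp add: matches_def)
  qed
qed

section \<open>Vanishing of Koszul homology\<close>

lemma pconst_sum: "pconst (sum f A) = (\<Sum>a\<in>A. pconst (f a))"
  by (induction A rule: infinite_finite_induct) (auto simp: pconst_add)

context graded_ideal
begin

text \<open>The Koszul complex on the inverse system (functions on monomials, with a variable acting by
  shifting the argument) splits by multidegree \<open>w\<close>.  In each multidegree with a nonpositive entry
  \<open>w p\<close>, wedging with the basis vector \<open>p\<close> is a contraction, by \<open>koszul_homotopy\<close> with all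
  variables replaced by \<open>1\<close>.\<close>

lemma inverse_system_koszul:
  fixes \<zeta> :: "'n set \<Rightarrow> ('n \<Rightarrow>\<^sub>0 nat) \<Rightarrow> ('n, 'k) mpoly"
  assumes i: "i < CARD('n)" and e: "0 \<le> e"
    and cyc: "\<And>s u. card s + 1 = i \<Longrightarrow> int (mdeg u) + 1 = e \<Longrightarrow>
      (\<Sum>l\<in>-s. ksign l s * \<zeta> (insert l s) (u + single l 1)) \<in> I"
    and \<zeta>: "\<And>s u. card s = i \<Longrightarrow> int (mdeg u) = e \<Longrightarrow> \<zeta> s u \<in> forms \<rho>"
  shows "\<exists>\<eta>. (\<forall>s u. card s = Suc i \<longrightarrow> int (mdeg u) = e + 1 \<longrightarrow> \<eta> s u \<in> forms \<rho>) \<and>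
    (\<forall>s u. card s = i \<longrightarrow> int (mdeg u) = e \<longrightarrow>
      \<zeta> s u - (\<Sum>l\<in>-s. ksign l s * \<eta> (insert l s) (u + single l 1)) \<in> I)"
proof -
  \<comment> \<open>The multidegree at \<open>s\<close> and \<open>u\<close>: inserting
    \<open>l\<close> into \<open>s\<close> while raising \<open>u\<close> at \<open>l\<close> leaves
    it unchanged. Exponents count negatively because variables act by shifting the argument.\<close>
  define wt where "wt s u = (\<lambda>l. (if l \<in> s then 1 else 0) - int (lookup u l))" for s :: "'n set" and u
  define pv where "pv w = (SOME p :: 'n. w p \<le> (0 :: int))" for w
  define E where "E l = (single l 1 :: 'n \<Rightarrow>\<^sub>0 nat)" for l
  define \<eta> where "\<eta> s u = (let p = pv (wt s u) in if p \<in> s then ksign p (s - {p}) * \<zeta> (s - {p}) (u - E p) else 0)" for s u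
  \<comment> \<open>\<open>U\<close> recovers the exponent vector from \<open>s\<close> and the
    multidegree; \<open>Z w\<close> is the slice of \<open>\<zeta>\<close> in multidegree
    \<open>w\<close>, extended by zero where there is no such vector.\<close>
  define U where "U s w = Abs_poly_mapping (\<lambda>l. nat ((if l \<in> s then 1 else 0) - w l))" for s :: "'n set" and w :: "'n \<Rightarrow> int"
  define Z where "Z w s = (if \<forall>l. w l \<le> (if l \<in> s then 1 else 0) then \<zeta> s (U s w) else 0)" for w and s :: "'n set"
  have U_wt: "U s (wt s u) = u" for s u
    by (rule poly_mapping_eqI) (simp add: U_def wt_def)
  have Z_wt: "Z (wt s u) s = \<zeta> s u" for s u
    by (auto simp: Z_def U_wt) (auto simp: wt_def split: if_splits)
  have wt_insert: "wt (insert l s) (u + E l) = wt s u" if "l \<notin> s" for l s u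
    using that by (auto simp: wt_def E_def fun_eq_iff lookup_add lookup_single when_def)
  have eta: "\<eta> s u = kwedge p (Z w) s" if p: "w p \<le> 0" "p = pv w" "w = wt s u" for s u w p
  proof (cases "p \<in> s")
    case True
    then have "lookup u p \<ge> 1" using p by (simp add: wt_def)
    then have "wt (s - {p}) (u - E p) = w"
      using True p(3) by (auto simp: wt_def E_def fun_eq_iff lookup_minus lookup_single when_def)
    then show ?thesis using True p Z_wt[of "s - {p}" "u - E p"] by (simp add: \<eta>_def kwedge_def Let_def)
  next
    case False
    then show ?thesis using p by (simp add: \<eta>_def kwedge_def Let_def)
  qed
  have "\<eta> s u \<in> forms \<rho>" if su: "card s = Suc i" "int (mdeg u) = e + 1" for s u
  proof (cases "pv (wt s u) \<in> s")
    case True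
    let ?p = "pv (wt s u)"
    \<comment> \<open>All entries positive would force \<open>u = 0\<close>, against
      \<open>mdeg u = e + 1\<close>.\<close>
    have "\<exists>p. wt s u p \<le> 0"
    proof (rule ccontr)
      assume "\<not> (\<exists>p. wt s u p \<le> 0)"
      then have pos: "0 < wt s u l" for l by (simp add: not_le)
      have "lookup u l = 0" for l
        using pos[of l] by (simp add: wt_def split: if_splits)
      then have "u = 0" by (intro poly_mapping_eqI) simp
      then show False using su e by simp
    qed
    then have "wt s u ?p \<le> 0" unfolding pv_def by (rule someI_ex)
    then have "lookup u ?p \<ge> 1" using True by (simp add: wt_def)
    then have "u = E ?p + (u - E ?p)"
      by (intro poly_mapping_eqI) (auto simp: E_def lookup_add lookup_minus lookup_single when_def)
    then have "mdeg u = 1 + mdeg (u - E ?p)" by (metis mdeg_add mdeg_single E_def)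
    then have "\<zeta> (s - {?p}) (u - E ?p) \<in> forms \<rho>"
      using su True by (intro \<zeta>) (auto simp: card_Diff_singleton)
    then show ?thesis using True by (simp add: \<eta>_def Let_def ksign_mult_forms)
  qed (simp add: \<eta>_def Let_def)
  moreover have "\<zeta> s u - (\<Sum>l\<in>-s. ksign l s * \<eta> (insert l s) (u + E l)) \<in> I"
    if su: "card s = i" "int (mdeg u) = e" for s u
  proof -
    define w where "w = wt s u"
    define p where "p = pv w"
    \<comment> \<open>Since \<open>i\<close> is below the number of variables, some index outside
      \<open>s\<close> has nonpositive weight; this excludes the end of the complex.\<close>
    have "s \<noteq> UNIV" using su i by auto
    then obtain l where "l \<notin> s" by auto
    then have "w l \<le> 0" by (simp add: w_def wt_def)
    then have "\<exists>p. w p \<le> 0" ..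
    then have p: "w p \<le> 0" unfolding p_def pv_def by (rule someI_ex)
    have "(\<Sum>l\<in>-s. ksign l s * \<eta> (insert l s) (u + E l)) = kdiff (\<lambda>_. 1) (kwedge p (Z w)) s"
      unfolding kdiff_def using eta[OF p p_def] wt_insert by (intro sum.cong refl) (simp add: w_def)
    also have "\<dots> = Z w s - kwedge p (kdiff (\<lambda>_. 1) (Z w)) s"
      using koszul_homotopy[of "\<lambda>_. 1" p "Z w" s] by (simp add: eq_diff_eq)
    finally have eq: "\<zeta> s u - (\<Sum>l\<in>-s. ksign l s * \<eta> (insert l s) (u + E l)) = kwedge p (kdiff (\<lambda>_. 1) (Z w)) s"
      using Z_wt[of s u] by (simp add: w_def)
    \<comment> \<open>By the contraction, the defect is \<open>p\<close> wedged with the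
      differential of the slice; the cycle condition at \<open>s - {p}\<close> and
      \<open>u - E p\<close> puts it into \<open>I\<close>.\<close>
    show ?thesis
    proof (cases "p \<in> s")
      case True
      then have "lookup u p \<ge> 1" using p by (simp add: wt_def w_def)
      then have up: "E p + (u - E p) = u" and "wt (s - {p}) (u - E p) = w"
        using True unfolding w_def
        by (auto simp: wt_def E_def fun_eq_iff lookup_add lookup_minus lookup_single when_def intro!: poly_mapping_eqI)
      then have Zi: "Z w (insert l (s - {p})) = \<zeta> (insert l (s - {p})) (u - E p + E l)" if "l \<notin> s - {p}" for l
        using Z_wt[of "insert l (s - {p})" "u - E p + E l"] wt_insert[OF that, of "u - E p"] by simp
      have "kdiff (\<lambda>_. 1) (Z w) (s - {p}) = (\<Sum>l\<in>-(s - {p}). ksign l (s - {p}) * \<zeta> (insert l (s - {p})) (u - E p + E l))"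
        unfolding kdiff_def by (intro sum.cong refl) (simp only: mult_1_right Zi[OF ComplD])
      also have "\<dots> \<in> I"
        unfolding E_def
      proof (rule cyc)
        show "card (s - {p}) + 1 = i" using True su by (metis Suc_eq_plus1 card_Suc_Diff1 finite)
        show "int (mdeg (u - single p 1)) + 1 = e"
          using su up mdeg_add[of "E p" "u - E p"] by (simp add: E_def)
      qed
      finally show ?thesis unfolding eq using True by (simp add: kwedge_def I_mult)
    next
      case False
      then show ?thesis unfolding eq by (simp add: kwedge_def I_0)
    qed
  qed
  ultimately show ?thesis unfolding E_def by (intro exI[of _ \<eta>]) blast
qed

text \<open>If multiplication by the monomials of degree \<open>\<rho> - d\<close> identifies \<open>S\<^sub>d / I\<^sub>d\<close> with all functions
  from these monomials to \<open>S\<^sub>\<rho> / I\<^sub>\<rho>\<close>, then in these degrees the quotient agrees with an inverse system.\<close>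

lemma koszul_vanishing:
  fixes \<rho> \<tau> :: int
  assumes inj: "\<And>d f. d \<le> \<rho> \<Longrightarrow> f \<in> forms d \<Longrightarrow>
      (\<And>u. int (mdeg u) = \<rho> - d \<Longrightarrow> single u 1 * f \<in> I) \<Longrightarrow> f \<in> I"
    and top: "\<And>d. d > \<rho> \<Longrightarrow> forms d \<subseteq> I"
    and surj: "\<And>d g. \<tau> \<le> d \<Longrightarrow> d \<le> \<rho> \<Longrightarrow> (\<And>u. int (mdeg u) = \<rho> - d \<Longrightarrow> g u \<in> forms \<rho>) \<Longrightarrow>
      \<exists>f\<in>forms d. \<forall>u. int (mdeg u) = \<rho> - d \<longrightarrow> single u 1 * f - g u \<in> I"
    and i: "i < CARD('n)" and z: "z \<in> Zyc i" "khom j z" and j: "j > \<tau> + int i"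
  shows "z \<in> Bnd i"
proof (cases "j - int i > \<rho>")
  case True
  have "z s \<in> I" for s
  proof (cases "card s = i")
    case True
    then show ?thesis using z(2) top[OF \<open>j - int i > \<rho>\<close>] by (auto simp: khom_def)
  next
    case False
    then show ?thesis using z(1) I_0 by (simp add: Zyc_def Kos_def)
  qed
  then have "z \<in> IKos i" using z(1) by (simp add: IKos_def Zyc_def)
  then show ?thesis using IKos_sub_Bnd by blast
next
  case False
  \<comment> \<open>Multiplication by monomials of the complementary degree \<open>e\<close> moves
    the coefficients of \<open>z\<close> into degree \<open>\<rho>\<close>.\<close>
  define e where "e = \<rho> - (j - int i)"
  define \<zeta> where "\<zeta> s u = single u 1 * z s" for s u
  have zf: "z s \<in> forms (j - int i)" if "card s = i" for s
    using z(2) that by (auto simp: khom_def)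
  have single_pvar: "single u 1 * (pvar l * f) = single (u + single l 1) 1 * f"
    for u l and f :: "('n, 'k) mpoly"
    by (simp add: pvar_def mult.assoc[symmetric] mult_single)
  have single_kd: "single u 1 * kd x s
      = (\<Sum>l\<in>-s. ksign l s * (single (u + single l 1) 1 * x (insert l s)))"
    for u s and x :: "('n, 'k) kvec"
    unfolding kdiff_def sum_distrib_left single_pvar[symmetric]
    by (intro sum.cong refl) (simp add: mult_ac)
  have "\<exists>\<eta>. (\<forall>s u. card s = Suc i \<longrightarrow> int (mdeg u) = e + 1 \<longrightarrow> \<eta> s u \<in> forms \<rho>) \<and>
    (\<forall>s u. card s = i \<longrightarrow> int (mdeg u) = e \<longrightarrow>
      \<zeta> s u - (\<Sum>l\<in>-s. ksign l s * \<eta> (insert l s) (u + single l 1)) \<in> I)"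
  proof (rule inverse_system_koszul[OF i])
    show "0 \<le> e" using False by (simp add: e_def)
    show "(\<Sum>l\<in>-s. ksign l s * \<zeta> (insert l s) (u + single l 1)) \<in> I" for s u
    proof -
      have "single u 1 * kd z s \<in> I" using z(1) I_mult by (auto simp: Zyc_def)
      then show ?thesis by (simp add: single_kd \<zeta>_def)
    qed
    show "\<zeta> s u \<in> forms \<rho>" if "card s = i" "int (mdeg u) = e" for s u
      unfolding \<zeta>_def using that by (intro forms_mult_eq[OF forms_single[OF refl] zf]) (auto simp: e_def)
  qed
  then obtain \<eta> where \<eta>: "\<And>s u. card s = Suc i \<Longrightarrow> int (mdeg u) = e + 1 \<Longrightarrow> \<eta> s u \<in> forms \<rho>"
    "\<And>s u. card s = i \<Longrightarrow> int (mdeg u) = e \<Longrightarrow>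
      \<zeta> s u - (\<Sum>l\<in>-s. ksign l s * \<eta> (insert l s) (u + single l 1)) \<in> I" by blast
  have "\<exists>f. card s = Suc i \<longrightarrow> f \<in> forms (j - int i - 1) \<and>
      (\<forall>u. int (mdeg u) = e + 1 \<longrightarrow> single u 1 * f - \<eta> s u \<in> I)" for s
  proof (cases "card s = Suc i")
    case True
    \<comment> \<open>The primitive lives in degree \<open>j - i - 1\<close>, one lower;
      \<open>j > \<tau> + i\<close> keeps this at least \<open>\<tau>\<close>, where surjectivity is
      available.\<close>
    have "\<exists>f\<in>forms (j - int i - 1). \<forall>u. int (mdeg u) = \<rho> - (j - int i - 1) \<longrightarrow> single u 1 * f - \<eta> s u \<in> I"
      using j False by (intro surj \<eta>(1)[OF True]) (auto simp: e_def)
    then show ?thesis by (auto simp: e_def algebra_simps)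
  qed simp
  then obtain y where y: "\<And>s. card s = Suc i \<Longrightarrow> y s \<in> forms (j - int i - 1)"
    "\<And>s u. card s = Suc i \<Longrightarrow> int (mdeg u) = e + 1 \<Longrightarrow> single u 1 * y s - \<eta> s u \<in> I"
    by metis
  define w where "w s = (if card s = Suc i then y s else 0)" for s
  have w: "w \<in> Kos (Suc i)" by (simp add: Kos_def w_def)
  have "khom j w" using y(1) by (auto simp: khom_def w_def algebra_simps)
  have "(z - kd w) s \<in> I" for s
  proof (cases "card s = i")
    case s: True
    show ?thesis
    proof (rule inj[of "j - int i"])
      show "j - int i \<le> \<rho>" using False by simp
      show "(z - kd w) s \<in> forms (j - int i)"
        using khom_diff[OF z(2) khom_kd[OF \<open>khom j w\<close>]] s unfolding khom_def by auto
      fix u :: "'n \<Rightarrow>\<^sub>0 nat" assume u: "int (mdeg u) = \<rho> - (j - int i)"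
      have "(\<Sum>l\<in>-s. ksign l s * (single (u + single l 1) 1 * w (insert l s) - \<eta> (insert l s) (u + single l 1))) \<in> I"
      proof (intro I_sum I_mult)
        fix l assume "l \<in> -s"
        then have "card (insert l s) = Suc i" using s by simp
        then show "single (u + single l 1) 1 * w (insert l s) - \<eta> (insert l s) (u + single l 1) \<in> I"
          using u unfolding w_def by (simp add: y(2) mdeg_add e_def)
      qed
      then have "(\<zeta> s u - (\<Sum>l\<in>-s. ksign l s * \<eta> (insert l s) (u + single l 1))) -
        (\<Sum>l\<in>-s. ksign l s * (single (u + single l 1) 1 * w (insert l s) - \<eta> (insert l s) (u + single l 1))) \<in> I"
        using s u by (intro I_diff[OF \<eta>(2)]) (auto simp: e_def)
      then show "single u 1 * (z - kd w) s \<in> I"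
        by (simp add: \<zeta>_def right_diff_distrib sum_subtractf single_kd)
    qed
  next
    case False
    then show ?thesis using z(1) kd_Kos[OF w] I_0 by (simp add: Zyc_def Kos_def)
  qed
  then show ?thesis using w z(1) unfolding Bnd_def Zyc_def by blast
qed

text \<open>Exactness of the Koszul complex of the polynomial ring in degree one: every monomial multiple
  of a basis vector is, modulo a Koszul relation, a monomial multiple of the basis vector chosen for
  its multidegree.\<close>

lemma polynomial_koszul_exact_1:
  assumes z: "z \<in> Kos 1" "kd z = 0"
  shows "\<exists>w\<in>Kos 2. kd w = z"
proof -
  define E where "E l = (single l 1 :: 'n \<Rightarrow>\<^sub>0 nat)" for l
  define b where "b l = (\<lambda>s. if s = {l} then 1 else 0 :: ('n, 'k) mpoly)" for l :: 'n
  define pv where "pv v = (SOME p. lookup v p \<noteq> 0)" for v :: "'n \<Rightarrow>\<^sub>0 nat"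
  \<comment> \<open>\<open>G v\<close> is the chosen representative of multidegree \<open>v\<close>;
    \<open>t l u\<close> is the Koszul relation that turns \<open>u\<close> times the basis vector
    of \<open>l\<close> into it.\<close>
  define G where "G v = ksmult (single (v - E (pv v)) 1) (b (pv v))" for v
  define t where "t l u = (if pv (u + E l) = l then 0 else
      ksmult (single (u - E (pv (u + E l))) 1) (kwedge (pv (u + E l)) (b l)))" for l u
  have b: "b l \<in> Kos 1" for l by (auto simp: b_def Kos_def)
  have kd_b: "kd (b l) s = (if s = {} then pvar l else 0)" for l s
  proof (cases "s = {}")
    case True
    then show ?thesis by (simp add: kdiff_def b_def ksign_def if_distrib[of "\<lambda>t. _ * t"] cong: if_cong)
  next
    case False
    then show ?thesis using kd_Kos[of "b l" 0] b[of l] by (auto simp: Kos_def)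
  qed
  have kw_b: "kd (kwedge p (b l)) = ksmult (pvar p) (b l) - ksmult (pvar l) (b p)" for p l
  proof
    fix s
    have "kwedge p (kd (b l)) s = pvar l * b p s"
    proof (cases "p \<in> s")
      case True
      then have "s - {p} = {} \<longleftrightarrow> s = {p}" by auto
      then show ?thesis using True by (simp add: kwedge_def kd_b) (simp add: b_def ksign_def)
    qed (auto simp: kwedge_def b_def)
    then show "kd (kwedge p (b l)) s = (ksmult (pvar p) (b l) - ksmult (pvar l) (b p)) s"
      using koszul_homotopy[of pvar p "b l" s] by (simp add: ksmult_def eq_diff_eq)
  qed
  have kd_t: "kd (t l u) = ksmult (single u 1) (b l) - G (u + E l)" for l u
  proof (cases "pv (u + E l) = l")
    case True
    then have "G (u + E l) = ksmult (single u 1) (b l)" by (simp add: G_def)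
    then show ?thesis using True by (simp add: t_def kd_0)
  next
    case False
    let ?p = "pv (u + E l)"
    have "\<exists>p. lookup (u + E l) p \<noteq> 0" by (intro exI[of _ l]) (simp add: E_def lookup_add)
    then have "lookup (u + E l) ?p \<noteq> 0" unfolding pv_def by (rule someI_ex)
    then have "lookup u ?p \<noteq> 0" using False by (simp add: E_def lookup_add lookup_single)
    then have 1: "u - E ?p + E ?p = u" "u - E ?p + E l = u + E l - E ?p"
      by (auto intro!: poly_mapping_eqI simp: E_def lookup_add lookup_minus lookup_single when_def)
    have "kd (t l u) = ksmult (single (u - E ?p) 1 * pvar ?p) (b l)
        - ksmult (single (u - E ?p) 1 * pvar l) (b ?p)"
      using False by (simp add: t_def kd_smult kw_b ksmult_diff ksmult_mult)
    also have "single (u - E ?p) 1 * pvar ?p = single u (1 :: 'k)"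
      using 1(1) by (simp add: pvar_def mult_single E_def)
    also have "single (u - E ?p) 1 * pvar l = single (u + E l - E ?p) (1 :: 'k)"
      using 1(2) by (simp add: pvar_def mult_single E_def)
    finally show ?thesis by (simp only: G_def)
  qed
  define w where "w = (\<Sum>l\<in>UNIV. \<Sum>u\<in>keys (z {l}). ksmult (pconst (lookup (z {l}) u)) (t l u))"
  have "t l u \<in> Kos 2" for l u
    using kwedge_Kos[OF b] gsub_Kos[of 2] by (auto simp: t_def numeral_2_eq_2 intro: gsub_0 gsub_smult)
  then have "w \<in> Kos 2" unfolding w_def by (intro gsub_sum gsub_smult gsub_Kos)
  have z_eq: "z = (\<Sum>l\<in>UNIV. ksmult (z {l}) (b l))"
  proof
    fix s
    show "z s = (\<Sum>l\<in>UNIV. ksmult (z {l}) (b l)) s"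
    proof (cases "card s = 1")
      case True
      then obtain l where "s = {l}" by (rule card_1_singletonE)
      then show ?thesis by (simp add: sum_fun_apply ksmult_def b_def if_distrib[of "\<lambda>t. _ * t"] cong: if_cong)
    next
      case False
      then have "s \<noteq> {l}" for l by auto
      then show ?thesis using z(1) False by (simp add: sum_fun_apply ksmult_def b_def Kos_def)
    qed
  qed
  define W where "W = (\<Union>l. (\<lambda>u. u + E l) ` keys (z {l}))"
  have finW: "finite W" by (simp add: W_def)
  have inj: "inj_on (\<lambda>u. u + E l) A" for l A by (auto simp: inj_on_def)
  \<comment> \<open>Collected by multidegree, the coefficient of \<open>G v\<close> is that of
    \<open>v\<close> in the polynomial \<open>kd z {}\<close>, which is zero.\<close>
  have coeff: "(\<Sum>l\<in>UNIV. \<Sum>u\<in>keys (z {l}). ksmult (pconst (lookup (z {l}) u)) (G (u + E l)))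
      = (\<Sum>v\<in>W. ksmult (pconst (lookup (\<Sum>l\<in>UNIV. pvar l * z {l}) v)) (G v))"
  proof -
    have lk: "lookup (pvar l * f) v = (if v \<in> (\<lambda>u. u + E l) ` keys f
        then lookup f (v - E l) else 0)" for l v and f :: "('n, 'k) mpoly"
    proof (cases "v \<in> (\<lambda>u. u + E l) ` keys f")
      case True
      then obtain u where "v = u + E l" by blast
      then show ?thesis using True lookup_single_mult[of "E l" 1 f u] by (simp add: pvar_def E_def add.commute)
    next
      case False
      then have "v \<notin> keys (pvar l * f)"
        using keys_mult[of "pvar l" f] by (auto simp: pvar_def E_def add.commute)
      then show ?thesis using False by (simp add: in_keys_iff)
    qed
    have "(\<Sum>u\<in>keys (z {l}). ksmult (pconst (lookup (z {l}) u)) (G (u + E l)))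
      = (\<Sum>v\<in>W. ksmult (pconst (lookup (pvar l * z {l}) v)) (G v))" for l
    proof -
      have "(\<Sum>v\<in>W. ksmult (pconst (lookup (pvar l * z {l}) v)) (G v))
        = (\<Sum>v\<in>(\<lambda>u. u + E l) ` keys (z {l}). ksmult (pconst (lookup (pvar l * z {l}) v)) (G v))"
        using finW by (intro sum.mono_neutral_right) (auto simp: W_def lk)
      also have "\<dots> = (\<Sum>u\<in>keys (z {l}). ksmult (pconst (lookup (z {l}) u)) (G (u + E l)))"
        by (subst sum.reindex[OF inj]) (auto intro!: sum.cong simp: lk)
      finally show ?thesis by simp
    qed
    then have "(\<Sum>l\<in>UNIV. \<Sum>u\<in>keys (z {l}). ksmult (pconst (lookup (z {l}) u)) (G (u + E l)))
      = (\<Sum>l\<in>UNIV. \<Sum>v\<in>W. ksmult (pconst (lookup (pvar l * z {l}) v)) (G v))"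
      by (rule sum.cong[OF refl])
    also have "\<dots> = (\<Sum>v\<in>W. \<Sum>l\<in>UNIV. ksmult (pconst (lookup (pvar l * z {l}) v)) (G v))"
      by (rule sum.swap)
    also have "\<dots> = (\<Sum>v\<in>W. ksmult (pconst (lookup (\<Sum>l\<in>UNIV. pvar l * z {l}) v)) (G v))"
      by (simp only: lookup_sum pconst_sum ksmult_sum_left)
    finally show ?thesis .
  qed
  have "(\<Sum>l\<in>UNIV. pvar l * z {l}) = kd z {}"
    by (simp add: kdiff_def ksign_def)
  then have 0: "(\<Sum>l\<in>UNIV. \<Sum>u\<in>keys (z {l}). ksmult (pconst (lookup (z {l}) u)) (G (u + E l))) = 0"
    unfolding coeff using z(2) by simp
  have "kd w = (\<Sum>l\<in>UNIV. \<Sum>u\<in>keys (z {l}). ksmult (pconst (lookup (z {l}) u)) (ksmult (single u 1) (b l)))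
     - (\<Sum>l\<in>UNIV. \<Sum>u\<in>keys (z {l}). ksmult (pconst (lookup (z {l}) u)) (G (u + E l)))"
    by (simp only: w_def kd_sum kd_smult kd_t ksmult_diff sum_subtractf)
  also have "\<dots> = (\<Sum>l\<in>UNIV. ksmult (\<Sum>u\<in>keys (z {l}). pconst (lookup (z {l}) u) * single u 1) (b l))"
    unfolding 0 by (simp add: ksmult_mult ksmult_sum_left)
  also have "\<dots> = (\<Sum>l\<in>UNIV. ksmult (z {l}) (b l))"
  proof (intro sum.cong refl)
    fix l
    have "(\<Sum>u\<in>keys (z {l}). pconst (lookup (z {l}) u) * single u 1) = z {l}"
      using monomial_sum[of "z {l}"] by (simp add: pconst_def mult_single)
    then show "ksmult (\<Sum>u\<in>keys (z {l}). pconst (lookup (z {l}) u) * single u 1) (b l) = ksmult (z {l}) (b l)"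
      by simp
  qed
  finally show ?thesis using \<open>w \<in> Kos 2\<close> z_eq by metis
qed

end

section \<open>Dimensions of graded components\<close>

context vector_space
begin

lemma span_Int_trivial:
  assumes "independent (B \<union> C)" "B \<inter> C = {}" "x \<in> span B" "x \<in> span C"
  shows "x = 0"
proof -
  have "representation (B \<union> C) x = representation B x" "representation (B \<union> C) x = representation C x"
    using assms by (auto intro!: representation_extend)
  then have "representation (B \<union> C) x b = 0" for b
    using representation_ne_zero[of B x b] representation_ne_zero[of C x b] assms(2) by (metis disjoint_iff)
  moreover have "x \<in> span (B \<union> C)" using assms(3) span_mono[of B "B \<union> C"] by blast
  ultimately show ?thesis
    using sum_nonzero_representation_eq[OF assms(1), of x] by simp
qed

lemma span_subset_of_card_le:
  assumes "independent A" "A \<subseteq> span T" "finite T" "card T \<le> card A"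
  shows "span T \<subseteq> span A"
proof
  fix x assume x: "x \<in> span T"
  show "x \<in> span A"
  proof (rule ccontr)
    assume "x \<notin> span A"
    then have "independent (insert x A)" "x \<notin> A" using independent_insertI[OF _ assms(1)] span_base by blast+
    moreover have "finite A" using independent_span_bound[OF assms(3,1,2)] by simp
    ultimately show False
      using independent_span_bound[OF assms(3), of "insert x A"] assms(2,4) x by auto
  qed
qed

end

section \<open>Dimension over the constants and cardinality of bases\<close>

lemma subfield_constants:
  fixes h :: "('n::finite, 'k::field) mpoly \<Rightarrow> 't"
  assumes T: "ring T" and h: "h \<in> ring_hom poly_alg T" and ne: "\<one>\<^bsub>T\<^esub> \<noteq> \<zero>\<^bsub>T\<^esub>"
  shows "subfield (h ` constants) T"
proof -
  let ?k = "ring_of_type_algebra :: 'k ring"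
  have k: "field ?k" by (rule field_from_type_algebra)
  have "(\<lambda>c. h (pconst c)) \<in> ring_hom ?k T"
    using h by (auto simp: ring_hom_def ring_of_type_algebra_def pconst_add pconst_mult)
  then have "ring_hom_ring ?k T (\<lambda>c. h (pconst c))"
    using k T by (intro ring_hom_ringI2) (auto simp: field.is_ring cring.axioms(1) field_def domain_def)
  moreover have "subfield (carrier ?k) ?k" using k by (rule field.carrier_is_subfield)
  ultimately have "subfield ((\<lambda>c. h (pconst c)) ` carrier ?k) T"
    using ne by (rule ring_hom_ring.img_is_subfield(2))
  moreover have "(\<lambda>c. h (pconst c)) ` carrier ?k = h ` constants"
    by (simp add: constants_def pconst_def[abs_def] image_image ring_of_type_algebra_def)
  ultimately show ?thesis by simp
qed

text \<open>The dimension of \<open>HOL-Algebra\<close> is built by line extensions, so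
  \<open>B\<close> is inserted vector by vector. Each new class is outside the previous ones because
  \<open>N\<close>, which contains the kernel of \<open>h\<close>, meets the span of
  \<open>B\<close> only in zero.\<close>

lemma dimension_class:
  fixes h :: "('n::finite, 'k::field) mpoly \<Rightarrow> 't"
  assumes T: "ring T" and h: "h \<in> ring_hom poly_alg T"
    and eq: "\<And>f g. h f = h g \<Longrightarrow> f - g \<in> N"
    and B: "finite B" "pvs.independent B" "pvs.span B \<inter> N \<subseteq> {0}"
  shows "ring.dimension T (card B) (h ` constants) (h ` pvs.span B)"
  using B
proof (induction B rule: finite_induct)
  case empty
  have "h 0 = \<zero>\<^bsub>T\<^esub>" using ring_hom_zero[OF h poly_alg.ring_axioms T] by simp
  then show ?case using ring.zero_dim[OF T] by simp
next
  case (insert b B)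
  have sub: "pvs.span B \<subseteq> pvs.span (insert b B)" by (intro pvs.span_mono) auto
  have b: "b \<notin> pvs.span B" "pvs.independent B"
    using insert by (auto simp: pvs.independent_insert)
  have "h b \<notin> h ` pvs.span B"
  proof
    assume "h b \<in> h ` pvs.span B"
    then obtain s where s: "h b = h s" "s \<in> pvs.span B" by blast
    have "b - s \<in> pvs.span (insert b B)"
      by (rule pvs.span_diff[OF pvs.span_base subsetD[OF sub s(2)]]) simp
    then have "b = s" using eq[OF s(1)] insert.prems(2) by auto
    then show False using b s by simp
  qed
  moreover have "h b \<in> carrier T" using h by (auto simp: ring_hom_def)
  moreover have "ring.dimension T (card B) (h ` constants) (h ` pvs.span B)"
    using insert b(2) sub by (intro insert.IH) auto
  ultimately have "ring.dimension T (Suc (card B)) (h ` constants) (ring.line_extension T (h ` constants) (h b) (h ` pvs.span B))"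
    by (intro ring.Suc_dim[OF T])
  moreover have "ring.line_extension T (h ` constants) (h b) (h ` pvs.span B) = h ` pvs.span (insert b B)"
  proof -
    have hh: "h (pconst c) \<otimes>\<^bsub>T\<^esub> h b \<oplus>\<^bsub>T\<^esub> h v = h (pscale c b + v)" for c v
      using h by (simp add: ring_hom_def pscale_def)
    have "y \<in> ring.line_extension T (h ` constants) (h b) (h ` pvs.span B) \<longleftrightarrow> (\<exists>c. \<exists>v\<in>pvs.span B. y = h (pscale c b + v))" for y
      unfolding ring.line_extension_mem_iff[OF T] by (auto simp: constants_def pconst_def[symmetric] hh)
    moreover have "(\<exists>c. \<exists>v\<in>pvs.span B. y = h (pscale c b + v)) \<longleftrightarrow> y \<in> h ` pvs.span (insert b B)" for y
    proof
      assume "\<exists>c. \<exists>v\<in>pvs.span B. y = h (pscale c b + v)"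
      then obtain c v where "v \<in> pvs.span B" "y = h (pscale c b + v)" by blast
      moreover have "pscale c b + v \<in> pvs.span (insert b B)"
        by (rule pvs.span_add[OF pvs.span_scale[OF pvs.span_base] subsetD[OF sub \<open>v \<in> pvs.span B\<close>]]) simp
      ultimately show "y \<in> h ` pvs.span (insert b B)" by blast
    next
      assume "y \<in> h ` pvs.span (insert b B)"
      then obtain x c where "y = h x" "x - pscale c b \<in> pvs.span B" by (auto simp: pvs.span_breakdown_eq)
      then show "\<exists>c. \<exists>v\<in>pvs.span B. y = h (pscale c b + v)"
        by (intro exI[of _ c] bexI[of _ "x - pscale c b"]) auto
    qed
    ultimately show ?thesis by blast
  qed
  ultimately show ?case using insert by simp
qed

lemma pscale_forms: "f \<in> forms d \<Longrightarrow> pscale c f \<in> forms d"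
  unfolding pscale_def using forms_mult[OF forms_pconst] by fastforce

lemma subspace_forms: "pvs.subspace (forms d)"
  by (auto simp: pvs.subspace_def intro: forms_add pscale_forms)

definition mons :: "int \<Rightarrow> ('n::finite \<Rightarrow>\<^sub>0 nat) set"
  where "mons d = {u. int (mdeg u) = d}"

lemma finite_mons: "finite (mons d :: ('n::finite \<Rightarrow>\<^sub>0 nat) set)"
  using finite_mdeg[of "nat d"] unfolding mons_def by (rule finite_subset[rotated]) auto

definition mbasis :: "int \<Rightarrow> ('n::finite, 'k::field) mpoly set"
  where "mbasis d = (\<lambda>u. single u 1) ` mons d"

lemma inj_single_1: "inj_on (\<lambda>u. single u (1 :: 'k::field)) A"
  by (auto simp: inj_on_def) (metis lookup_single_eq lookup_single_not_eq zero_neq_one)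

lemma card_mbasis: "card (mbasis d :: ('n::finite, 'k::field) mpoly set) = card (mons d :: ('n \<Rightarrow>\<^sub>0 nat) set)"
  unfolding mbasis_def by (rule card_image[OF inj_single_1])

lemma finite_mbasis: "finite (mbasis d)"
  by (simp add: mbasis_def finite_mons)

lemma span_mbasis: "pvs.span (mbasis d :: ('n::finite, 'k::field) mpoly set) = forms d"
proof
  show "pvs.span (mbasis d) \<subseteq> (forms d :: ('n, 'k) mpoly set)"
    by (rule pvs.span_minimal[OF _ subspace_forms]) (auto simp: mbasis_def mons_def intro: forms_single)
  show "forms d \<subseteq> pvs.span (mbasis d :: ('n, 'k) mpoly set)"
  proof
    fix f :: "('n, 'k) mpoly" assume f: "f \<in> forms d"
    have "(\<Sum>u\<in>keys f. pscale (lookup f u) (single u 1)) \<in> pvs.span (mbasis d)"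
      using f by (intro pvs.span_sum pvs.span_scale pvs.span_base) (auto simp: mbasis_def mons_def forms_iff in_keys_iff)
    then show "f \<in> pvs.span (mbasis d)" using monomial_span[OF f] by (simp add: pscale_def)
  qed
qed

lemma independent_mbasis: "pvs.independent (mbasis d :: ('n::finite, 'k::field) mpoly set)"
proof (rule pvs.independent_if_scalars_zero[OF finite_mbasis])
  fix c :: "('n, 'k) mpoly \<Rightarrow> 'k" and x :: "('n, 'k) mpoly"
  assume 0: "(\<Sum>x\<in>mbasis d. pscale (c x) x) = 0" and x: "x \<in> mbasis d"
  then obtain u where u: "x = single u 1" "u \<in> mons d" by (auto simp: mbasis_def)
  have "(\<Sum>v\<in>mons d. pscale (c (single v 1)) (single v 1)) = 0"
    using 0 unfolding mbasis_def by (simp add: sum.reindex[OF inj_single_1])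
  then have "lookup (\<Sum>v\<in>mons d. pscale (c (single v 1)) (single v 1)) u = 0"
    by simp
  then show "c x = 0"
    using u(2) by (simp add: lookup_sum pscale_def lookup_pconst_mult lookup_single when_def if_distrib[of "\<lambda>t. _ * t"] finite_mons u(1) cong: if_cong)
qed

lemma card_basis_forms:
  fixes B :: "('n::finite, 'k::field) mpoly set"
  assumes "pvs.independent B" "B \<subseteq> forms d" "forms d \<subseteq> pvs.span B"
  shows "finite B" "card B = card (mons d :: ('n \<Rightarrow>\<^sub>0 nat) set)"
proof -
  have 1: "finite B \<and> card B \<le> card (mbasis d :: ('n, 'k) mpoly set)"
    using assms by (intro pvs.independent_span_bound[OF finite_mbasis]) (auto simp: span_mbasis)
  then show "finite B" by simp
  have "mbasis d \<subseteq> pvs.span B" using assms(3) span_mbasis pvs.span_base by blast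
  then have "card (mbasis d :: ('n, 'k) mpoly set) \<le> card B"
    using pvs.independent_span_bound[OF \<open>finite B\<close> independent_mbasis] by blast
  then show "card B = card (mons d :: ('n \<Rightarrow>\<^sub>0 nat) set)" using 1 by (simp add: card_mbasis)
qed

lemma dim_forms:
  "ring.dim (poly_alg :: ('n::finite, 'k::field) mpoly ring) constants (forms d) = card (mons d :: ('n \<Rightarrow>\<^sub>0 nat) set)"
proof -
  have "ring.dimension poly_alg (card (mbasis d :: ('n, 'k) mpoly set)) (id ` constants) (id ` pvs.span (mbasis d :: ('n, 'k) mpoly set))"
    by (rule dimension_class[OF poly_alg.ring_axioms _ _ finite_mbasis independent_mbasis, of _ "{0}"]) (auto simp: ring_hom_def)
  moreover have "subfield (id ` constants) (poly_alg :: ('n, 'k) mpoly ring)"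
    by (rule subfield_constants[OF poly_alg.ring_axioms]) (auto simp: ring_hom_def)
  ultimately show ?thesis
    using poly_alg.dimI[of "id ` constants"] by (simp add: span_mbasis card_mbasis over_def)
qed

lemma single_mult_eq_0: "single u 1 * f = 0 \<Longrightarrow> f = 0"
  for f :: "('n::finite, 'k::field) mpoly"
proof (rule poly_mapping_eqI)
  fix v assume "single u 1 * f = 0"
  then show "lookup f v = lookup 0 v"
    using lookup_single_mult[of u 1 f v] by simp
qed

text \<open>Multiplication by a power of one variable is injective on monomials.\<close>

lemma card_mons_mono:
  assumes "d \<le> e" "0 \<le> d"
  shows "card (mons d :: ('n::finite \<Rightarrow>\<^sub>0 nat) set) \<le> card (mons e :: ('n \<Rightarrow>\<^sub>0 nat) set)"
proof (rule card_inj_on_le[OF _ _ finite_mons])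
  let ?s = "\<lambda>u. u + single (undefined :: 'n) (nat (e - d))"
  show "inj_on ?s (mons d)" by (auto simp: inj_on_def)
  show "?s ` mons d \<subseteq> mons e" using assms by (auto simp: mons_def mdeg_add)
qed

context graded_ideal
begin

lemma quot_constants_eq: "quot_constants I = cls ` constants"
  by (simp add: quot_constants_def cls_def)

lemma subfield_quot: "subfield (quot_constants I) (quot_alg I)"
  unfolding quot_constants_eq
proof (rule subfield_constants[OF _ cls_hom])
  show "ring (quot_alg I)" using cring_quot by (simp add: cring.axioms(1))
  show "\<one>\<^bsub>quot_alg I\<^esub> \<noteq> \<zero>\<^bsub>quot_alg I\<^esub>"
    using I_max[of 1] by (auto simp: cls_one cls_zero cls_eq_iff)
qed

lemma subspace_I: "pvs.subspace (I \<inter> forms d)"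
  by (auto simp: pvs.subspace_def pscale_def intro: I_0 I_add I_mult forms_add pscale_forms[unfolded pscale_def])

text \<open>A basis \<open>C'\<close> of the degree \<open>d\<close> part of \<open>I\<close> is
  extended by \<open>B\<close> to a basis of all forms; then \<open>B\<close> maps to a basis of the
  component of the quotient. All comparisons of dimensions go through these cardinalities.\<close>

lemma adapted_basis:
  obtains B C' where "finite B" "finite C'" "B \<inter> C' = {}" "pvs.independent (B \<union> C')" "B \<subseteq> forms d"
    "C' \<subseteq> I \<inter> forms d" "I \<inter> forms d \<subseteq> pvs.span C'" "forms d \<subseteq> pvs.span (B \<union> C')"
    "pvs.span B \<inter> I \<subseteq> {0}"
    "card B = ring.dim (quot_alg I) (quot_constants I) (quot_forms I d)"
    "card B + card C' = card (mons d :: ('n \<Rightarrow>\<^sub>0 nat) set)"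
proof -
  obtain C' where C': "C' \<subseteq> I \<inter> forms d" "pvs.independent C'" "I \<inter> forms d \<subseteq> pvs.span C'"
    by (rule pvs.maximal_independent_subset)
  obtain B' where B': "C' \<subseteq> B'" "B' \<subseteq> forms d" "pvs.independent B'" "forms d \<subseteq> pvs.span B'"
    using pvs.maximal_independent_subset_extend[of C' "forms d"] C' by blast
  define B where "B = B' - C'"
  have B: "B \<union> C' = B'" "B \<inter> C' = {}" using B' by (auto simp: B_def)
  have fin: "finite B'" "card B' = card (mons d :: ('n \<Rightarrow>\<^sub>0 nat) set)"
    using card_basis_forms[OF B'(3,2,4)] by auto
  have finBC: "finite B" "finite C'" using fin B(1) by auto
  have spanB: "pvs.span B \<subseteq> forms d"
    using B' by (intro pvs.span_minimal subspace_forms) (auto simp: B_def)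
  have BI: "pvs.span B \<inter> I \<subseteq> {0}"
  proof
    fix x assume x: "x \<in> pvs.span B \<inter> I"
    then have "x \<in> pvs.span C'" using spanB C' by blast
    then show "x \<in> {0}" using pvs.span_Int_trivial[of B C' x] B B'(3) x by auto
  qed
  have indB: "pvs.independent B" using B'(3) by (rule pvs.independent_mono) (auto simp: B_def)
  have ring: "ring (quot_alg I)" using cring_quot by (simp add: cring.axioms(1))
  have "ring.dimension (quot_alg I) (card B) (cls ` constants) (cls ` pvs.span B)"
    by (rule dimension_class[OF ring cls_hom _ finBC(1) indB BI]) (simp add: cls_eq_iff)
  moreover have "cls ` pvs.span B = quot_forms I d"
    unfolding quot_forms_eq
  proof
    show "cls ` pvs.span B \<subseteq> cls ` forms d" using spanB by blast
    show "cls ` forms d \<subseteq> cls ` pvs.span B"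
    proof
      fix t assume "t \<in> cls ` forms d"
      then obtain f where f: "t = cls f" "f \<in> forms d" by blast
      then obtain x y where xy: "f = x + y" "x \<in> pvs.span B" "y \<in> pvs.span C'"
        using B'(4) B(1) by (auto simp: pvs.span_Un[of B C', symmetric] dest!: subsetD)
          (smt (verit) mem_Collect_eq pvs.span_Un)
      have "y \<in> I" using xy(3) pvs.span_minimal[OF C'(1) subspace_I] by blast
      then have "cls f = cls x" by (simp add: cls_eq_iff xy(1))
      then show "t \<in> cls ` pvs.span B" using f xy by blast
    qed
  qed
  ultimately have "card B = ring.dim (quot_alg I) (quot_constants I) (quot_forms I d)"
    using ring.dimI[OF ring subfield_quot] by (simp add: quot_constants_eq over_def)
  moreover have "card B + card C' = card (mons d :: ('n \<Rightarrow>\<^sub>0 nat) set)"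
    using card_Un_disjoint[OF finBC B(2)] B(1) fin by simp
  ultimately show ?thesis
    using that[OF finBC B(2) _ _ C'(1) C'(3)] B B'(2-4) BI by auto
qed

end

section \<open>Compressed level algebras\<close>

interpretation pvp: vector_space_pair pscale pscale
  by unfold_locales

lemma linear_pscale_fscaleI:
  assumes "\<And>a b. f (a + b) = f a + f b" "\<And>c a. f (pscale c a) = fscale c (f a)"
  shows "Vector_Spaces.linear pscale fscale f"
  using assms pvs.vector_space_axioms fvs.vector_space_axioms unfolding Vector_Spaces.linear_iff by blast

context graded_ideal
begin

context
  fixes \<rho> :: int and s :: nat
  assumes level: "level I \<rho> s"
    and hilbert: "\<And>d. ring.dim (quot_alg I) (quot_constants I) (quot_forms I d)
         = min (card (mons d :: ('n \<Rightarrow>\<^sub>0 nat) set)) (s * card (mons (\<rho> - d) :: ('n \<Rightarrow>\<^sub>0 nat) set))"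
begin

text \<open>There are no monomials of the negative degree \<open>\<rho> - d\<close>, so the Hilbert
  function vanishes there.\<close>

lemma level_top: "d > \<rho> \<Longrightarrow> forms d \<subseteq> I"
proof -
  assume d: "d > \<rho>"
  obtain B C' :: "('n, 'k) mpoly set" where B: "finite B" "forms d \<subseteq> pvs.span (B \<union> C')" "C' \<subseteq> I \<inter> forms d"
    "card B = ring.dim (quot_alg I) (quot_constants I) (quot_forms I d)"
    using adapted_basis[of d] by metis
  have "mons (\<rho> - d) = ({} :: ('n \<Rightarrow>\<^sub>0 nat) set)" using d by (auto simp: mons_def)
  then have "B = {}" using B(1,4) hilbert[of d] by simp
  then have "forms d \<subseteq> pvs.span C'" using B(2) by simp
  also have "\<dots> \<subseteq> I \<inter> forms d" by (rule pvs.span_minimal[OF B(3) subspace_I])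
  finally show "forms d \<subseteq> I" by blast
qed

text \<open>The Hilbert function is nonzero in degree \<open>0\<close> because \<open>1\<close> is
  not in \<open>I\<close>.\<close>

lemma level_s: "1 \<le> s"
proof -
  obtain B C' :: "('n, 'k) mpoly set" where B: "finite B" "forms 0 \<subseteq> pvs.span (B \<union> C')" "C' \<subseteq> I \<inter> forms 0"
    "card B = ring.dim (quot_alg I) (quot_constants I) (quot_forms I 0)"
    using adapted_basis[of 0] by metis
  have "B \<noteq> {}"
  proof
    assume "B = {}"
    then have "forms 0 \<subseteq> pvs.span C'" using B(2) by simp
    also have "\<dots> \<subseteq> I \<inter> forms 0" by (rule pvs.span_minimal[OF B(3) subspace_I])
    finally have "pconst 1 \<in> I" using forms_pconst[of 1] by blast
    then show False using I_max[of "1"] by simp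
  qed
  then have "card B \<noteq> 0" using B(1) by simp
  then have "s * card (mons \<rho> :: ('n \<Rightarrow>\<^sub>0 nat) set) \<noteq> 0"
    unfolding B(4) hilbert diff_0_right by (metis min_0R)
  then show "1 \<le> s" by (simp add: Suc_le_eq)
qed

lemma socle_mem:
  assumes "\<And>l. pvar l * f \<in> I"
  shows "cls f \<in> socle (quot_alg I) (quot_forms I)"
proof -
  have "g * f \<in> I" if "lookup g 0 = 0" for g
  proof -
    obtain h where "g = (\<Sum>i\<in>UNIV. pvar i * h i)" using max_ideal_decomp[OF \<open>lookup g 0 = 0\<close>] by blast
    then have "g * f = (\<Sum>i\<in>UNIV. h i * (pvar i * f))" by (simp add: sum_distrib_left mult_ac)
    also have "\<dots> \<in> I" by (rule I_sum, rule I_mult, rule assms)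
    finally show ?thesis .
  qed
  then show ?thesis
    by (auto simp: socle_def irrelevant_eq carrier_quot cls_mult cls_zero cls_eq_iff)
qed

lemma level_socle: "socle (quot_alg I) (quot_forms I) = quot_forms I \<rho>"
proof
  show "socle (quot_alg I) (quot_forms I) \<subseteq> quot_forms I \<rho>" using level by (simp add: level_def)
  show "quot_forms I \<rho> \<subseteq> socle (quot_alg I) (quot_forms I)"
  proof
    fix t assume "t \<in> quot_forms I \<rho>"
    then obtain f where f: "t = cls f" "f \<in> forms \<rho>" by (auto simp: quot_forms_eq)
    have "pvar l * f \<in> I" for l
      using level_top[of "\<rho> + 1"] forms_mult_eq[OF forms_pvar f(2), of "\<rho> + 1"] by auto
    then show "t \<in> socle (quot_alg I) (quot_forms I)" unfolding f(1) by (rule socle_mem)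
  qed
qed

lemma level_dim_rho: "ring.dim (quot_alg I) (quot_constants I) (quot_forms I \<rho>) = s"
proof -
  have "ring (quot_alg I)" using cring_quot by (simp add: cring.axioms(1))
  moreover have "ring.dimension (quot_alg I) s (quot_constants I) (quot_forms I \<rho>)"
    using level unfolding level_def level_socle by simp
  ultimately show ?thesis using ring.dimI[OF _ subfield_quot] by (simp add: over_def)
qed

text \<open>A form of degree below \<open>\<rho>\<close> that all variables send into
  \<open>I\<close> has its class in the socle, hence is congruent to a form of degree
  \<open>\<rho>\<close>; comparing components puts it into \<open>I\<close>. Induction on
  \<open>\<rho> - d\<close> reduces monomials to variables.\<close>

lemma level_inj:
  assumes "d \<le> \<rho>" "f \<in> forms d" "\<And>u. int (mdeg u) = \<rho> - d \<Longrightarrow> single u 1 * f \<in> I"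
  shows "f \<in> I"
  using assms
proof (induction "nat (\<rho> - d)" arbitrary: d f)
  case 0
  then have "single 0 1 * f \<in> I" by (intro 0(4)) auto
  then show ?case by simp
next
  case (Suc k)
  have "pvar l * f \<in> I" for l
  proof (rule Suc(1))
    show "k = nat (\<rho> - (d + 1))" "d + 1 \<le> \<rho>" using Suc(2) by auto
    show "pvar l * f \<in> forms (d + 1)" using Suc(4) by (intro forms_mult_eq[OF forms_pvar]) auto
    fix u :: "'n \<Rightarrow>\<^sub>0 nat" assume u: "int (mdeg u) = \<rho> - (d + 1)"
    have "single u 1 * (pvar l * f) = single (u + single l 1) 1 * f"
      by (simp add: pvar_def mult.assoc[symmetric] mult_single)
    also have "\<dots> \<in> I" using u by (intro Suc(5)) (simp add: mdeg_add)
    finally show "single u 1 * (pvar l * f) \<in> I" .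
  qed
  then have "cls f \<in> quot_forms I \<rho>" using socle_mem level_socle by blast
  then obtain g where g: "f - g \<in> I" "g \<in> forms \<rho>" by (auto simp: quot_forms_eq cls_eq_iff)
  have "hcomp d (f - g) \<in> I" using g(1) by (rule I_hcomp)
  moreover have "d \<noteq> \<rho>" using Suc(2) by auto
  ultimately show ?case using g(2) Suc(4) by (simp add: hcomp_diff hcomp_eq hcomp_eq_0)
qed

section \<open>The Hilbert function from the initial degree on\<close>

context
  fixes \<tau> :: int and f0 :: "('n, 'k) mpoly"
  assumes f0: "f0 \<in> I" "f0 \<in> forms \<tau>" "f0 \<noteq> 0"
begin

lemma tau_nonneg: "0 \<le> \<tau>"
  using forms_neg[OF f0(2)] f0(3) by (meson not_le)

text \<open>Monomial multiples of \<open>f0\<close> are nonzero forms of \<open>I\<close> in every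
  such degree; so the minimum in the Hilbert function must be its second term.\<close>

lemma card_less: "\<tau> \<le> d \<Longrightarrow>
  ring.dim (quot_alg I) (quot_constants I) (quot_forms I d) < card (mons d :: ('n \<Rightarrow>\<^sub>0 nat) set)"
proof -
  assume d: "\<tau> \<le> d"
  obtain B C' :: "('n, 'k) mpoly set" where B: "I \<inter> forms d \<subseteq> pvs.span C'" "finite C'"
    "card B = ring.dim (quot_alg I) (quot_constants I) (quot_forms I d)"
    "card B + card C' = card (mons d :: ('n \<Rightarrow>\<^sub>0 nat) set)"
    by (rule adapted_basis[of d], rule that, assumption+)
  let ?u = "single (undefined :: 'n) (nat (d - \<tau>))"
  have "single ?u 1 * f0 \<in> forms d"
    using d by (intro forms_mult_eq[OF forms_single[OF refl] f0(2)]) auto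
  moreover have "single ?u 1 * f0 \<in> I" using f0(1) by (rule I_mult)
  moreover have "single ?u 1 * f0 \<noteq> 0" using single_mult_eq_0 f0(3) by blast
  ultimately have "C' \<noteq> {}" using B(1) by auto
  then have "card C' > 0" using B(2) by (simp add: card_gt_0_iff)
  then show ?thesis using B(3,4) by simp
qed

lemma dim_quot: "\<tau> \<le> d \<Longrightarrow>
  ring.dim (quot_alg I) (quot_constants I) (quot_forms I d) = s * card (mons (\<rho> - d) :: ('n \<Rightarrow>\<^sub>0 nat) set)"
proof -
  assume "\<tau> \<le> d"
  then have "min (card (mons d :: ('n \<Rightarrow>\<^sub>0 nat) set)) (s * card (mons (\<rho> - d) :: ('n \<Rightarrow>\<^sub>0 nat) set)) < card (mons d :: ('n \<Rightarrow>\<^sub>0 nat) set)"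
    using card_less unfolding hilbert by blast
  moreover have "min a b < a \<Longrightarrow> min a b = b" for a b :: nat by (auto simp: min_def split: if_splits)
  ultimately show ?thesis unfolding hilbert by blast
qed

text \<open>If \<open>\<rho> - \<tau>\<close> were at least \<open>\<tau>\<close>, the second term
  of the minimum in degree \<open>\<tau>\<close> would be at least the number of monomials, leaving
  no room for \<open>f0\<close>.\<close>

lemma level_rho_le: "\<rho> \<le> 2 * \<tau> - 1"
proof (rule ccontr)
  assume "\<not> \<rho> \<le> 2 * \<tau> - 1"
  then have "card (mons \<tau> :: ('n \<Rightarrow>\<^sub>0 nat) set) \<le> card (mons (\<rho> - \<tau>) :: ('n \<Rightarrow>\<^sub>0 nat) set)"
    using tau_nonneg by (intro card_mons_mono) auto
  also have "\<dots> \<le> s * card (mons (\<rho> - \<tau>) :: ('n \<Rightarrow>\<^sub>0 nat) set)" using level_s by simp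
  also have "\<dots> < card (mons \<tau> :: ('n \<Rightarrow>\<^sub>0 nat) set)"
    using card_less[OF order_refl] unfolding dim_quot[OF order_refl] .
  finally show False by simp
qed

text \<open>Multiplication by monomials is injective by \<open>level_inj\<close>, and both sides
  have dimension \<open>s * card (mons (\<rho> - d))\<close>, the source because of compressedness.
  Complements of \<open>I\<close> replace the quotients, so that the linear algebra stays among
  polynomials.\<close>

lemma level_surj:
  assumes d: "\<tau> \<le> d" "d \<le> \<rho>" and g: "\<And>u. int (mdeg u) = \<rho> - d \<Longrightarrow> g u \<in> forms \<rho>"
  shows "\<exists>f\<in>forms d. \<forall>u. int (mdeg u) = \<rho> - d \<longrightarrow> single u 1 * f - g u \<in> I"
proof -
  obtain P P' where P: "finite P" "finite P'" "P \<inter> P' = {}" "pvs.independent (P \<union> P')" "P \<subseteq> forms \<rho>"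
    "P' \<subseteq> I \<inter> forms \<rho>" "forms \<rho> \<subseteq> pvs.span (P \<union> P')" "pvs.span P \<inter> I \<subseteq> {0}"
    "card P = ring.dim (quot_alg I) (quot_constants I) (quot_forms I \<rho>)"
    using adapted_basis[of \<rho>] by metis
  obtain B B' where B: "finite B" "pvs.independent (B \<union> B')" "B \<subseteq> forms d" "pvs.span B \<inter> I \<subseteq> {0}"
    "card B = ring.dim (quot_alg I) (quot_constants I) (quot_forms I d)"
    using adapted_basis[of d] by metis
  \<comment> \<open>The projection of forms of degree \<open>\<rho>\<close> to the span of
    \<open>P\<close> along the forms in \<open>I\<close>; it turns congruences into
    equations.\<close>
  define nf where "nf = pvp.construct (P \<union> P') (\<lambda>b. if b \<in> P then b else 0)"
  have lin_nf: "Vector_Spaces.linear pscale pscale nf"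
    unfolding nf_def by (rule pvp.linear_construct[OF P(4)])
  interpret nf: Vector_Spaces.linear pscale pscale nf by (rule lin_nf)
  have nf_P: "nf b = b" if "b \<in> P" for b
    unfolding nf_def using that by (subst pvp.construct_basis[OF P(4)]) auto
  have nf_P': "nf b = 0" if "b \<in> P'" for b
    unfolding nf_def using that P(3) by (subst pvp.construct_basis[OF P(4)]) auto
  have nf_spanP: "nf x = x" if "x \<in> pvs.span P" for x
    using pvp.linear_eq_on[OF lin_nf pvs.linear_id that] nf_P by simp
  have nf_spanP': "nf x = 0" if "x \<in> pvs.span P'" for x
    using pvp.linear_eq_on[OF lin_nf pvp.linear_zero that] nf_P' by simp
  have split: "\<exists>x\<in>pvs.span P. \<exists>y\<in>pvs.span P'. y \<in> I \<and> f = x + y" if "f \<in> forms \<rho>" for f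
  proof -
    have "f \<in> pvs.span (P \<union> P')" using P(7) that by blast
    then obtain x y where "f = x + y" "x \<in> pvs.span P" "y \<in> pvs.span P'" unfolding pvs.span_Un by blast
    moreover have "y \<in> I" using \<open>y \<in> pvs.span P'\<close> pvs.span_minimal[OF P(6) subspace_I] by blast
    ultimately show ?thesis by blast
  qed
  have nf_mod: "f - nf f \<in> I" and nf_in: "nf f \<in> pvs.span P" if fr: "f \<in> forms \<rho>" for f
  proof -
    obtain x y where "x \<in> pvs.span P" "y \<in> pvs.span P'" "y \<in> I" "f = x + y" using split[OF fr] by blast
    then show "f - nf f \<in> I" "nf f \<in> pvs.span P" by (simp_all add: nf.add nf_spanP nf_spanP')
  qed
  define M where "M = (mons (\<rho> - d) :: ('n \<Rightarrow>\<^sub>0 nat) set)"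
  have finM: "finite M" by (simp add: M_def finite_mons)
  have M_forms: "single u 1 * f \<in> forms \<rho>" if "u \<in> M" "f \<in> forms d" for u f
    using that by (intro forms_mult_eq[OF forms_single[OF refl]]) (auto simp: M_def mons_def)
  define \<Phi> where "\<Phi> f = (\<lambda>u. if u \<in> M then nf (single u 1 * f) else 0)" for f
  have lin_\<Phi>: "Vector_Spaces.linear pscale fscale \<Phi>"
  proof (rule linear_pscale_fscaleI)
    fix a b :: "('n, 'k) mpoly" and c :: 'k
    show "\<Phi> (a + b) = \<Phi> a + \<Phi> b" by (auto simp: \<Phi>_def fun_eq_iff distrib_left nf.add)
    have "nf (single u 1 * pscale c a) = pscale c (nf (single u 1 * a))" for u
      using nf.scale[of c "single u 1 * a"] by (simp add: pscale_def mult.left_commute)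
    then show "\<Phi> (pscale c a) = fscale c (\<Phi> a)" by (auto simp: \<Phi>_def fun_eq_iff fscale_def pscale_def)
  qed
  interpret \<Phi>: Vector_Spaces.linear pscale fscale \<Phi> by (rule lin_\<Phi>)
  have spanB: "pvs.span B \<subseteq> forms d" by (rule pvs.span_minimal[OF B(3) subspace_forms])
  have \<Phi>_0: "f = 0" if f: "f \<in> pvs.span B" "\<Phi> f = 0" for f
  proof -
    have fd: "f \<in> forms d" using f spanB by blast
    have "single u 1 * f \<in> I" if "int (mdeg u) = \<rho> - d" for u
    proof -
      have u: "u \<in> M" using that by (simp add: M_def mons_def)
      then have "nf (single u 1 * f) = 0" using fun_cong[OF f(2), of u] by (simp add: \<Phi>_def)
      then show ?thesis using nf_mod[OF M_forms[OF u fd]] by simp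
    qed
    then have "f \<in> I" by (rule level_inj[OF d(2) fd])
    then show ?thesis using f(1) B(4) by blast
  qed
  have inj: "inj_on \<Phi> (pvs.span B)"
    using \<Phi>_0 by (auto simp: \<Phi>.inj_on_iff_eq_0[OF pvs.subspace_span])
  have indB: "pvs.independent B" using B(2) by (rule pvs.independent_mono) auto
  have ind\<Phi>: "fvs.independent (\<Phi> ` B)" by (rule \<Phi>.independent_injective_image[OF indB inj])
  have card\<Phi>: "card (\<Phi> ` B) = card B"
    by (rule card_image[OF inj_on_subset[OF inj]]) (auto intro: pvs.span_base)
  \<comment> \<open>Functions supported at one monomial with value in \<open>P\<close>: they span
    all functions from \<open>M\<close> to the complement, and there are at most
    \<open>card M * s\<close> of them.\<close>
  define T where "T = (\<lambda>(u, b) v. if v = u then b else (0 :: ('n, 'k) mpoly)) ` (M \<times> P)"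
  have finT: "finite T" by (simp add: T_def finM P(1))
  have "card T \<le> card M * card P"
    unfolding T_def using card_image_le[of "M \<times> P"] finM P(1) by (simp add: card_cartesian_product)
  also have "\<dots> = card (\<Phi> ` B)"
    unfolding card\<Phi> B(5) dim_quot[OF d(1)] P(9) level_dim_rho by (simp add: M_def)
  finally have cardT: "card T \<le> card (\<Phi> ` B)" .
  have in_T: "h \<in> fvs.span T" if h: "\<And>u. u \<in> M \<Longrightarrow> h u \<in> pvs.span P" "\<And>u. u \<notin> M \<Longrightarrow> h u = 0" for h
  proof -
    have single: "(\<lambda>v. if v = u then x else 0) \<in> fvs.span T" if "u \<in> M" "x \<in> pvs.span P" for u x
    proof -
      have lin: "Vector_Spaces.linear pscale fscale (\<lambda>x v. if v = u then x else (0 :: ('n, 'k) mpoly))"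
        by (rule linear_pscale_fscaleI) (auto simp: fun_eq_iff fscale_def pscale_def)
      interpret e: Vector_Spaces.linear pscale fscale "\<lambda>x v. if v = u then x else (0 :: ('n, 'k) mpoly)" by (rule lin)
      have "(\<lambda>v. if v = u then x else 0) \<in> (\<lambda>x v. if v = u then x else 0) ` pvs.span P" using that by blast
      also have "\<dots> = fvs.span ((\<lambda>x v. if v = u then x else 0) ` P)" by (rule e.span_image[symmetric])
      also have "\<dots> \<subseteq> fvs.span T"
        using that(1) by (intro fvs.span_mono) (auto simp: T_def intro!: image_eqI[of _ _ "(u, _)"])
      finally show ?thesis .
    qed
    have "h = (\<Sum>u\<in>M. (\<lambda>v. if v = u then h u else 0))"
    proof
      fix v
      show "h v = (\<Sum>u\<in>M. (\<lambda>v. if v = u then h u else 0)) v"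
        using h(2)[of v] finM by (simp add: sum_fun_apply)
    qed
    also have "\<dots> \<in> fvs.span T" using single h(1) by (intro fvs.span_sum) auto
    finally show ?thesis .
  qed
  have "\<Phi> ` B \<subseteq> fvs.span T"
  proof
    fix y assume "y \<in> \<Phi> ` B"
    then obtain b where "y = \<Phi> b" "b \<in> forms d" using B(3) by blast
    then show "y \<in> fvs.span T" using nf_in M_forms by (intro in_T) (auto simp: \<Phi>_def)
  qed
  then have T\<Phi>: "fvs.span T \<subseteq> fvs.span (\<Phi> ` B)"
    by (rule fvs.span_subset_of_card_le[OF ind\<Phi> _ finT cardT])
  define h where "h = (\<lambda>u. if u \<in> M then nf (g u) else 0)"
  have gM: "g u \<in> forms \<rho>" if "u \<in> M" for u using g that by (simp add: M_def mons_def)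
  have "h \<in> fvs.span T" using nf_in gM by (intro in_T) (auto simp: h_def)
  then have "h \<in> \<Phi> ` pvs.span B" using T\<Phi> by (auto simp: \<Phi>.span_image)
  then obtain f where f: "f \<in> pvs.span B" "h = \<Phi> f" by blast
  have fd: "f \<in> forms d" using f spanB by blast
  have "single u 1 * f - g u \<in> I" if "int (mdeg u) = \<rho> - d" for u
  proof -
    have u: "u \<in> M" using that by (simp add: M_def mons_def)
    have "nf (g u) = nf (single u 1 * f)" using fun_cong[OF f(2), of u] u by (simp add: h_def \<Phi>_def)
    then show ?thesis
      using I_diff[OF nf_mod[OF M_forms[OF u fd]] nf_mod[OF gM[OF u]]] by simp
  qed
  then show ?thesis using fd by blast
qed

end

end

end

section \<open>Minimal generators\<close>

text \<open>The polynomial ring as a module over itself: ideals are its submodules, and ideal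
  generation becomes \<open>span\<close>.\<close>

interpretation pmod: Modules.module "(*) :: ('n::finite, 'k::field) mpoly \<Rightarrow> _"
  by unfold_locales (auto simp: algebra_simps)

declare pmod.scale_scale [simp del] \<comment> \<open>as a rewrite rule, the reverse of \<open>mult.assoc\<close>\<close>

lemma ideal_iff_subspace: "ideal I poly_alg \<longleftrightarrow> pmod.subspace I"
  by (auto simp: ideal_poly_alg_iff pmod.subspace_def)

lemma genideal_eq_span: "Idl\<^bsub>poly_alg\<^esub> G = pmod.span G"
proof
  show "Idl\<^bsub>poly_alg\<^esub> G \<subseteq> pmod.span G"
    by (rule poly_alg.genideal_minimal) (auto simp: ideal_iff_subspace intro: pmod.span_base)
  show "pmod.span G \<subseteq> Idl\<^bsub>poly_alg\<^esub> G"
    using poly_alg.genideal_ideal[of G] poly_alg.genideal_self[of G]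
    by (intro pmod.span_minimal) (auto simp: ideal_iff_subspace)
qed

lemma span_homogeneous:
  assumes "G \<subseteq> (\<Union>d. forms d)" "f \<in> pmod.span G"
  obtains t r e where "finite t" "t \<subseteq> G" "\<And>g. g \<in> t \<Longrightarrow> g \<in> forms (e g)" "f = (\<Sum>g\<in>t. r g * g)"
proof -
  obtain t r where t: "finite t" "t \<subseteq> G" "f = (\<Sum>g\<in>t. r g * g)"
    using assms(2) unfolding pmod.span_explicit by blast
  have "\<forall>g\<in>t. \<exists>d. g \<in> forms d" using t(2) assms(1) by blast
  then obtain e where "\<forall>g\<in>t. g \<in> forms (e g)" by metis
  then show ?thesis using that t by blast
qed

lemma hcomp_combination:
  assumes "\<And>g. g \<in> t \<Longrightarrow> g \<in> forms (e g)"
  shows "hcomp d (\<Sum>g\<in>t. r g * g) = (\<Sum>g\<in>t. hcomp (d - e g) (r g) * g)"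
  unfolding hcomp_sum
proof (rule sum.cong[OF refl])
  fix g assume "g \<in> t"
  then show "hcomp d (r g * g) = hcomp (d - e g) (r g) * g"
    using hcomp_mult[OF assms, of g d "r g"] by (simp add: mult.commute)
qed

lemma gideal_homogeneous:
  assumes "homogeneous_ideal poly_alg forms I"
  shows "gideal I"
proof -
  obtain G where G: "G \<subseteq> (\<Union>d. forms d)" "I = pmod.span G"
    using assms by (auto simp: homogeneous_ideal_def genideal_eq_span)
  have "hcomp d f \<in> pmod.span G" if f: "f \<in> pmod.span G" for d f
  proof -
    obtain t r e where t: "finite t" "t \<subseteq> G" "\<And>g. g \<in> t \<Longrightarrow> g \<in> forms (e g)" "f = (\<Sum>g\<in>t. r g * g)"
      by (rule span_homogeneous[OF G(1) f]) (rule that)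
    have "hcomp d f = (\<Sum>g\<in>t. hcomp (d - e g) (r g) * g)"
      unfolding t(4) by (rule hcomp_combination) (rule t(3))
    also have "\<dots> \<in> pmod.span G"
      using t(2) by (intro pmod.span_sum pmod.span_scale pmod.span_base) auto
    finally show ?thesis .
  qed
  then show ?thesis
    unfolding gideal_def G(2) by (auto intro: pmod.span_add pmod.span_scale pmod.span_zero)
qed

lemma variables_const: "f \<in> Idl\<^bsub>poly_alg\<^esub> variables \<Longrightarrow> lookup f 0 = 0"
proof -
  have "Idl\<^bsub>poly_alg\<^esub> (variables :: ('a, 'b) mpoly set) \<subseteq> {f. lookup f 0 = 0}"
  proof (rule poly_alg.genideal_minimal)
    show "ideal {f :: ('a, 'b) mpoly. lookup f 0 = 0} poly_alg"
      by (auto simp: ideal_poly_alg_iff lookup_add const_mult)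
    show "variables \<subseteq> {f :: ('a, 'b) mpoly. lookup f 0 = 0}"
      using const_forms[OF forms_pvar] by (auto simp: variables_def pvar_def)
  qed
  then show "f \<in> Idl\<^bsub>poly_alg\<^esub> variables \<Longrightarrow> lookup f 0 = 0" by blast
qed

text \<open>Every monomial in a product of two polynomials without constant term is a sum of two
  nonzero exponents.\<close>

lemma max_ideal_square:
  assumes "f \<in> ideal_prod poly_alg (Idl\<^bsub>poly_alg\<^esub> variables) (Idl\<^bsub>poly_alg\<^esub> variables)" "mdeg u \<le> 1"
  shows "lookup f u = 0"
  using assms(1)
proof (induction f rule: ideal_prod.induct)
  case (prod f g)
  have "u \<notin> keys (f * g)"
  proof
    assume "u \<in> keys (f * g)"
    then obtain a b where ab: "u = a + b" "a \<in> keys f" "b \<in> keys g"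
      using keys_mult[of f g] by blast
    then have "a \<noteq> 0" "b \<noteq> 0" using variables_const[OF prod(1)] variables_const[OF prod(2)] by (auto simp: in_keys_iff)
    then have "mdeg a \<noteq> 0" "mdeg b \<noteq> 0" by (simp_all add: mdeg_eq_0_iff)
    then show False using assms(2) ab(1) by (simp add: mdeg_add)
  qed
  then show ?case by (simp add: in_keys_iff)
qed (simp add: lookup_add)

lemma span_Diff_redundant:
  assumes "g \<in> pmod.span (G - {g})"
  shows "pmod.span (G - {g}) = pmod.span G"
proof
  show "pmod.span (G - {g}) \<subseteq> pmod.span G" by (rule pmod.span_mono) auto
  have "h \<in> pmod.span (G - {g})" if "h \<in> G" for h
    using assms that pmod.span_base[of h "G - {g}"] by (cases "h = g") auto
  then show "pmod.span G \<subseteq> pmod.span (G - {g})" by (intro pmod.span_minimal) auto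
qed

lemma minimal_generator_nonzero:
  assumes "minimal_generating_set poly_alg forms I G" "g \<in> G"
  shows "g \<noteq> 0"
proof
  assume "g = 0"
  then have "G - {0} \<subset> G" using assms(2) by blast
  then show False
    using assms(1) span_Diff_redundant[of 0 G] pmod.span_zero[of "G - {0}"]
    unfolding minimal_generating_set_def genideal_eq_span by blast
qed

text \<open>The graded Nakayama lemma.\<close>

lemma minimal_generator_notin:
  fixes f :: "'n::finite \<Rightarrow> ('n, 'k::field) mpoly"
  assumes G: "minimal_generating_set poly_alg forms I G" and g: "g \<in> G" "g \<in> forms d"
    and f: "\<And>l. f l \<in> I" "g = (\<Sum>l\<in>UNIV. pvar l * f l)"
  shows False
proof -
  have hom: "G \<subseteq> (\<Union>d. forms d)" and I: "I = pmod.span G"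
    using G by (auto simp: minimal_generating_set_def genideal_eq_span)
  have "\<exists>t r. finite t \<and> t \<subseteq> G \<and> f l = (\<Sum>h\<in>t. r h * h)" for l
    using f(1)[of l] unfolding I pmod.span_explicit by blast
  then have "\<exists>t. \<forall>l. \<exists>r. finite (t l) \<and> t l \<subseteq> G \<and> f l = (\<Sum>h\<in>t l. r h * h)" by (intro choice allI)
  then obtain t where "\<forall>l. \<exists>r. finite (t l) \<and> t l \<subseteq> G \<and> f l = (\<Sum>h\<in>t l. r h * h)" ..
  then have "\<exists>r. \<forall>l. finite (t l) \<and> t l \<subseteq> G \<and> f l = (\<Sum>h\<in>t l. r l h * h)" by (rule choice)
  then obtain r where t: "\<And>l. finite (t l)" "\<And>l. t l \<subseteq> G" "\<And>l. f l = (\<Sum>h\<in>t l. r l h * h)" by auto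
  define T where "T = (\<Union>l. t l)"
  define c where "c l h = (if h \<in> t l then r l h else 0)" for l h
  define q where "q h = (\<Sum>l\<in>UNIV. pvar l * c l h)" for h
  have T: "finite T" "T \<subseteq> G" using t(1,2) by (auto simp: T_def)
  have fT: "f l = (\<Sum>h\<in>T. c l h * h)" for l
    unfolding t(3) using T(1) by (intro sum.mono_neutral_cong_left) (auto simp: T_def c_def)
  have "g = (\<Sum>l\<in>UNIV. pvar l * (\<Sum>h\<in>T. c l h * h))"
    using f(2) unfolding fT .
  also have "\<dots> = (\<Sum>l\<in>UNIV. \<Sum>h\<in>T. pvar l * c l h * h)"
    by (simp add: sum_distrib_left mult.assoc)
  also have "\<dots> = (\<Sum>h\<in>T. q h * h)"
    by (subst sum.swap) (simp add: q_def sum_distrib_right)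
  finally have gq: "g = (\<Sum>h\<in>T. q h * h)" .
  have q0: "lookup (q h) 0 = 0" for h
    by (simp add: q_def lookup_sum const_mult const_forms[OF forms_pvar])
  obtain e where e: "\<And>h. h \<in> T \<Longrightarrow> h \<in> forms (e h)"
    using T(2) hom by (metis UN_E subsetD)
  have "g = hcomp d (\<Sum>h\<in>T. q h * h)" using hcomp_eq[OF g(2)] gq by simp
  also have "\<dots> = (\<Sum>h\<in>T. hcomp (d - e h) (q h) * h)" by (rule hcomp_combination[OF e])
  also have "\<dots> = (\<Sum>h\<in>T - {g}. hcomp (d - e h) (q h) * h)"
  proof (rule sum.mono_neutral_right[OF T(1)])
    \<comment> \<open>In degree \<open>d\<close> the coefficient of \<open>g\<close> itself is a
      constant, and \<open>q g\<close> has none; so \<open>g\<close> is a combination of the other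
      generators.\<close>
    have "hcomp (d - e g) (q g) = 0" if "g \<in> T"
    proof -
      have "e g = d" using forms_distinct[OF e[OF that] g(2)] minimal_generator_nonzero[OF G g(1)] by blast
      then show ?thesis using forms_0_eq_pconst[OF hcomp_forms[of 0 "q g"]] q0 by (simp add: const_hcomp)
    qed
    then show "\<forall>h\<in>T - (T - {g}). hcomp (d - e h) (q h) * h = 0" by auto
  qed auto
  also have "\<dots> \<in> pmod.span (G - {g})"
    using T(2) by (intro pmod.span_sum pmod.span_scale pmod.span_base) auto
  finally have "g \<in> pmod.span (G - {g})" .
  then have "pmod.span (G - {g}) = pmod.span G" by (rule span_Diff_redundant)
  moreover have "G - {g} \<subset> G" using g(1) by blast
  ultimately show False
    using G by (auto simp: minimal_generating_set_def genideal_eq_span)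
qed

text \<open>In degree \<open>j > m\<close> each generator enters with a coefficient of positive
  degree, which is a combination of the variables.\<close>

lemma high_degree_decomp:
  fixes f :: "('n::finite, 'k::field) mpoly"
  assumes G: "minimal_generating_set poly_alg forms I G" "\<And>g d. g \<in> G \<Longrightarrow> g \<in> forms d \<Longrightarrow> d \<le> m"
    and f: "f \<in> I" "f \<in> forms j" "j > m"
  shows "\<exists>k. (\<forall>l. k l \<in> I) \<and> f = (\<Sum>l\<in>UNIV. pvar l * k l)"
proof -
  have hom: "G \<subseteq> (\<Union>d. forms d)" and I: "I = pmod.span G"
    using G by (auto simp: minimal_generating_set_def genideal_eq_span)
  obtain t r e where t: "finite t" "t \<subseteq> G" "\<And>g. g \<in> t \<Longrightarrow> g \<in> forms (e g)" "f = (\<Sum>g\<in>t. r g * g)"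
    by (rule span_homogeneous[OF hom f(1)[unfolded I]]) (rule that)
  have "\<exists>k. g \<in> t \<longrightarrow> hcomp (j - e g) (r g) = (\<Sum>l\<in>UNIV. pvar l * k l)" for g
  proof (cases "g \<in> t")
    case True
    then have "e g \<le> m" using G(2) t(2,3) by blast
    then have "lookup (hcomp (j - e g) (r g)) 0 = 0" using f(3) by (simp add: const_hcomp)
    then show ?thesis using max_ideal_decomp by blast
  qed simp
  then obtain k where k: "\<And>g. g \<in> t \<Longrightarrow> hcomp (j - e g) (r g) = (\<Sum>l\<in>UNIV. pvar l * k g l)" by metis
  have "f = (\<Sum>g\<in>t. hcomp (j - e g) (r g) * g)"
    using hcomp_eq[OF f(2)] hcomp_combination[OF t(3), where r = r and d = j] t(4) by simp
  also have "\<dots> = (\<Sum>g\<in>t. \<Sum>l\<in>UNIV. pvar l * (k g l * g))"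
    by (intro sum.cong refl) (simp add: k sum_distrib_right mult.assoc)
  also have "\<dots> = (\<Sum>l\<in>UNIV. pvar l * (\<Sum>g\<in>t. k g l * g))"
    by (subst sum.swap) (simp add: sum_distrib_left)
  finally have "f = (\<Sum>l\<in>UNIV. pvar l * (\<Sum>g\<in>t. k g l * g))" .
  moreover have "(\<Sum>g\<in>t. k g l * g) \<in> I" for l
    unfolding I using t(2) by (intro pmod.span_sum pmod.span_scale pmod.span_base) auto
  ultimately show ?thesis by (intro exI[of _ "\<lambda>l. \<Sum>g\<in>t. k g l * g"]) blast
qed

context graded_ideal
begin

text \<open>Spanning sets of \<open>I\<close> in degrees up to \<open>R + 1\<close> generate it: a
  form of higher degree is a combination of the variables with coefficients one degree lower, which
  lie in \<open>I\<close> already. A homogeneous generating set of least cardinality is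
  minimal.\<close>

lemma minimal_generating_set_exists:
  assumes top: "\<And>d. d > R \<Longrightarrow> forms d \<subseteq> I"
  shows "\<exists>G. minimal_generating_set poly_alg forms I G"
proof -
  have "\<exists>B. finite B \<and> B \<subseteq> I \<inter> forms d \<and> I \<inter> forms d \<subseteq> pvs.span B" for d
    using pvs.finite_spanning_subset[of "I \<inter> forms d" "mbasis d"] finite_mbasis span_mbasis by (metis inf_le2)
  then obtain B where B: "\<And>d. finite (B d)" "\<And>d. B d \<subseteq> I \<inter> forms d" "\<And>d. I \<inter> forms d \<subseteq> pvs.span (B d)" by metis
  define G0 where "G0 = (\<Union>d\<in>{0..R + 1}. B d)"
  have "finite G0" using B(1) by (auto simp: G0_def)
  moreover have "G0 \<subseteq> I" "G0 \<subseteq> (\<Union>d. forms d)" unfolding G0_def using B(2) by blast+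
  ultimately have G0: "finite G0" "G0 \<subseteq> I" "G0 \<subseteq> (\<Union>d. forms d)" .
  have sub_I: "pmod.subspace I"
    using ideal_I ideal_iff_subspace by blast
  have small: "f \<in> pmod.span G0" if f: "f \<in> I" "f \<in> forms d" "d \<in> {0..R + 1}" for f d
  proof -
    have "f \<in> pvs.span (B d)" using B(3) f by blast
    moreover have "pvs.subspace (pmod.span G0)"
      by (auto simp: pvs.subspace_def pscale_def intro: pmod.span_add pmod.span_scale pmod.span_zero)
    moreover have "B d \<subseteq> pmod.span G0"
      using f(3) pmod.span_superset[of G0] unfolding G0_def by blast
    ultimately show ?thesis using pvs.span_minimal by blast
  qed
  have large: "f \<in> pmod.span G0" if "f \<in> forms (R + 1 + int k)" "f \<in> I" for f k
    using that
  proof (induction k arbitrary: f)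
    case 0
    show ?case
    proof (cases "R + 1 \<ge> 0")
      case True
      then show ?thesis using 0 by (intro small[of f "R + 1"]) auto
    next
      case False
      then have "f = 0" using forms_neg[OF 0(1)] by simp
      then show ?thesis by (simp add: pmod.span_zero)
    qed
  next
    case (Suc k)
    show ?case
    proof (cases "R + 1 + int k \<ge> 0")
      case True
      then have "lookup f 0 = 0" using Suc.prems(1) by (intro const_forms[of f "R + 1 + int (Suc k)"]) auto
      then obtain h where h: "f = (\<Sum>l\<in>UNIV. pvar l * h l)"
        "\<forall>d. f \<in> forms d \<longrightarrow> (\<forall>l. h l \<in> forms (d - 1))"
        using max_ideal_decomp by blast
      have "h l \<in> forms (R + 1 + int k)" for l
        using h(2)[rule_format, OF Suc.prems(1), of l] by (simp add: algebra_simps)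
      then have "h l \<in> pmod.span G0" for l
        using top[of "R + 1 + int k"] by (intro Suc.IH) auto
      then show ?thesis unfolding h(1) by (intro pmod.span_sum pmod.span_scale) auto
    next
      \<comment> \<open>Here \<open>R\<close> is negative, so all constants would lie in
        \<open>I\<close>.\<close>
      case False
      have not_1: "1 \<notin> I" using I_max[of 1] by auto
      have "1 \<in> (forms 0 :: ('n, 'k) mpoly set)" using forms_pconst[of 1] by simp
      then show ?thesis using top[of 0] False not_1 by auto
    qed
  qed
  have "I \<subseteq> pmod.span G0"
  proof
    fix f assume f: "f \<in> I"
    obtain N where N: "f = (\<Sum>d\<in>{..<N::nat}. hcomp (int d) f)" using hcomp_decomp by blast
    have "hcomp (int d) f \<in> pmod.span G0" for d
    proof (cases "int d \<le> R + 1")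
      case True
      then show ?thesis using I_hcomp[OF f] by (intro small[of _ "int d"]) auto
    next
      case False
      then have "int d = R + 1 + int (nat (int d - R - 1))" by simp
      then show ?thesis using large[of "hcomp (int d) f" "nat (int d - R - 1)"] I_hcomp[OF f] hcomp_forms[of "int d" f] by metis
    qed
    then have "(\<Sum>d\<in>{..<N::nat}. hcomp (int d) f) \<in> pmod.span G0" by (intro pmod.span_sum)
    then show "f \<in> pmod.span G0" using N by simp
  qed
  then have "pmod.span G0 = I" using pmod.span_minimal[OF G0(2) sub_I] by blast
  then have ex: "\<exists>c G. finite G \<and> card G = c \<and> G \<subseteq> (\<Union>d. forms d) \<and> pmod.span G = I" using G0 by blast
  define c where "c = (LEAST c. \<exists>G. finite G \<and> card G = c \<and> G \<subseteq> (\<Union>d. forms d) \<and> pmod.span G = I)"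
  obtain G where G: "finite G" "card G = c" "G \<subseteq> (\<Union>d. forms d)" "pmod.span G = I"
    using LeastI_ex[OF ex] unfolding c_def by blast
  have "pmod.span H \<noteq> I" if H: "H \<subset> G" for H
  proof
    assume "pmod.span H = I"
    then have "\<exists>G. finite G \<and> card G = card H \<and> G \<subseteq> (\<Union>d. forms d) \<and> pmod.span G = I"
      using H G(1,3) finite_subset[of H G] by (intro exI[of _ H]) auto
    then have "c \<le> card H" unfolding c_def by (rule Least_le)
    then show False using psubset_card_mono[OF G(1) H] G(2) by simp
  qed
  then have "minimal_generating_set poly_alg forms I G"
    using G by (auto simp: minimal_generating_set_def genideal_eq_span)
  then show ?thesis by blast
qed

text \<open>A generator of larger degree would be a combination of the variables with coefficients
  of degree above \<open>R\<close>, hence in \<open>I\<close>, against Nakayama. The resulting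
  finiteness gives \<open>Max\<close> and \<open>Min\<close> their meaning.\<close>

lemma generator_degrees_bounds:
  assumes top: "\<And>d. d > R \<Longrightarrow> forms d \<subseteq> I" and d: "d \<in> generator_degrees poly_alg forms I"
  shows "0 \<le> d" "d \<le> max 0 (R + 1)"
proof -
  obtain G g where G: "minimal_generating_set poly_alg forms I G" and g: "g \<in> G" "g \<in> forms d"
    using d by (auto simp: generator_degrees_def)
  have "g \<noteq> 0" by (rule minimal_generator_nonzero[OF G g(1)])
  then show "0 \<le> d" using forms_neg[OF g(2)] by (meson not_le)
  show "d \<le> max 0 (R + 1)"
  proof (rule ccontr)
    assume "\<not> d \<le> max 0 (R + 1)"
    then have dR: "d > R + 1" "d > 0" by auto
    obtain h where h: "g = (\<Sum>l\<in>UNIV. pvar l * h l)" "\<forall>d. g \<in> forms d \<longrightarrow> (\<forall>l. h l \<in> forms (d - 1))"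
      using max_ideal_decomp[of g] const_forms[OF g(2)] dR by auto
    have "forms (d - 1) \<subseteq> I" using top dR by simp
    moreover have "h l \<in> forms (d - 1)" for l by (rule h(2)[rule_format, OF g(2)])
    ultimately have "h l \<in> I" for l by blast
    then show False by (rule minimal_generator_notin[OF G g _ h(1)])
  qed
qed

lemma finite_generator_degrees:
  assumes "\<And>d. d > R \<Longrightarrow> forms d \<subseteq> I"
  shows "finite (generator_degrees poly_alg forms I)"
proof (rule finite_subset)
  show "generator_degrees poly_alg forms I \<subseteq> {0..max 0 (R + 1)}"
  proof
    fix d assume d: "d \<in> generator_degrees poly_alg forms I"
    show "d \<in> {0..max 0 (R + 1)}"
      using generator_degrees_bounds(1)[OF assms d] generator_degrees_bounds(2)[OF assms d] by simp
  qed
qed simp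

text \<open>The differential of \<open>z\<close> is an element of \<open>I\<close> of degree above
  \<open>m\<close>, hence a combination of the variables with coefficients in \<open>I\<close>.
  Subtracting these coefficients leaves a cycle over the polynomial ring, where the Koszul complex
  is exact in homological degree one.\<close>

lemma Zyc_1_Bnd:
  assumes G: "minimal_generating_set poly_alg forms I G" "\<And>g d. g \<in> G \<Longrightarrow> g \<in> forms d \<Longrightarrow> d \<le> m"
    and z: "z \<in> Zyc 1" "khom e z" "e > m"
  shows "z \<in> Bnd 1"
proof -
  have f: "kd z {} \<in> I" "kd z {} \<in> forms e"
    using z(1) khom_kd[OF z(2)] by (auto simp: Zyc_def khom_def dest: spec[of _ "{}"])
  have "\<exists>k. (\<forall>l. k l \<in> I) \<and> kd z {} = (\<Sum>l\<in>UNIV. pvar l * k l)"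
    by (rule high_degree_decomp[OF G(1) _ f z(3)]) (rule G(2))
  then obtain k where k: "\<And>l. k l \<in> I" "kd z {} = (\<Sum>l\<in>UNIV. pvar l * k l)" by blast
  define y where "y s = (if card s = 1 then k (the_elem s) else 0)" for s
  have y: "y \<in> Kos 1" by (simp add: y_def Kos_def)
  have zy: "z - y \<in> Kos 1" using z(1) y by (intro gsub_diff[OF gsub_Kos]) (auto simp: Zyc_def)
  have "kd (z - y) s = 0" for s
  proof (cases "s = {}")
    case True
    have "kd y {} = (\<Sum>l\<in>UNIV. pvar l * k l)" by (simp add: kdiff_def ksign_def y_def)
    then show ?thesis using True k(2) by (simp add: kd_diff)
  next
    case False
    then show ?thesis using kd_Kos[of "z - y" 0] zy by (simp add: Kos_def)
  qed
  then have "kd (z - y) = 0" by (intro ext) (simp only: zero_fun_apply)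
  then obtain w where w: "w \<in> Kos 2" "kd w = z - y"
    using polynomial_koszul_exact_1[OF zy] by blast
  have "z - kd w = y" using w(2) by simp
  moreover have "y s \<in> I" for s using k(1) I_0 by (simp add: y_def)
  moreover have "z \<in> Kos 1" "w \<in> Kos (Suc 1)" using w(1) z(1) by (simp_all add: Zyc_def numeral_2_eq_2)
  ultimately show ?thesis unfolding Bnd_def by blast
qed

text \<open>The coefficients of \<open>g\<close> as a combination of the variables form the cycle.
  Were it a boundary modulo \<open>I\<close>, they could be replaced by elements of
  \<open>I\<close>, against Nakayama.\<close>

lemma minimal_generator_cycle:
  assumes G: "minimal_generating_set poly_alg forms I G" and g: "g \<in> G" "g \<in> forms d"
  obtains z where "z \<in> Zyc 1" "khom d z" "z \<notin> Bnd 1"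
proof -
  have gI: "g \<in> I" using G g(1) by (auto simp: minimal_generating_set_def genideal_eq_span intro: pmod.span_base)
  obtain h where h: "g = (\<Sum>l\<in>UNIV. pvar l * h l)" "\<And>l. h l \<in> forms (d - 1)"
    using max_ideal_decomp[OF I_max[OF gI]] g(2) by blast
  define z where "z s = (if card s = 1 then h (the_elem s) else 0)" for s
  have z: "z \<in> Kos 1" by (simp add: z_def Kos_def)
  have kz: "kd z s = (if s = {} then g else 0)" for s
  proof (cases "s = {}")
    case True
    then show ?thesis by (simp add: kdiff_def ksign_def z_def h(1))
  next
    case False
    then show ?thesis using kd_Kos[of z 0] z by (simp add: Kos_def)
  qed
  show ?thesis
  proof
    show "z \<in> Zyc 1" using z gI I_0 by (simp add: Zyc_def kz)
    show "khom d z" using h(2) by (simp add: khom_def z_def)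
    show "z \<notin> Bnd 1"
    proof
      assume "z \<in> Bnd 1"
      then obtain w where w: "\<And>s. (z - kd w) s \<in> I" by (auto simp: Bnd_def)
      have "kd (z - kd w) {} = g" by (simp add: kd_diff kdiff_kdiff kz)
      then have "g = (\<Sum>l\<in>UNIV. pvar l * (z - kd w) {l})" by (simp add: kdiff_def ksign_def)
      then show False using minimal_generator_notin[OF G g, of "\<lambda>l. (z - kd w) {l}"] w by blast
    qed
  qed
qed

end

section \<open>Rate and slant\<close>

text \<open>The supremum is attained at \<open>i = 2\<close>, where the denominator is
  \<open>1\<close>.\<close>

lemma rate_eqI:
  assumes ub: "\<And>i. 2 \<le> i \<Longrightarrow> top_degree R gr i \<le> ereal (1 + (real i - 1) * c)"
    and lb: "ereal (1 + c) \<le> top_degree R gr 2"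
  shows "rate R gr = ereal c"
  unfolding rate_def
proof (rule antisym)
  show "(SUP i\<in>{2..}. (top_degree R gr i - 1) / ereal (real i - 1)) \<le> ereal c"
  proof (rule SUP_least)
    fix i :: nat assume i: "i \<in> {2..}"
    have "top_degree R gr i - 1 \<le> ereal (1 + (real i - 1) * c) - 1"
      using ub i by (intro ereal_minus_mono) auto
    also have "\<dots> = ereal ((real i - 1) * c)" by (simp add: one_ereal_def)
    finally have "(top_degree R gr i - 1) / ereal (real i - 1) \<le> ereal ((real i - 1) * c) / ereal (real i - 1)"
      using i by (intro ereal_divide_right_mono) auto
    also have "\<dots> = ereal c" using i by simp
    finally show "(top_degree R gr i - 1) / ereal (real i - 1) \<le> ereal c" .
  qed
  have "ereal c = ereal (1 + c) - 1" by (simp add: one_ereal_def)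
  also have "\<dots> \<le> top_degree R gr 2 - 1" using lb by (intro ereal_minus_mono) auto
  also have "\<dots> = (top_degree R gr 2 - 1) / ereal (real 2 - 1)" by (simp add: one_ereal_def[symmetric])
  also have "\<dots> \<le> (SUP i\<in>{2..}. (top_degree R gr i - 1) / ereal (real i - 1))"
    by (rule SUP_upper) simp
  finally show "ereal c \<le> (SUP i\<in>{2..}. (top_degree R gr i - 1) / ereal (real i - 1))" .
qed

lemma slant_eqI:
  assumes ub: "\<And>i. 1 \<le> i \<Longrightarrow> top_degree R gr i \<le> ereal (real i * c)"
    and lb: "ereal (2 * c) \<le> top_degree R gr 2"
  shows "slant R gr = ereal c"
  unfolding slant_def
proof (rule antisym)
  show "(SUP i\<in>{1..}. top_degree R gr i / ereal (real i)) \<le> ereal c"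
  proof (rule SUP_least)
    fix i :: nat assume i: "i \<in> {1..}"
    have "top_degree R gr i / ereal (real i) \<le> ereal (real i * c) / ereal (real i)"
      using i ub by (intro ereal_divide_right_mono) auto
    also have "\<dots> = ereal c" using i by simp
    finally show "top_degree R gr i / ereal (real i) \<le> ereal c" .
  qed
  have "ereal c = ereal (2 * c) / ereal (real 2)" by simp
  also have "\<dots> \<le> top_degree R gr 2 / ereal (real 2)" using lb by (intro ereal_divide_right_mono) auto
  also have "\<dots> \<le> (SUP i\<in>{1..}. top_degree R gr i / ereal (real i))"
    by (rule SUP_upper) simp
  finally show "ereal c \<le> (SUP i\<in>{1..}. top_degree R gr i / ereal (real i))" .
qed

text \<open>The bounds on Koszul homology that enter the recursion; beyond the number \<open>n\<close> of variables
  Koszul homology is zero and any value will do.\<close>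

definition koszul_bound :: "nat \<Rightarrow> int \<Rightarrow> int \<Rightarrow> nat \<Rightarrow> real"
  where "koszul_bound n \<tau> m i =
    (if i = 1 then of_int m else if i < n then of_int \<tau> + real i
     else if i = n then 2 * of_int \<tau> - 1 + real n else real i)"

text \<open>This is what the recursion needs for slope \<open>m - 1\<close>. At \<open>i = 1\<close>
  it is an equality; elsewhere \<open>m\<close> may be lowered to \<open>\<tau>\<close>, and the
  tight cases are \<open>i = 2\<close> and \<open>i = n = 4\<close> with \<open>\<tau> = 3\<close>,
  and \<open>i = n = 3\<close> with \<open>\<tau> = 4\<close>.\<close>

lemma koszul_bound_rate:
  assumes "n = 3 \<and> \<tau> \<ge> 4 \<or> n \<ge> 4 \<and> \<tau> \<ge> 3" "\<tau> \<le> m" "1 \<le> i"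
  shows "koszul_bound n \<tau> m i \<le> 1 + real i * (of_int m - 1)"
proof -
  define x y t where "x = real i" and "y = real n" and "t = real_of_int \<tau>"
  have tm: "t \<le> of_int m" using assms(2) by (simp add: t_def)
  have t: "t \<ge> 3" "y \<ge> 3" "y = 3 \<and> t \<ge> 4 \<or> y \<ge> 4" using assms(1) by (auto simp: t_def y_def)
  have mono: "1 + x * (t - 1) \<le> 1 + x * (of_int m - 1)" using tm by (simp add: x_def mult_left_mono)
  consider "i = 1" | "2 \<le> i" "i < n" | "i = n" "i \<noteq> 1" | "i > n" using assms(3) by linarith
  then have "koszul_bound n \<tau> m i \<le> 1 + x * (of_int m - 1)"
  proof cases
    case 1
    then show ?thesis by (simp add: koszul_bound_def x_def)
  next
    case 2
    \<comment> \<open>The difference of the two sides is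
      \<open>(x - 1) * (t - 3) + (x - 2)\<close>.\<close>
    have "(x - 1) * (t - 3) \<ge> 0" using 2 t by (simp add: x_def)
    then have "t + x \<le> 1 + x * (t - 1)" using 2 by (simp add: algebra_simps x_def)
    moreover have "koszul_bound n \<tau> m i = t + x" using 2 by (simp add: koszul_bound_def x_def t_def)
    ultimately show ?thesis using mono by linarith
  next
    case 3
    have "2 * t - 1 + y \<le> 1 + y * (t - 1)"
    proof (cases "y = 3")
      case True
      then show ?thesis using t by (simp add: algebra_simps)
    next
      case False
      \<comment> \<open>The difference of the two sides is
        \<open>(y - 2) * (t - 3) + (y - 4)\<close>.\<close>
      then have "(y - 2) * (t - 3) \<ge> 0" "y \<ge> 4" using t by auto
      then show ?thesis by (simp add: algebra_simps)
    qed
    moreover have "koszul_bound n \<tau> m i = 2 * t - 1 + y" "x = y"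
      using 3 by (simp_all add: koszul_bound_def x_def t_def y_def)
    ultimately show ?thesis using mono by (metis order_trans)
  next
    case 4
    have "x * (t - 2) \<ge> 0" using t by (simp add: x_def)
    then have "x \<le> 1 + x * (t - 1)" by (simp add: algebra_simps)
    moreover have "koszul_bound n \<tau> m i = x" using 4 assms(1) by (auto simp: koszul_bound_def x_def)
    ultimately show ?thesis using mono by linarith
  qed
  then show ?thesis by (simp add: x_def)
qed

text \<open>The counterpart for slope \<open>m / 2\<close>, again an equality at
  \<open>i = 1\<close>. The tight cases for \<open>m = \<tau>\<close> are \<open>i = 2\<close> and
  \<open>i = n = 5\<close> with \<open>\<tau> = 4\<close>, and \<open>i = n = 4\<close> with
  \<open>\<tau> = 6\<close>.\<close>

lemma koszul_bound_slant:
  assumes "n = 4 \<and> \<tau> \<ge> 6 \<or> n \<ge> 5 \<and> \<tau> \<ge> 4" "\<tau> \<le> m" "1 \<le> i"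
  shows "koszul_bound n \<tau> m i \<le> (real i + 1) * (of_int m / 2)"
proof -
  define x y t where "x = real i" and "y = real n" and "t = real_of_int \<tau>"
  have tm: "t \<le> of_int m" using assms(2) by (simp add: t_def)
  have t: "t \<ge> 4" "y \<ge> 4" "y = 4 \<and> t \<ge> 6 \<or> y \<ge> 5" using assms(1) by (auto simp: t_def y_def)
  have mono: "(x + 1) * (t / 2) \<le> (x + 1) * (of_int m / 2)" using tm by (intro mult_left_mono) (auto simp: x_def)
  consider "i = 1" | "2 \<le> i" "i < n" | "i = n" "i \<noteq> 1" | "i > n" using assms(3) by linarith
  then have "koszul_bound n \<tau> m i \<le> (x + 1) * (of_int m / 2)"
  proof cases
    case 1
    then show ?thesis by (simp add: koszul_bound_def x_def)
  next
    case 2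
    \<comment> \<open>Twice the difference of the two sides is
      \<open>(x - 1) * (t - 4) + 2 * (x - 2)\<close>.\<close>
    have "(x - 1) * (t - 4) \<ge> 0" using 2 t by (simp add: x_def)
    then have "t + x \<le> (x + 1) * (t / 2)" using 2 by (simp add: algebra_simps x_def)
    moreover have "koszul_bound n \<tau> m i = t + x" using 2 by (simp add: koszul_bound_def x_def t_def)
    ultimately show ?thesis using mono by linarith
  next
    case 3
    have "2 * t - 1 + y \<le> (y + 1) * (t / 2)"
    proof (cases "y = 4")
      case True
      then show ?thesis using t by (simp add: algebra_simps)
    next
      case False
      \<comment> \<open>Twice the difference of the two sides is
        \<open>(y - 3) * (t - 4) + 2 * (y - 5)\<close>.\<close>
      then have "(y - 3) * (t - 4) \<ge> 0" "y \<ge> 5" using t by auto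
      then show ?thesis by (simp add: algebra_simps)
    qed
    moreover have "koszul_bound n \<tau> m i = 2 * t - 1 + y" "x = y"
      using 3 by (simp_all add: koszul_bound_def x_def t_def y_def)
    ultimately show ?thesis using mono by (metis order_trans)
  next
    case 4
    have "(x + 1) * (t - 2) \<ge> 0" using t by (simp add: x_def)
    then have "x \<le> (x + 1) * (t / 2)" by (simp add: algebra_simps)
    moreover have "koszul_bound n \<tau> m i = x" using 4 assms(1) by (auto simp: koszul_bound_def x_def)
    ultimately show ?thesis using mono by linarith
  qed
  then show ?thesis by (simp add: x_def)
qed

lemma minimal_generator_mem: "minimal_generating_set poly_alg forms I G \<Longrightarrow> g \<in> G \<Longrightarrow> g \<in> I"
  unfolding minimal_generating_set_def genideal_eq_span using pmod.span_superset by blast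

lemma (in graded_ideal) Kos_trivial: "CARD('n) < i \<Longrightarrow> z \<in> Kos i \<Longrightarrow> z = 0"
proof
  fix s :: "'n set" assume "CARD('n) < i" "z \<in> Kos i"
  moreover have "card s \<le> CARD('n)" by (rule card_mono) auto
  ultimately show "z s = 0 s" by (simp add: Kos_def)
qed

theorem corollary4p2:
  fixes I :: "('n::finite, 'k::field) mpoly set" and \<tau> m :: int
  assumes n: "CARD('n) \<ge> 2"
    and I_hom: "homogeneous_ideal poly_alg forms I"
    and I_nz: "I \<noteq> {0}"
    and I_sub: "I \<subseteq> ideal_prod poly_alg (Idl\<^bsub>poly_alg\<^esub> variables) (Idl\<^bsub>poly_alg\<^esub> variables)"
    and tau: "\<tau> = initial_degree poly_alg forms I"
    and m: "m = max_generator_degree poly_alg forms I"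
    and art: "artinian_ring (quot_alg I)"
    and compressed: "compressed_level I"
  shows "(CARD('n) = 3 \<and> \<tau> \<ge> 4 \<or> CARD('n) \<ge> 4 \<and> \<tau> \<ge> 3 \<longrightarrow>
            rate (quot_alg I) (quot_forms I) = ereal (of_int m - 1)) \<and>
         (CARD('n) = 4 \<and> \<tau> \<ge> 6 \<or> CARD('n) \<ge> 5 \<and> \<tau> \<ge> 4 \<longrightarrow>
            slant (quot_alg I) (quot_forms I) = ereal (of_int m / 2))"
proof -
  \<comment> \<open>Used twice: in degree \<open>0\<close> it makes \<open>I\<close> proper, in
    degree \<open>1\<close> it gives \<open>m \<ge> 2\<close>.\<close>
  have low: "lookup f u = 0" if "f \<in> I" "mdeg u \<le> 1" for f u
    using I_sub that by (intro max_ideal_square) auto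
  interpret graded_ideal I
    by unfold_locales (use gideal_homogeneous[OF I_hom] low[of _ 0] in auto)
  obtain \<rho> s where level: "level I \<rho> s"
    and "\<forall>d. ring.dim (quot_alg I) (quot_constants I) (quot_forms I d)
         = min (ring.dim (poly_alg :: ('n, 'k) mpoly ring) constants (forms d))
               (s * ring.dim (poly_alg :: ('n, 'k) mpoly ring) constants (forms (\<rho> - d)))"
    using compressed unfolding compressed_level_def by blast
  then have hilbert: "ring.dim (quot_alg I) (quot_constants I) (quot_forms I d)
         = min (card (mons d :: ('n \<Rightarrow>\<^sub>0 nat) set)) (s * card (mons (\<rho> - d) :: ('n \<Rightarrow>\<^sub>0 nat) set))" for d
    unfolding dim_forms by blast
  note top = level_top[OF level hilbert]
  let ?D = "generator_degrees poly_alg forms I"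
  obtain G where G: "minimal_generating_set poly_alg forms I G"
    using minimal_generating_set_exists[where R = \<rho>] top by blast
  have fin: "finite ?D" using finite_generator_degrees[where R = \<rho>] top by blast
  have deg_m: "d \<le> m" if "g \<in> G" "g \<in> forms d" for g d
    unfolding m max_generator_degree_def using that G fin by (intro Max_ge) (auto simp: generator_degrees_def)
  have "G \<noteq> {}"
    using G I_nz by (auto simp: minimal_generating_set_def genideal_eq_span)
  then obtain g d where "g \<in> G" "g \<in> forms d" using G unfolding minimal_generating_set_def by blast
  then have "d \<in> ?D" using G unfolding generator_degrees_def by blast
  then have ne: "?D \<noteq> {}" by blast
  have "m \<in> ?D" unfolding m max_generator_degree_def by (rule Max_in[OF fin ne])
  then obtain Gm gm where gm: "minimal_generating_set poly_alg forms I Gm" "gm \<in> Gm" "gm \<in> forms m"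
    by (auto simp: generator_degrees_def)
  have "\<tau> \<in> ?D" unfolding tau initial_degree_def by (rule Min_in[OF fin ne])
  then obtain Gt gt where gt: "minimal_generating_set poly_alg forms I Gt" "gt \<in> Gt" "gt \<in> forms \<tau>"
    by (auto simp: generator_degrees_def)
  have tm: "\<tau> \<le> m" unfolding tau initial_degree_def using fin \<open>m \<in> ?D\<close> by (rule Min_le)
  have gtI: "gt \<in> I" "gt \<noteq> 0" and gmI: "gm \<in> I" "gm \<noteq> 0"
    using minimal_generator_mem[OF gt(1,2)] minimal_generator_nonzero[OF gt(1,2)]
      minimal_generator_mem[OF gm(1,2)] minimal_generator_nonzero[OF gm(1,2)] by blast+
  have m2: "2 \<le> m"
  proof -
    obtain u where u: "lookup gm u \<noteq> 0" using gmI(2) by (metis poly_mapping_eqI lookup_zero)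
    then have "\<not> mdeg u \<le> 1" using low[OF gmI(1)] by blast
    then show ?thesis using gm(3) u by (auto simp: forms_iff)
  qed
  note rho = level_rho_le[OF level hilbert gtI(1) gt(3) gtI(2)]
  have vanish: "z \<in> Bnd i"
    if i: "1 \<le> i" and z: "z \<in> Zyc i" "khom e z" and e: "real_of_int e > koszul_bound CARD('n) \<tau> m i" for i e z
  proof -
    have zK: "z \<in> Kos i" using z(1) by (simp add: Zyc_def)
    consider "i = 1" | "2 \<le> i" "i < CARD('n)" | "i = CARD('n)" "i \<noteq> 1" | "i > CARD('n)" using i by linarith
    then show ?thesis
    proof cases
      case 1
      then have em: "e > m" using e by (simp add: koszul_bound_def)
      have z1: "z \<in> Zyc 1" using z(1) 1 by simp
      show ?thesis unfolding 1 by (rule Zyc_1_Bnd[OF G _ z1 z(2) em]) (rule deg_m)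
    next
      case 2
      then have "real_of_int e > real_of_int (\<tau> + int i)" using e by (simp add: koszul_bound_def)
      then have e': "e > \<tau> + int i" by linarith
      show ?thesis
        by (rule koszul_vanishing[OF level_inj[OF level hilbert] top level_surj[OF level hilbert gtI(1) gt(3) gtI(2)] 2(2) z e'])
    next
      case 3
      \<comment> \<open>Coefficients of an element of degree \<open>e\<close> in
        \<open>Kos n\<close> have degree \<open>e - n\<close>, which exceeds
        \<open>2 * \<tau> - 1\<close> and hence \<open>\<rho>\<close>.\<close>
      then have "real_of_int e > real_of_int (2 * \<tau> - 1 + int i)" using e by (simp add: koszul_bound_def)
      then have e': "e - int i > \<rho>" using rho by linarith
      have "z s \<in> I" for s
        using z(2) zK top[OF e'] I_0 by (cases "card s = i") (auto simp: khom_def Kos_def)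
      then have "z \<in> IKos i" using zK by (simp add: IKos_def)
      then show ?thesis using IKos_sub_Bnd by blast
    next
      case 4
      then show ?thesis using Kos_trivial[OF 4 zK] gsub_0[OF gsub_Bnd] by simp
    qed
  qed
  obtain r dg A \<alpha> where lift: "lifted_resolution I r dg A \<alpha>"
    and Tor: "\<And>i j. trivial_group (Tor (quot_alg I) (quot_forms I) i j) \<longleftrightarrow>
      lifted_resolution.van r dg A i j (Kos 0) (Bnd 0)"
    using Tor_lift[where R = \<rho>] top by blast
  interpret L: lifted_resolution I r dg A \<alpha> by (rule lift)
  have lower: "ereal (of_int m) \<le> top_degree (quot_alg I) (quot_forms I) 2"
  proof -
    obtain z where z: "z \<in> Zyc 1" "khom m z" "z \<notin> Bnd 1"
      by (rule minimal_generator_cycle[OF gm])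
    \<comment> \<open>Vanishing would make the cycle of a generator of degree \<open>m\<close> a
      boundary; \<open>m \<ge> 2\<close> avoids the exceptional degree \<open>1\<close>.\<close>
    have "\<not> L.van 2 m (Kos 0) (Bnd 0)"
      using L.van_2_imp_Bnd[OF _ _ z(1,2)] z(3) m2 by auto
    then show ?thesis
      unfolding top_degree_def Tor by (intro SUP_upper) simp
  qed
  have upper: "top_degree (quot_alg I) (quot_forms I) p \<le> ereal (a p)"
    if a: "a 0 = 0" "\<And>p. real p \<le> a p"
      "\<And>q i. i \<ge> 1 \<Longrightarrow> a q + koszul_bound CARD('n) \<tau> m i \<le> a (q + i + 1)" for a p
    unfolding top_degree_def
  proof (rule SUP_least)
    fix j assume j: "j \<in> {j. \<not> trivial_group (Tor (quot_alg I) (quot_forms I) p j)}"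
    have "L.van p j (Kos 0) (Bnd 0)" if "real_of_int j > a p"
      by (rule L.van_residue_field[where a = a and h = "koszul_bound CARD('n) \<tau> m"]) (use a vanish that in auto)
    then show "ereal (of_int j) \<le> ereal (a p)" using j Tor by (auto simp: not_less[symmetric])
  qed
  show ?thesis
  proof (intro conjI impI)
    assume c: "CARD('n) = 3 \<and> \<tau> \<ge> 4 \<or> CARD('n) \<ge> 4 \<and> \<tau> \<ge> 3"
    \<comment> \<open>The line of slope \<open>m - 1\<close> with value \<open>1\<close> at
      \<open>p = 1\<close>. At \<open>p = 0\<close> it would give \<open>2 - m\<close>, possibly
      negative, while \<open>k\<close> in homological degree \<open>0\<close> has top degree
      \<open>0\<close>.\<close>
    define a where "a p = (if p = 0 then 0 else 1 + (real p - 1) * (of_int m - 1))" for p :: nat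
    have a_le: "real p \<le> a p" for p
    proof (cases "p = 0")
      case False
      then have "(real p - 1) * (of_int m - 2) \<ge> 0" using m2 by simp
      then show ?thesis using False by (simp add: a_def algebra_simps)
    qed (simp add: a_def)
    have rec: "a q + koszul_bound CARD('n) \<tau> m i \<le> a (q + i + 1)" if "i \<ge> 1" for q i
    proof -
      have "koszul_bound CARD('n) \<tau> m i \<le> 1 + real i * (of_int m - 1)"
        by (rule koszul_bound_rate[OF c tm that])
      \<comment> \<open>This weaker bound treats \<open>q = 0\<close> together with the other
        values; it needs \<open>m \<ge> 2\<close>.\<close>
      moreover have "a q \<le> real q * (of_int m - 1)"
        using m2 by (cases "q = 0") (simp_all add: a_def algebra_simps)
      ultimately show ?thesis by (simp add: a_def algebra_simps)
    qed
    show "rate (quot_alg I) (quot_forms I) = ereal (of_int m - 1)"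
    proof (rule rate_eqI)
      show "top_degree (quot_alg I) (quot_forms I) i \<le> ereal (1 + (real i - 1) * (of_int m - 1))" if "2 \<le> i" for i
        using upper[of a i] a_le rec that by (simp add: a_def)
      show "ereal (1 + (of_int m - 1)) \<le> top_degree (quot_alg I) (quot_forms I) 2" using lower by simp
    qed
  next
    assume c: "CARD('n) = 4 \<and> \<tau> \<ge> 6 \<or> CARD('n) \<ge> 5 \<and> \<tau> \<ge> 4"
    \<comment> \<open>The line through the origin with value \<open>m\<close> at
      \<open>p = 2\<close>, where the bound is attained.\<close>
    define a where "a p = real p * (of_int m / 2)" for p :: nat
    have a_le: "real p \<le> a p" for p
    proof -
      have "real p * (of_int m - 2) \<ge> 0" using m2 by simp
      then show ?thesis by (simp add: a_def algebra_simps)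
    qed
    have rec: "a q + koszul_bound CARD('n) \<tau> m i \<le> a (q + i + 1)" if "i \<ge> 1" for q i
      using koszul_bound_slant[OF c tm that] by (simp add: a_def algebra_simps add_divide_distrib)
    show "slant (quot_alg I) (quot_forms I) = ereal (of_int m / 2)"
    proof (rule slant_eqI)
      show "top_degree (quot_alg I) (quot_forms I) i \<le> ereal (real i * (of_int m / 2))" if "1 \<le> i" for i
        using upper[of a i] a_le rec by (simp add: a_def)
      show "ereal (2 * (of_int m / 2)) \<le> top_degree (quot_alg I) (quot_forms I) 2" using lower by simp
    qed
  qed
qed

end
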